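(* Let $Z\subseteq\mathbb{P}^2\times\mathbb{A}^1$ be a family of plane cubics with smooth total space, whose fibres $Z_t$ are smooth for $t\neq0$ and whose central fibre is the toric boundary $\Delta=D_0\cup D_1\cup D_2$. Let $E$ denote the general fibre. Of the $27$ embedded conics maximally tangent to $E$ at a single point, as $E$ degenerates to $\Delta$ exactly $18$ limit to split curves (limiting multi-degree $(1,1,0)$) and exactly $9$ limit to double lines (limiting multi-degree $(2,0,0)$).
   Context: Work over an algebraically closed field of characteristic zero. "General fibre" may be taken to be the geometric generic fibre of $Z\to\mathbb{A}^1$. An embedded conic maximally tangent to $E$ is an integral conic $C\subseteq\mathbb{P}^2$ which meets $E$ in exactly one point (so with multiplicity $6$); there are $27$ of these, one for each point of $E$ of index $6$, i.e. each $6$-torsion point of $(E,p_0)$ that is not $3$-torsion, where $p_0\in E$ is a fixed flex point. An embedded tangent curve to $E$ degenerates uniquely along with the cubic; its limit over $t=0$ is contained in $\Delta$ and, as a cycle, equals $d_0D_0+d_1D_1+d_2D_2$; the triple $(d_0,d_1,d_2)$ up to reordering is the limiting multi-degree. *)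

theory Defs
  imports
    "HOL-Analysis.Analysis"
    "HOL-Algebra.Algebraic_Closure_Type"
    "HOL-Library.Poly_Mapping"
    "HOL-Library.Multiset"
begin

section \<open>Ternary forms and plane curves\<close>

text \<open>The polynomial ring in the three variables \<open>var 0\<close>, \<open>var 1\<close>, \<open>var 2\<close>, indexed by the
  three-element type \<open>3\<close>; a monomial is its exponent vector.\<close>

type_synonym 'a ternary = "(3 \<Rightarrow>\<^sub>0 nat) \<Rightarrow>\<^sub>0 'a"

definition var :: "3 \<Rightarrow> 'a::comm_ring_1 ternary" where
  "var i = Poly_Mapping.single (Poly_Mapping.single i 1) 1"

definition const :: "'a::comm_ring_1 \<Rightarrow> 'a ternary" where
  "const c = Poly_Mapping.single 0 c"

definition homogeneous :: "nat \<Rightarrow> 'a::zero ternary \<Rightarrow> bool" where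
  "homogeneous d P \<longleftrightarrow> (\<forall>m\<in>Poly_Mapping.keys P. (\<Sum>i\<in>UNIV. Poly_Mapping.lookup m i) = d)"

definition teval :: "'a::comm_ring_1 ternary \<Rightarrow> 'a ^ 3 \<Rightarrow> 'a" where
  "teval P v = (\<Sum>m\<in>Poly_Mapping.keys P. Poly_Mapping.lookup P m *
                   (\<Prod>i\<in>UNIV. (v $ i) ^ Poly_Mapping.lookup m i))"

definition partial :: "3 \<Rightarrow> 'a::comm_ring_1 ternary \<Rightarrow> 'a ternary" where
  "partial i P = (\<Sum>m\<in>Poly_Mapping.keys P.
     Poly_Mapping.single (m - Poly_Mapping.single i 1)
       (of_nat (Poly_Mapping.lookup m i) * Poly_Mapping.lookup P m))"

text \<open>A point of the projective plane over a field is the set of its homogeneous coordinate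
  vectors.\<close>

definition proj_point :: "'a::field ^ 3 \<Rightarrow> ('a ^ 3) set" where
  "proj_point v = {c *s v | c. c \<noteq> 0}"

definition zero_locus :: "'a::field ternary \<Rightarrow> ('a ^ 3) set set" where
  "zero_locus P = {proj_point v | v. v \<noteq> 0 \<and> teval P v = 0}"

text \<open>A plane curve (effective divisor, possibly non-reduced) is a nonzero form up to nonzero
  scalars; it is integral iff the form is irreducible.\<close>

definition plane_curve :: "'a::field ternary \<Rightarrow> 'a ternary set" where
  "plane_curve P = {const c * P | c. c \<noteq> 0}"

definition smooth_form :: "'a::field ternary \<Rightarrow> bool" where
  "smooth_form P \<longleftrightarrow>
     (\<forall>v. v \<noteq> 0 \<and> teval P v = 0 \<longrightarrow> (\<exists>i. teval (partial i P) v \<noteq> 0))"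

definition tangent_conics :: "'a::field ternary \<Rightarrow> 'a ternary set set" where
  "tangent_conics P = {plane_curve Q | Q.
     homogeneous 2 Q \<and> Factorial_Ring.irreducible Q \<and> is_singleton (zero_locus Q \<inter> zero_locus P)}"


section \<open>Families of plane curves over the affine line\<close>

text \<open>A family over the affine line with coordinate \<open>t\<close> is given by a form whose coefficients are
  polynomials in \<open>t\<close>.\<close>

definition fibre :: "'k::field poly ternary \<Rightarrow> 'k \<Rightarrow> 'k ternary" where
  "fibre F s = Poly_Mapping.map (\<lambda>p. poly p s) F"

text \<open>Jacobian criterion at the closed points of the total space over \<open>U\<close>; the last disjunct
  is the derivative in the direction of the base.\<close>

definition smooth_total_space :: "'k::field set \<Rightarrow> 'k poly ternary \<Rightarrow> bool" where
  "smooth_total_space U F \<longleftrightarrow>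
     (\<forall>s\<in>U. \<forall>v. v \<noteq> 0 \<and> teval (fibre F s) v = 0 \<longrightarrow>
        (\<exists>i. teval (partial i (fibre F s)) v \<noteq> 0) \<or>
        teval (fibre (Poly_Mapping.map pderiv F) s) v \<noteq> 0)"

text \<open>A degeneration of smooth plane cubics to the toric boundary, over a Zariski neighbourhood
  \<open>U\<close> of the origin of the affine line. The base has to be allowed to be smaller than the whole
  line: a family with a cycle of three lines as its only singular fibre over the entire line does
  not exist, because its invariants \<open>c\<^sub>4\<close>, \<open>c\<^sub>6\<close> would be polynomials in \<open>t\<close> with \<open>c\<^sub>4 ^ 3 - c\<^sub>6 ^ 2\<close>
  a nonzero multiple of \<open>t ^ 3\<close> and \<open>c\<^sub>4\<close> nonzero at the origin, contradicting the Mason--Stothers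
  theorem.\<close>

definition cubic_degeneration :: "'k::field set \<Rightarrow> 'k poly ternary \<Rightarrow> bool" where
  "cubic_degeneration U F \<longleftrightarrow>
     finite (- U) \<and> 0 \<in> U \<and>
     homogeneous 3 F \<and>
     smooth_total_space U F \<and>
     (\<forall>s\<in>U. s \<noteq> 0 \<longrightarrow> smooth_form (fibre F s)) \<and>
     plane_curve (fibre F 0) = plane_curve (var 0 * var 1 * var 2)"

text \<open>The geometric generic point of the line: the algebraic closure of the function field.\<close>

type_synonym 'k gen = "'k poly fract alg_closure"

definition gen_of_poly :: "'k::field poly \<Rightarrow> 'k gen" where
  "gen_of_poly p = to_ac (to_fract p)"

definition generic_fibre :: "'k::field poly ternary \<Rightarrow> 'k gen ternary" where
  "generic_fibre F = Poly_Mapping.map gen_of_poly F"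


section \<open>Limits over the origin\<close>

text \<open>A specialisation from the geometric generic point to \<open>t = 0\<close>: a valuation ring of the
  algebraic closure of the function field whose centre on the line is the origin.\<close>

definition valuation_ring_over_0 :: "'k::field gen set \<Rightarrow> bool" where
  "valuation_ring_over_0 V \<longleftrightarrow>
     (\<forall>x\<in>V. \<forall>y\<in>V. x - y \<in> V \<and> x * y \<in> V) \<and>
     (\<forall>x. x \<in> V \<or> inverse x \<in> V) \<and>
     range gen_of_poly \<subseteq> V \<and>
     inverse (gen_of_poly [:0, 1:]) \<notin> V"

definition max_ideal :: "'a::field set \<Rightarrow> 'a set" where
  "max_ideal V = {x\<in>V. x = 0 \<or> inverse x \<notin> V}"

text \<open>The flat limit of a curve: the special fibre of its closure in the projective plane over
  \<open>V\<close>. The closure is cut out by a representative form with coefficients in \<open>V\<close> and not all in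
  the maximal ideal, and the special fibre by its reduction \<open>R\<close>; the residue field of \<open>V\<close> is
  \<open>'k\<close>.\<close>

definition has_limit :: "'k::field gen set \<Rightarrow> 'k gen ternary set \<Rightarrow> 'k ternary set \<Rightarrow> bool" where
  "has_limit V C D \<longleftrightarrow> (\<exists>Q R. C = plane_curve Q \<and> D = plane_curve R \<and> R \<noteq> 0 \<and>
     (\<forall>m. Poly_Mapping.lookup Q m \<in> V \<and>
          Poly_Mapping.lookup Q m - gen_of_poly [:Poly_Mapping.lookup R m:] \<in> max_ideal V))"

text \<open>The multi-degree of a limit contained in the toric boundary; \<open>D i\<close> is the line \<open>var i = 0\<close>.
  The multiset makes it insensitive to reordering.\<close>

definition has_limiting_multidegree ::
    "'k::field gen set \<Rightarrow> 'k gen ternary set \<Rightarrow> nat multiset \<Rightarrow> bool" where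
  "has_limiting_multidegree V C M \<longleftrightarrow> (\<exists>d0 d1 d2.
     M = {#d0, d1, d2#} \<and> has_limit V C (plane_curve (var 0 ^ d0 * var 1 ^ d1 * var 2 ^ d2)))"

end

(* Let F be a smooth plane cubic and Q a conic meeting it in a single point p. Parametrising Q shows
   that F restricted to Q is, up to a constant, the cube of the tangent line L of Q at p, so
   F = M Q + c L^3 for a line M. The line M is a flex line, and it is determined by Q. Conversely, for
   a fixed flex line M, in coordinates with F = x Q + k y^3, the possible conics are
   Q - k (3 s y^2 + 3 s^2 x y + s^3 x^2), where s runs through the roots of a cubic polynomial
   ("tangency") whose roots are distinct because F is smooth. There are nine flex lines.

   For the degenerating family, every flex line reduces to a side x = 0 of the triangle xyz = 0. Since
   the total space is smooth at the vertices, k has the valuation of t, and two of the roots s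
   lie in the maximal ideal, which gives the limit yz, while for the third one k s is a unit, and
   the dominating term k s^3 x^2 gives the double line. Each flex line thus contributes 2 + 1 conics. *)

theory Submission
  imports Defs
begin

text \<open>Forms are handled as functions on vectors: a change of coordinates is then a
  composition, and irreducibility of a conic means that it is not a product of two values of
  \<open>lin\<close>. Polynomials and plane curves return only for the final count, where a
  quadratic form is recovered from its function. The valuation ring lies in an algebraic closure, so
  no uniformiser and no integer valuation is available. Sizes are expressed by membership in V and
  in its maximal ideal M, and unknown roots are located by integral closedness. That a flex line
  reduces to a side has the same source: on the flex line the cubic is (l1 y + l2 z)^3 with l1^3 and
  l2^3 in \<tau> V; hence l1 and l2 are in M, so are the mixed coefficients 3 l1^2 l2 and 3 l1 l2^2,
  and these contain the unit e times the coefficients of the line. The number nine is derived: a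
  common zero of the cubic and its Hessian gives one flex line, this one allows a Weierstrass form,
  and there the other eight are z = m y + n x, where m^2 runs through the four roots of a separable
  quartic.\<close>

no_notation fps_nth (infixl \<open>$\<close> 75)

abbreviation "lookup \<equiv> Poly_Mapping.lookup"
abbreviation "keys \<equiv> Poly_Mapping.keys"
abbreviation "single \<equiv> Poly_Mapping.single"

abbreviation ternary_quadratic :: "'a::comm_ring_1 \<Rightarrow> 'a \<Rightarrow> 'a \<Rightarrow> 'a \<Rightarrow> 'a \<Rightarrow> 'a \<Rightarrow> 'a \<Rightarrow> 'a \<Rightarrow> 'a \<Rightarrow> 'a" where
  "ternary_quadratic a b c d e g x y z \<equiv> a * x^2 + b * x * y + c * y^2 + d * x * z + e * y * z + g * z^2"

abbreviation ternary_cubic :: "'a::comm_ring_1 \<Rightarrow> 'a \<Rightarrow> 'a \<Rightarrow> 'a \<Rightarrow> 'a \<Rightarrow> 'a \<Rightarrow> 'a \<Rightarrow> 'a \<Rightarrow> 'a \<Rightarrow> 'a \<Rightarrow> 'a \<Rightarrow> 'a \<Rightarrow> 'a \<Rightarrow> 'a" where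
  "ternary_cubic c1 c2 c3 c4 c5 c6 c7 c8 c9 c0 x y z \<equiv> c1 * x^3 + c2 * x^2 * y + c3 * x * y^2 + c4 * y^3
     + c5 * x^2 * z + c6 * x * y * z + c7 * y^2 * z + c8 * x * z^2 + c9 * y * z^2 + c0 * z^3"

lemmas expand_simps = algebra_simps power2_eq_square power3_eq_cube

section \<open>Forms and the functions they induce\<close>

lemma UNIV_3_distinct:
  fixes i j k :: 3
  assumes "i \<noteq> j" "j \<noteq> k" "i \<noteq> k"
  shows "UNIV = {i, j, k}"
proof -
  have "card {i, j, k} = CARD(3)"
    using assms by simp
  then show ?thesis
    by (intro card_subset_eq[symmetric]) auto
qed

section \<open>Evaluation of polynomials as a ring homomorphism\<close>

definition monom_fun :: "(3 \<Rightarrow>\<^sub>0 nat) \<Rightarrow> 'a::comm_ring_1 ^ 3 \<Rightarrow> 'a" where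
  "monom_fun m v = (\<Prod>i\<in>UNIV. (v $ i) ^ lookup m i)"

definition total_degree :: "(3 \<Rightarrow>\<^sub>0 nat) \<Rightarrow> nat" where
  "total_degree m = (\<Sum>i\<in>UNIV. lookup m i)"

lemma total_degree_add: "total_degree (m + n) = total_degree m + total_degree n"
  by (simp add: total_degree_def lookup_add sum.distrib)

lemma monom_fun_add: "monom_fun (m + n) v = monom_fun m v * monom_fun n v"
  by (simp add: monom_fun_def lookup_add power_add prod.distrib)

text \<open>Different polynomials have different key sets; their evaluations can be added once they
  are summed over one common finite set.\<close>

lemma teval_superset:
  assumes "finite S" "keys P \<subseteq> S"
  shows "teval P v = (\<Sum>m\<in>S. lookup P m * monom_fun m v)"
  unfolding teval_def monom_fun_def
  by (rule sum.mono_neutral_left) (use assms in \<open>auto simp: in_keys_iff\<close>)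

lemma teval_0 [simp]: "teval 0 v = 0"
  by (simp add: teval_def)

lemma teval_single: "teval (single m c) v = c * monom_fun m v"
  by (subst teval_superset[of "{m}"]) (auto simp: keys_single split: if_splits)

lemma teval_add: "teval (P + Q) v = teval P v + teval Q v"
proof -
  let ?S = "keys P \<union> keys Q"
  have "teval R v = (\<Sum>m\<in>?S. lookup R m * monom_fun m v)"
    if "R \<in> {P, Q, P + Q}" for R
    using that Poly_Mapping.keys_add[of P Q] by (intro teval_superset) auto
  then show ?thesis
    by (simp add: lookup_add distrib_right sum.distrib)
qed

lemma teval_sum: "teval (\<Sum>x\<in>A. P x) v = (\<Sum>x\<in>A. teval (P x) v)"
  by (induction A rule: infinite_finite_induct) (auto simp: teval_add)

lemma sum_singles: "P = (\<Sum>m\<in>keys P. single m (lookup P m))"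
proof (rule poly_mapping_eqI)
  fix k
  have "(\<Sum>m\<in>keys P. lookup (single m (lookup P m)) k)
      = (\<Sum>m\<in>keys P. if m = k then lookup P k else 0)"
    by (rule sum.cong) (auto simp: lookup_single when_def)
  then show "lookup P k = lookup
      (\<Sum>m\<in>keys P. single m (lookup P m)) k"
    by (simp add: lookup_sum in_keys_iff)
qed

lemma mult_as_singles:
  fixes P Q :: "'a::comm_ring_1 ternary"
  shows "P * Q = (\<Sum>m\<in>keys P. \<Sum>n\<in>keys Q.
           single (m + n) (lookup P m * lookup Q n))"
  by (subst sum_singles[of P], subst sum_singles[of Q]) (simp add: sum_product mult_single)

lemma teval_mult:
  fixes P Q :: "'a::comm_ring_1 ternary"
  shows "teval (P * Q) v = teval P v * teval Q v"
proof -
  have "teval P v * teval Q v = (\<Sum>m\<in>keys P. \<Sum>n\<in>keys Q.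
      (lookup P m * monom_fun m v) * (lookup Q n * monom_fun n v))"
    by (simp add: teval_def monom_fun_def sum_product)
  then show ?thesis
    by (subst mult_as_singles) (simp add: teval_sum teval_single monom_fun_add mult_ac)
qed

lemma teval_const [simp]: "teval (const c) v = c"
  by (simp add: const_def teval_single monom_fun_def)

lemma teval_one [simp]: "teval 1 v = 1"
  using teval_const[of 1 v] by (simp add: const_def)

lemma teval_var [simp]: "teval (var i) v = v $ i"
proof -
  have "(\<Prod>j\<in>UNIV. v $ j ^ lookup (single i 1) j)
      = (\<Prod>j\<in>UNIV. if j = i then v $ i else 1)"
    by (rule prod.cong) (auto simp: lookup_single when_def)
  then show ?thesis
    by (simp add: var_def teval_single monom_fun_def)
qed

lemma lookup_const_mult:
  fixes P :: "'a::comm_ring_1 ternary"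
  shows "lookup (const c * P) m = c * lookup P m"
  unfolding const_def mult_map_scale_conv_mult[symmetric]
  by (simp add: Poly_Mapping.map.rep_eq when_def)

lemma homogeneous_iff:
  "homogeneous d P \<longleftrightarrow> (\<forall>m\<in>keys P. total_degree m = d)"
  by (simp add: homogeneous_def total_degree_def)

lemma homogeneous_0: "homogeneous d 0"
  by (simp add: homogeneous_def)

lemma homogeneous_add:
  "homogeneous d P \<Longrightarrow> homogeneous d Q \<Longrightarrow> homogeneous d (P + Q)"
  unfolding homogeneous_iff using Poly_Mapping.keys_add[of P Q] by blast

lemma homogeneous_mult:
  fixes P Q :: "'a::comm_ring_1 ternary"
  shows "homogeneous d P \<Longrightarrow> homogeneous e Q \<Longrightarrow> homogeneous (d + e) (P * Q)"
  unfolding homogeneous_iff using keys_mult[of P Q] by (fastforce simp: total_degree_add)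

lemma homogeneous_const: "homogeneous 0 (const c)"
  by (auto simp: homogeneous_def const_def keys_single)

lemma total_degree_single: "total_degree (single i n) = n"
proof -
  have "(\<Sum>j\<in>UNIV. lookup (single i n) j) = (\<Sum>j\<in>UNIV. if j = i then n else 0)"
    by (rule sum.cong) (auto simp: lookup_single when_def)
  then show ?thesis
    by (simp add: total_degree_def)
qed

lemma homogeneous_var: "homogeneous 1 (var i)"
  by (auto simp: homogeneous_iff var_def keys_single total_degree_single)

text \<open>A form is remembered only through its function, together with the degree and a set
  containing the coefficients of some representing polynomial. With \<open>I\<close> equal to
  \<open>UNIV\<close>, a valuation ring or its maximal ideal, the closure rules below replace most
  computations with coefficients.\<close>

definition form_in :: "'a::comm_ring_1 set \<Rightarrow> nat \<Rightarrow> ('a ^ 3 \<Rightarrow> 'a) \<Rightarrow> bool" where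
  "form_in I d f \<longleftrightarrow>
     (\<exists>P. homogeneous d P \<and> (\<forall>m. lookup P m \<in> I) \<and> (\<forall>v. teval P v = f v))"

abbreviation form :: "nat \<Rightarrow> ('a::comm_ring_1 ^ 3 \<Rightarrow> 'a) \<Rightarrow> bool" where
  "form \<equiv> form_in UNIV"

lemma form_iff: "form d f \<longleftrightarrow> (\<exists>P. homogeneous d P \<and> (\<forall>v. teval P v = f v))"
  by (simp add: form_in_def)

lemma form_teval: "homogeneous d P \<Longrightarrow> form d (teval P)"
  by (auto simp: form_iff)

lemma form_in_mono: "form_in I d f \<Longrightarrow> I \<subseteq> J \<Longrightarrow> form_in J d f"
  unfolding form_in_def by blast

lemma form_in_add:
  assumes "\<And>x y. x \<in> I \<Longrightarrow> y \<in> I \<Longrightarrow> x + y \<in> I" "form_in I d f" "form_in I d g"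
  shows "form_in I d (\<lambda>v. f v + g v)"
proof -
  obtain P Q where "homogeneous d P" "\<forall>m. lookup P m \<in> I" "\<forall>v. teval P v = f v"
    "homogeneous d Q" "\<forall>m. lookup Q m \<in> I" "\<forall>v. teval Q v = g v"
    using assms(2,3) unfolding form_in_def by blast
  then show ?thesis
    unfolding form_in_def
    by (intro exI[of _ "P + Q"]) (auto simp: homogeneous_add teval_add lookup_add assms(1))
qed

lemma form_in_mult:
  assumes "\<And>x y. x \<in> I \<Longrightarrow> y \<in> J \<Longrightarrow> x * y \<in> L" "0 \<in> L" "\<And>x y. x \<in> L \<Longrightarrow> y \<in> L \<Longrightarrow> x + y \<in> L"
    and "form_in I d f" "form_in J e g"
  shows "form_in L (d + e) (\<lambda>v. f v * g v)"
proof -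
  obtain P Q where PQ: "homogeneous d P" "\<forall>m. lookup P m \<in> I" "\<forall>v. teval P v = f v"
    "homogeneous e Q" "\<forall>m. lookup Q m \<in> J" "\<forall>v. teval Q v = g v"
    using assms(4,5) unfolding form_in_def by blast
  have sumL: "(\<Sum>x\<in>A. h x) \<in> L" if "\<forall>x\<in>A. h x \<in> L" for A :: "(3 \<Rightarrow>\<^sub>0 nat) set" and h
    using that by (induction A rule: infinite_finite_induct) (auto intro: assms(2,3))
  have "lookup (P * Q) m \<in> L" for m
    unfolding mult_as_singles[of P Q] lookup_sum
    using PQ assms(1,2) by (intro sumL ballI) (auto simp: lookup_single when_def)
  with PQ show ?thesis
    unfolding form_in_def
    by (intro exI[of _ "P * Q"]) (auto simp: homogeneous_mult teval_mult)
qed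

lemma form_in_const: "c \<in> I \<Longrightarrow> 0 \<in> I \<Longrightarrow> form_in I 0 (\<lambda>v. c)"
  unfolding form_in_def
  by (intro exI[of _ "const c"] conjI homogeneous_const) (auto, simp add: const_def lookup_single when_def)

lemma form_in_var: "1 \<in> I \<Longrightarrow> 0 \<in> I \<Longrightarrow> form_in I 1 (\<lambda>v. v $ i)"
  unfolding form_in_def
  by (intro exI[of _ "var i"] conjI homogeneous_var) (auto, simp add: var_def lookup_single when_def)

lemma form_in_zero: "0 \<in> I \<Longrightarrow> form_in I d (\<lambda>v. 0)"
  unfolding form_in_def by (intro exI[of _ 0]) (auto simp: homogeneous_0)

lemma form_in_scale:
  assumes "\<And>x. x \<in> I \<Longrightarrow> c * x \<in> J" "form_in I d f"
  shows "form_in J d (\<lambda>v. c * f v)"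
proof -
  obtain P where P: "homogeneous d P" "\<forall>m. lookup P m \<in> I" "\<forall>v. teval P v = f v"
    using assms(2) unfolding form_in_def by blast
  with assms(1) show ?thesis
    unfolding form_in_def using homogeneous_mult[OF homogeneous_const[of c], of d P]
    by (intro exI[of _ "const c * P"]) (auto simp: teval_mult lookup_const_mult)
qed

lemma form_add: "form d f \<Longrightarrow> form d g \<Longrightarrow> form d (\<lambda>v. f v + g v)"
  by (rule form_in_add) auto

lemma form_mult: "form d f \<Longrightarrow> form e g \<Longrightarrow> form (d + e) (\<lambda>v. f v * g v)"
  by (rule form_in_mult) auto

lemma form_const: "form 0 (\<lambda>v. c)"
  by (rule form_in_const) auto

lemma form_var: "form 1 (\<lambda>v. v $ i)"
  by (rule form_in_var) auto

lemma form_scale: "form d f \<Longrightarrow> form d (\<lambda>v. c * f v)"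
  by (rule form_in_scale) auto

lemma form_diff:
  assumes "form d f" "form d g"
  shows "form d (\<lambda>v. f v - g v)"
  using form_add[OF assms(1) form_scale[OF assms(2), of "-1"]] by simp

lemma form_sum: "(\<And>x. x \<in> A \<Longrightarrow> form d (f x)) \<Longrightarrow> form d (\<lambda>v. \<Sum>x\<in>A. f x v)"
  by (induction A rule: infinite_finite_induct) (auto intro: form_in_zero form_add)

lemma form_power: "form d f \<Longrightarrow> form (n * d) (\<lambda>v. f v ^ n)"
proof (induction n)
  case 0
  show ?case using form_const[of 1] by simp
next
  case (Suc n)
  then show ?case using form_mult[OF Suc.prems Suc.IH[OF Suc.prems]] by simp
qed

lemma form_prod: "finite A \<Longrightarrow> (\<And>x. x \<in> A \<Longrightarrow> form (d x) (f x)) \<Longrightarrow> form (\<Sum>x\<in>A. d x) (\<lambda>v. \<Prod>x\<in>A. f x v)"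
  by (induction A rule: finite_induct) (auto intro: form_const form_mult)

text \<open>Every coordinate of \<open>A *v v\<close> is a form of degree 1, so a monomial of total
  degree d turns into a product of d such forms.\<close>

lemma form_linear_substitution:
  fixes A :: "'a::comm_ring_1 ^ 3 ^ 3"
  assumes "form d f"
  shows "form d (\<lambda>v. f (A *v v))"
proof -
  obtain P where P: "homogeneous d P" "\<And>v. teval P v = f v"
    using assms by (auto simp: form_iff)
  have coord: "form 1 (\<lambda>v. (A *v v) $ i)" for i
    unfolding matrix_vector_mult_def by (simp del: One_nat_def) (intro form_sum form_scale form_var)
  have "form d (\<lambda>v. monom_fun m (A *v v))" if "m \<in> keys P" for m
  proof -
    have "form (\<Sum>i\<in>UNIV. lookup m i * 1) (\<lambda>v. monom_fun m (A *v v))"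
      unfolding monom_fun_def by (intro form_prod form_power coord) auto
    moreover have "(\<Sum>i\<in>UNIV. lookup m i * 1) = d"
      using P(1) that by (simp add: homogeneous_def)
    ultimately show ?thesis by simp
  qed
  then have "form d (\<lambda>v. \<Sum>m\<in>keys P. lookup P m * monom_fun m (A *v v))"
    by (intro form_sum form_scale)
  moreover have "f (A *v v) = (\<Sum>m\<in>keys P. lookup P m * monom_fun m (A *v v))" for v
    by (simp add: P(2)[symmetric] teval_def monom_fun_def)
  ultimately show ?thesis by simp
qed

text \<open>The order of the three coordinates is left open, since later the side of the triangle to
  which a flex line reduces can be any of the three.\<close>

definition expo :: "3 \<Rightarrow> 3 \<Rightarrow> 3 \<Rightarrow> nat \<Rightarrow> nat \<Rightarrow> nat \<Rightarrow> (3 \<Rightarrow>\<^sub>0 nat)" where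
  "expo i j k a b c = single i a + single j b + single k c"

context
  fixes i j k :: 3
  assumes distinct: "i \<noteq> j" "j \<noteq> k" "i \<noteq> k"
begin

lemma lookup_expo [simp]:
  "lookup (expo i j k a b c) i = a"
  "lookup (expo i j k a b c) j = b"
  "lookup (expo i j k a b c) k = c"
  using distinct by (auto simp: expo_def lookup_add lookup_single when_def)

lemma expo_eq_iff [simp]: "expo i j k a b c = expo i j k a' b' c' \<longleftrightarrow> a = a' \<and> b = b' \<and> c = c'"
  by (metis lookup_expo)

lemma expo_cases: "m = expo i j k (lookup m i) (lookup m j) (lookup m k)"
proof (rule poly_mapping_eqI)
  fix l :: 3
  have "l \<in> {i, j, k}"
    using UNIV_3_distinct[OF distinct] by blast
  then show "lookup m l = lookup (expo i j k (lookup m i)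
      (lookup m j) (lookup m k)) l"
    by auto
qed

lemma total_degree_expo [simp]: "total_degree (expo i j k a b c) = a + b + c"
  by (simp add: expo_def total_degree_add total_degree_single)

lemma monom_fun_expo [simp]: "monom_fun (expo i j k a b c) v = (v $ i) ^ a * (v $ j) ^ b * (v $ k) ^ c"
  unfolding monom_fun_def UNIV_3_distinct[OF distinct] using distinct by (simp add: mult_ac)

text \<open>The third exponent is forced by the degree, so the possible exponent vectors are indexed
  by pairs a, b with a + b \<le> d.\<close>

lemma teval_expansion:
  assumes "homogeneous d P"
  shows "teval P v = (\<Sum>a\<le>d. \<Sum>b\<le>d - a. lookup P (expo i j k a b (d - a - b)) *
           ((v $ i) ^ a * (v $ j) ^ b * (v $ k) ^ (d - a - b)))"
proof -
  define T where "T = (SIGMA a:{..d}. {..d - a})"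
  define g where "g = (\<lambda>(a, b). expo i j k a b (d - a - b))"
  have "inj_on g T"
    by (auto simp: inj_on_def g_def T_def)
  have "keys P \<subseteq> g ` T"
  proof
    fix m assume "m \<in> keys P"
    then have d: "total_degree m = d"
      using assms by (simp add: homogeneous_iff)
    obtain a b c where m: "m = expo i j k a b c"
      using expo_cases by blast
    with d have "(a, b) \<in> T" "m = g (a, b)"
      by (auto simp: T_def g_def)
    then show "m \<in> g ` T" by blast
  qed
  then have "teval P v = (\<Sum>m\<in>g ` T. lookup P m * monom_fun m v)"
    by (intro teval_superset) (auto simp: T_def)
  also have "\<dots> = (\<Sum>x\<in>T. lookup P (g x) * monom_fun (g x) v)"
    using \<open>inj_on g T\<close> by (simp add: sum.reindex)
  also have "\<dots> = (\<Sum>a\<le>d. \<Sum>b\<le>d - a. lookup P (expo i j k a b (d - a - b)) *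
           ((v $ i) ^ a * (v $ j) ^ b * (v $ k) ^ (d - a - b)))"
    unfolding T_def g_def by (subst sum.Sigma) (auto simp: split_def)
  finally show ?thesis .
qed

lemma quadratic_teval:
  assumes "homogeneous 2 P"
  shows "teval P v = lookup P (expo i j k 2 0 0) * (v $ i)^2 + lookup P (expo i j k 1 1 0) * (v $ i) * (v $ j)
    + lookup P (expo i j k 0 2 0) * (v $ j)^2 + lookup P (expo i j k 1 0 1) * (v $ i) * (v $ k)
    + lookup P (expo i j k 0 1 1) * (v $ j) * (v $ k) + lookup P (expo i j k 0 0 2) * (v $ k)^2"
  by (subst teval_expansion[OF assms]) (simp add: numeral_2_eq_2 algebra_simps)

lemma linear_form_in:
  assumes "form_in I 1 f"
  obtains a b c where "{a, b, c} \<subseteq> I" "\<And>v. f v = a * (v $ i) + b * (v $ j) + c * (v $ k)"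
proof -
  obtain P where P: "homogeneous 1 P" "\<And>m. lookup P m \<in> I" "\<And>v. teval P v = f v"
    using assms unfolding form_in_def by blast
  show ?thesis
    by (rule that[of "lookup P (expo i j k 1 0 0)" "lookup P (expo i j k 0 1 0)"
          "lookup P (expo i j k 0 0 1)"])
       (use P(2) in \<open>auto simp: P(3)[symmetric] teval_expansion[OF P(1)] algebra_simps\<close>)
qed

lemma quadratic_form_in:
  assumes "form_in I 2 f"
  obtains a b c d e g where "{a, b, c, d, e, g} \<subseteq> I"
    "\<And>v. f v = ternary_quadratic a b c d e g (v $ i) (v $ j) (v $ k)"
proof -
  obtain P where P: "homogeneous 2 P" "\<And>m. lookup P m \<in> I" "\<And>v. teval P v = f v"
    using assms unfolding form_in_def by blast
  show ?thesis
    by (rule that[OF _ quadratic_teval[OF P(1), unfolded P(3)]]) (use P(2) in blast)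
qed

lemma cubic_teval:
  assumes "homogeneous 3 P"
  shows "teval P v = lookup P (expo i j k 3 0 0) * (v $ i)^3
    + lookup P (expo i j k 2 1 0) * (v $ i)^2 * (v $ j)
    + lookup P (expo i j k 1 2 0) * (v $ i) * (v $ j)^2
    + lookup P (expo i j k 0 3 0) * (v $ j)^3
    + lookup P (expo i j k 2 0 1) * (v $ i)^2 * (v $ k)
    + lookup P (expo i j k 1 1 1) * (v $ i) * (v $ j) * (v $ k)
    + lookup P (expo i j k 0 2 1) * (v $ j)^2 * (v $ k)
    + lookup P (expo i j k 1 0 2) * (v $ i) * (v $ k)^2
    + lookup P (expo i j k 0 1 2) * (v $ j) * (v $ k)^2
    + lookup P (expo i j k 0 0 3) * (v $ k)^3"
proof -
  have sum3: "(\<Sum>a\<le>3. \<Sum>b\<le>3 - a. g a b) = g 3 0 + g 2 1 + g 1 2 + g 0 3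
      + g 2 0 + g 1 1 + g 0 2 + g 1 0 + g 0 1 + g 0 0" for g :: "nat \<Rightarrow> nat \<Rightarrow> 'b::comm_monoid_add"
    by (simp add: numeral_3_eq_3 numeral_2_eq_2 ac_simps)
  have "3 - 2 = (1::nat)" "3 - 1 = (2::nat)"
    by simp_all
  then show ?thesis
    by (simp only: teval_expansion[OF assms] sum3 diff_zero diff_self_eq_0 diff_diff_eq2 diff_add_zero
      power_0 power_one_right mult_1_left mult_1_right mult.assoc minus_nat.diff_0 cancel_comm_monoid_add_class.diff_cancel)
      (simp add: mult.assoc)
qed

lemma cubic_form_in:
  assumes "form_in I 3 f"
  obtains c1 c2 c3 c4 c5 c6 c7 c8 c9 c0 where "{c1, c2, c3, c4, c5, c6, c7, c8, c9, c0} \<subseteq> I"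
    "\<And>v. f v = ternary_cubic c1 c2 c3 c4 c5 c6 c7 c8 c9 c0 (v $ i) (v $ j) (v $ k)"
proof -
  obtain P where P: "homogeneous 3 P" "\<And>m. lookup P m \<in> I" "\<And>v. teval P v = f v"
    using assms unfolding form_in_def by blast
  show ?thesis
    by (rule that[OF _ cubic_teval[OF P(1), unfolded P(3)]]) (use P(2) in blast)
qed

end

section \<open>Conics meeting a cubic in one point\<close>

definition lin :: "'a::comm_ring_1 ^ 3 \<Rightarrow> 'a ^ 3 \<Rightarrow> 'a" where
  "lin m v = (\<Sum>i\<in>UNIV. m $ i * v $ i)"

definition vec3 :: "'a::zero \<Rightarrow> 'a \<Rightarrow> 'a \<Rightarrow> 'a ^ 3" where
  "vec3 x y z = vector [x, y, z]"

lemma vec3_nth [simp]: "vec3 x y z $ 1 = x" "vec3 x y z $ 2 = y" "vec3 x y z $ 3 = z"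
  by (simp_all add: vec3_def)

lemma vec3_eq_iff: "v = w \<longleftrightarrow> v $ 1 = w $ 1 \<and> v $ 2 = w $ 2 \<and> v $ (3::3) = w $ 3"
  by (simp add: vec_eq_iff forall_3)

lemma lin_3: "lin m v = m $ 1 * v $ 1 + m $ 2 * v $ 2 + m $ 3 * v $ 3"
  by (simp add: lin_def sum_3)

lemma lin_add: "lin m (v + w) = lin m v + lin m w"
  by (simp add: lin_def distrib_left sum.distrib)

lemma lin_smult: "lin m (c *s v) = c * lin m v"
  by (simp add: lin_def sum_distrib_left mult_ac)

lemma lin_smult_left: "lin (c *s m) v = c * lin m v"
  by (simp add: lin_def sum_distrib_left mult_ac)

lemma lin_matrix: "lin m (A *v v) = lin (m v* A) v" for A :: "'a::comm_ring_1 ^ 3 ^ 3"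
  by (simp add: lin_3 matrix_vector_mult_def vector_matrix_mult_def sum_3 algebra_simps)

lemma lin_eq_iff: "(\<forall>v. lin m v = lin m' v) \<longleftrightarrow> m = m'"
proof
  assume *: "\<forall>v. lin m v = lin m' v"
  show "m = m'"
    using *[rule_format, of "vec3 1 0 0"] *[rule_format, of "vec3 0 1 0"] *[rule_format, of "vec3 0 0 1"]
    by (simp add: lin_3 vec3_eq_iff)
qed simp

lemma form_lin: "form 1 (lin m)"
proof -
  have "form 1 (\<lambda>v. \<Sum>i\<in>UNIV. m $ i * v $ i)"
    by (intro form_sum form_scale form_var)
  then show ?thesis by (simp add: lin_def[abs_def])
qed

lemma form_mult_11: "form 1 f \<Longrightarrow> form 1 g \<Longrightarrow> form 2 (\<lambda>v. f v * g v)"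
  using form_mult[of 1 f 1 g] by (simp add: numeral_2_eq_2)

lemma form_quadratic:
  "form 2 (\<lambda>v. ternary_quadratic a b c d e g (v $ i) (v $ j) (v $ k))"
  unfolding power2_eq_square mult.assoc
  by (intro form_add form_scale form_mult_11 form_var)

text \<open>Instead of partial derivatives: along every line through p the cubic starts in order 2.
  This formulation commutes with linear substitutions. For a cubic form the zero vector always
  satisfies it, hence the exception for 0 in \<open>smooth\<close>.\<close>

definition singular_at :: "('a::field ^ 3 \<Rightarrow> 'a) \<Rightarrow> 'a ^ 3 \<Rightarrow> bool" where
  "singular_at F p \<longleftrightarrow> (\<forall>w. \<exists>a b. \<forall>t. F (p + t *s w) = t^2 * a + t^3 * b)"

definition smooth :: "('a::field ^ 3 \<Rightarrow> 'a) \<Rightarrow> bool" where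
  "smooth F \<longleftrightarrow> (\<forall>p. singular_at F p \<longrightarrow> p = 0)"

text \<open>The constant in front of the cube is absorbed into l by a cube root. If l vanishes on
  the line, the line is contained in the cubic; for smooth cubics this is excluded inside
  \<open>flex_normal_form\<close>.\<close>

definition flex_line :: "('a::field ^ 3 \<Rightarrow> 'a) \<Rightarrow> 'a ^ 3 \<Rightarrow> bool" where
  "flex_line F m \<longleftrightarrow> m \<noteq> 0 \<and> (\<exists>l. \<forall>v. lin m v = 0 \<longrightarrow> F v = (lin l v)^3)"

text \<open>The functional counterpart of a member of \<open>tangent_conics\<close>, see
  \<open>tangent_conics_eq\<close>: irreducibility becomes not being a product of two linear forms,
  and a single intersection point becomes a one-dimensional set of common zeros.\<close>

definition tangent_conic_fun :: "('a::field ^ 3 \<Rightarrow> 'a) \<Rightarrow> ('a ^ 3 \<Rightarrow> 'a) \<Rightarrow> bool" where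
  "tangent_conic_fun F Q \<longleftrightarrow> form 2 Q \<and> (\<nexists>a b. \<forall>v. Q v = lin a v * lin b v) \<and>
     (\<exists>p. p \<noteq> 0 \<and> (\<forall>v. Q v = 0 \<and> F v = 0 \<longleftrightarrow> (\<exists>c. v = c *s p)))"

text \<open>The scale of m is tied to that of Q: multiplying Q by c divides m by c, see
  \<open>on_flex_scale\<close>.\<close>

definition on_flex :: "('a::field ^ 3 \<Rightarrow> 'a) \<Rightarrow> ('a ^ 3 \<Rightarrow> 'a) \<Rightarrow> 'a ^ 3 \<Rightarrow> bool" where
  "on_flex F Q m \<longleftrightarrow> (\<exists>l c. \<forall>v. F v = lin m v * Q v + c * (lin l v)^3)"

subsection \<open>Linear substitutions\<close>

lemma invertible_obtain:
  fixes A :: "'a::field ^ 3 ^ 3"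
  assumes "invertible A"
  obtains B where "invertible B" "\<And>v. A *v (B *v v) = v" "\<And>v. B *v (A *v v) = v"
    "\<And>m. (m v* B) v* A = m" "\<And>m. (m v* A) v* B = m"
proof -
  from assms obtain B where AB: "A ** B = mat 1" "B ** A = mat 1"
    unfolding invertible_def by blast
  then have "invertible B" unfolding invertible_def by blast
  moreover have "A *v (B *v v) = v" "B *v (A *v v) = v" for v
    using AB by (simp_all add: matrix_vector_mul_assoc matrix_vector_mul_lid)
  moreover have "(m v* B) v* A = m" "(m v* A) v* B = m" for m
    using AB by (simp_all add: vector_matrix_mul_assoc vector_matrix_mul_rid)
  ultimately show ?thesis using that by blast
qed

lemma matrix_vector_eq_0:
  fixes A :: "'a::field ^ 3 ^ 3"
  assumes "invertible A"
  shows "A *v v = 0 \<longleftrightarrow> v = 0" "m v* A = 0 \<longleftrightarrow> m = 0"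
proof -
  obtain B where B: "\<And>v. B *v (A *v v) = v" "\<And>m. (m v* A) v* B = m"
    using invertible_obtain[OF assms] by metis
  show "A *v v = 0 \<longleftrightarrow> v = 0" by (metis B(1) matrix_vector_mult_0_right)
  show "m v* A = 0 \<longleftrightarrow> m = 0" by (metis B(2) vector_matrix_mult_0)
qed

lemma smooth_substitution:
  fixes A :: "'a::field ^ 3 ^ 3"
  assumes "smooth F" "invertible A"
  shows "smooth (\<lambda>v. F (A *v v))"
  unfolding smooth_def
proof (intro allI impI)
  fix p assume p: "singular_at (\<lambda>v. F (A *v v)) p"
  obtain B where B: "\<And>v. A *v (B *v v) = v"
    using invertible_obtain[OF assms(2)] by metis
  have "singular_at F (A *v p)"
    unfolding singular_at_def
  proof
    fix w
    from p obtain a b where "\<forall>t. F (A *v (p + t *s (B *v w))) = t^2 * a + t^3 * b"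
      unfolding singular_at_def by blast
    then show "\<exists>a b. \<forall>t. F (A *v p + t *s w) = t^2 * a + t^3 * b"
      by (auto simp: matrix_vector_right_distrib matrix_vector_mult_scaleR vector_scalar_commute B)
  qed
  then show "p = 0"
    using assms matrix_vector_eq_0(1)[OF assms(2)] unfolding smooth_def by blast
qed

lemma flex_line_substitution:
  fixes A :: "'a::field ^ 3 ^ 3"
  assumes "flex_line F m" "invertible A"
  shows "flex_line (\<lambda>v. F (A *v v)) (m v* A)"
  using assms unfolding flex_line_def by (auto simp: matrix_vector_eq_0 lin_matrix[symmetric]) (metis lin_matrix)

lemma on_flex_substitution:
  fixes A :: "'a::field ^ 3 ^ 3"
  assumes "on_flex F Q m"
  shows "on_flex (\<lambda>v. F (A *v v)) (\<lambda>v. Q (A *v v)) (m v* A)"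
proof -
  obtain l c where "\<And>v. F v = lin m v * Q v + c * (lin l v)^3"
    using assms unfolding on_flex_def by blast
  then show ?thesis
    unfolding on_flex_def by (intro exI[of _ "l v* A"] exI[of _ c]) (simp add: lin_matrix)
qed

lemma tangent_conic_fun_substitution:
  fixes A :: "'a::field ^ 3 ^ 3"
  assumes "tangent_conic_fun F Q" "invertible A"
  shows "tangent_conic_fun (\<lambda>v. F (A *v v)) (\<lambda>v. Q (A *v v))"
proof -
  obtain p where p: "p \<noteq> 0" "\<And>v. Q v = 0 \<and> F v = 0 \<longleftrightarrow> (\<exists>c. v = c *s p)"
    using assms(1) unfolding tangent_conic_fun_def by blast
  obtain B where B: "invertible B" "\<And>v. A *v (B *v v) = v" "\<And>v. B *v (A *v v) = v"
    using invertible_obtain[OF assms(2)] by metis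
  have "\<nexists>a b. \<forall>v. Q (A *v v) = lin a v * lin b v"
  proof
    assume "\<exists>a b. \<forall>v. Q (A *v v) = lin a v * lin b v"
    then obtain a b where "\<And>v. Q (A *v v) = lin a v * lin b v" by blast
    from this[of "B *v _"] have "\<forall>v. Q v = lin (a v* B) v * lin (b v* B) v"
      by (simp add: B lin_matrix)
    then show False
      using assms(1) unfolding tangent_conic_fun_def by blast
  qed
  moreover have "form 2 (\<lambda>v. Q (A *v v))"
    using assms(1) unfolding tangent_conic_fun_def by (blast intro: form_linear_substitution)
  moreover have "(Q (A *v v) = 0 \<and> F (A *v v) = 0) \<longleftrightarrow> (\<exists>c. v = c *s (B *v p))" for v
  proof -
    have "(A *v v = c *s p) \<longleftrightarrow> v = c *s (B *v p)" for c
      by (metis B(2,3) vector_scalar_commute)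
    then show ?thesis by (simp add: p(2))
  qed
  moreover have "B *v p \<noteq> 0"
    using p(1) B(1) by (simp add: matrix_vector_eq_0)
  ultimately show ?thesis
    unfolding tangent_conic_fun_def by blast
qed

section \<open>Coordinate changes with a prescribed row or column\<close>

definition mat3 :: "'a::zero ^ 3 \<Rightarrow> 'a ^ 3 \<Rightarrow> 'a ^ 3 \<Rightarrow> 'a ^ 3 ^ 3" where
  "mat3 a b c = vector [a, b, c]"

lemma mat3_mult [simp]:
  fixes a b c v :: "'a::comm_ring_1 ^ 3"
  shows "(mat3 a b c *v v) $ 1 = lin a v" "(mat3 a b c *v v) $ 2 = lin b v" "(mat3 a b c *v v) $ 3 = lin c v"
  by (simp_all add: mat3_def matrix_vector_mult_def lin_def)

lemma det_mat3: "det (mat3 a b c) = a $ 1 * (b $ 2 * c $ 3 - b $ 3 * c $ 2)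
     - a $ 2 * (b $ 1 * c $ 3 - b $ 3 * c $ 1) + a $ 3 * (b $ 1 * c $ 2 - b $ 2 * c $ 1)"
  by (simp add: det_3 mat3_def algebra_simps)

lemma invertible_mat3:
  fixes a b c :: "'a::field ^ 3"
  shows "invertible (mat3 a b c) \<longleftrightarrow> a $ 1 * (b $ 2 * c $ 3 - b $ 3 * c $ 2)
     - a $ 2 * (b $ 1 * c $ 3 - b $ 3 * c $ 1) + a $ 3 * (b $ 1 * c $ 2 - b $ 2 * c $ 1) \<noteq> 0"
  by (simp add: invertible_det_nz det_mat3)

lemma extend_covector:
  fixes m :: "'a::field ^ 3"
  assumes "m \<noteq> 0"
  obtains b c where "invertible (mat3 m b c)"
proof -
  have "m $ 1 \<noteq> 0 \<or> m $ 2 \<noteq> 0 \<or> m $ 3 \<noteq> 0"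
    using assms by (auto simp: vec3_eq_iff)
  then have "invertible (mat3 m (vec3 0 1 0) (vec3 0 0 1)) \<or> invertible (mat3 m (vec3 1 0 0) (vec3 0 0 1))
      \<or> invertible (mat3 m (vec3 1 0 0) (vec3 0 1 0))"
    by (auto simp: invertible_mat3)
  then show ?thesis using that by blast
qed

lemma extend_vector:
  fixes p :: "'a::field ^ 3"
  assumes "p \<noteq> 0"
  obtains B where "invertible B" "B *v vec3 0 0 1 = p"
proof -
  \<comment> \<open>A matrix maps (0, 0, 1) to its last column, so p is put there; the cases only
    complete it to an invertible matrix.\<close>
  have col: "mat3 (vec3 a1 b1 (p $ 1)) (vec3 a2 b2 (p $ 2)) (vec3 a3 b3 (p $ 3)) *v vec3 0 0 1 = p"
    for a1 a2 a3 b1 b2 b3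
    by (simp add: vec3_eq_iff lin_3)
  consider "p $ 1 \<noteq> 0" | "p $ 2 \<noteq> 0" | "p $ 3 \<noteq> 0"
    using assms by (auto simp: vec3_eq_iff)
  then show ?thesis
  proof cases
    case 1
    then show ?thesis by (intro that[OF _ col[of 0 0 1 0 0 1]]) (simp add: invertible_mat3)
  next
    case 2
    then show ?thesis by (intro that[OF _ col[of 1 0 0 0 0 1]]) (simp add: invertible_mat3)
  next
    case 3
    then show ?thesis by (intro that[OF _ col[of 1 0 0 1 0 0]]) (simp add: invertible_mat3)
  qed
qed

subsection \<open>The flex line of a tangent conic\<close>

lemma square_root_exists:
  fixes a :: "'a::alg_closed_field"
  obtains r where "r^2 = a"
  using nth_root_exists[of 2 a] by auto

lemma cube_root_exists:
  fixes a :: "'a::alg_closed_field"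
  obtains r where "r^3 = a"
  using nth_root_exists[of 3 a] by auto

lemma binary_quadratic_factors:
  fixes a b c :: "'a::{alg_closed_field, field_char_0}"
  obtains p q r s where "\<And>x y. a * x^2 + b * x * y + c * y^2 = (p * x + q * y) * (r * x + s * y)"
proof (cases "a = 0")
  case True
  then show ?thesis
    by (intro that[of 0 1 b c]) (simp add: algebra_simps power2_eq_square)
next
  case False
  obtain d where d: "d^2 = b^2 - 4 * a * c" using square_root_exists by blast
  have c: "c = (b^2 - d^2) / (4 * a)" using d False by (simp add: field_simps)
  show ?thesis
    by (rule that[of a "(b - d) / 2" 1 "(b + d) / (2 * a)"])
      (use False in \<open>simp add: c field_simps power2_eq_square\<close>)
qed

text \<open>Put p at (0, 0, 1), so that Q = T z + q with forms T, q in x, y of degrees 1 and 2. If T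
  = 0, then q splits into linear factors. Otherwise q is a multiple of T up to the square of another
  linear form, and this square is nonzero because T does not divide Q. The resulting l1 = T is the
  tangent at p.\<close>

lemma conic_normal_form:
  fixes Q :: "'a::{alg_closed_field, field_char_0} ^ 3 \<Rightarrow> 'a"
  assumes "form 2 Q" "\<nexists>a b. \<forall>v. Q v = lin a v * lin b v" "p \<noteq> 0" "Q p = 0"
  obtains A where "invertible (A :: 'a ^ 3 ^ 3)" "\<And>v. Q v = (A *v v) $ 1 * (A *v v) $ 3 - ((A *v v) $ 2)^2"
    "(A *v p) $ 1 = 0" "(A *v p) $ 2 = 0"
proof -
  obtain B where B: "invertible B" "B *v vec3 0 0 1 = p"
    using extend_vector[OF assms(3)] by blast
  obtain B' where B': "invertible B'" "\<And>v. B *v (B' *v v) = v" "\<And>v. B' *v (B *v v) = v"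
    using invertible_obtain[OF B(1)] by metis
  have "form 2 (\<lambda>v. Q (B *v v))"
    by (rule form_linear_substitution[OF assms(1)])
  then obtain a b c d e g where Q: "\<And>v. Q (B *v v) = ternary_quadratic a b c d e g (v $ 1) (v $ 2) (v $ 3)"
    by (rule quadratic_form_in[of 1 2 3, rotated 3]) auto
  have "g = 0"
    using Q[of "vec3 0 0 1"] assms(4) B(2) by simp
  have not_product: False if "\<And>v. Q (B *v v) = lin l v * lin l' v" for l l'
  proof -
    have "Q v = lin (l v* B') v * lin (l' v* B') v" for v
      using that[of "B' *v v"] by (simp add: B' lin_matrix)
    then show False using assms(2) by blast
  qed
  have "\<exists>l1 l2 l3. invertible (mat3 l1 l2 l3) \<and> (\<forall>v. Q (B *v v) = lin l1 v * lin l3 v - (lin l2 v)^2) \<and> l1 $ 3 = 0 \<and> l2 $ 3 = 0"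
  proof -
    consider "d \<noteq> 0" | "d = 0" "e \<noteq> 0" | "d = 0" "e = 0" by blast
    then show ?thesis
    proof cases
      case 1
      \<comment> \<open>Division of a x^2 + b x y + c y^2 by d x + e y: the quotient is a' d x + (a'
        e + b') y, the remainder c' y^2.\<close>
      define a' b' where "a' = a / d^2" and "b' = (b - 2 * a' * d * e) / d"
      define c' where "c' = c - a' * e^2 - b' * e"
      obtain s where s: "s^2 = - c'" using square_root_exists by blast
      have eq: "Q (B *v v) = lin (vec3 d e 0) v * lin (vec3 (a' * d) (a' * e + b') 1) v - (lin (vec3 0 s 0) v)^2" for v
      proof -
        have abc: "a = a' * d^2" "b = 2 * a' * d * e + b' * d" "c = a' * e^2 + b' * e - s^2"
          using 1 by (simp_all add: a'_def b'_def c'_def s)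
        show ?thesis
          by (simp add: abc Q \<open>g = 0\<close> lin_3 power2_eq_square algebra_simps)
      qed
      have "s \<noteq> 0"
        using not_product[of "vec3 d e 0" "vec3 (a' * d) (a' * e + b') 1"] eq by (auto simp: lin_3)
      then show ?thesis
        using 1 eq by (intro exI[of _ "vec3 d e 0"] exI[of _ "vec3 0 s 0"] exI[of _ "vec3 (a' * d) (a' * e + b') 1"])
          (simp add: invertible_mat3)
    next
      case 2
      obtain s where s: "s^2 = - a" using square_root_exists by blast
      have eq: "Q (B *v v) = lin (vec3 0 1 0) v * lin (vec3 b c e) v - (lin (vec3 s 0 0) v)^2" for v
        using s 2 by (simp add: Q \<open>g = 0\<close> lin_3 power_mult_distrib) (simp add: power2_eq_square algebra_simps)
      have "s \<noteq> 0"
        using not_product[of "vec3 0 1 0" "vec3 b c e"] eq by (auto simp: lin_3)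
      then show ?thesis
        using 2 eq by (intro exI[of _ "vec3 0 1 0"] exI[of _ "vec3 s 0 0"] exI[of _ "vec3 b c e"])
          (simp add: invertible_mat3)
    next
      case 3
      obtain p q r s where "\<And>x y. a * x^2 + b * x * y + c * y^2 = (p * x + q * y) * (r * x + s * y)"
        using binary_quadratic_factors[of a b c] by blast
      then have "Q (B *v v) = lin (vec3 p q 0) v * lin (vec3 r s 0) v" for v
        by (simp add: Q \<open>g = 0\<close> 3 lin_3)
      then show ?thesis using not_product by blast
    qed
  qed
  then obtain l1 l2 l3 where ls: "invertible (mat3 l1 l2 l3)"
    "\<And>v. Q (B *v v) = lin l1 v * lin l3 v - (lin l2 v)^2" "l1 $ 3 = 0" "l2 $ 3 = 0" by blast
  let ?A = "mat3 l1 l2 l3 ** B'"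
  have Av: "?A *v v = mat3 l1 l2 l3 *v (B' *v v)" for v
    by (simp add: matrix_vector_mul_assoc)
  have "Q v = (?A *v v) $ 1 * (?A *v v) $ 3 - ((?A *v v) $ 2)^2" for v
    using ls(2)[of "B' *v v"] by (simp add: Av B')
  moreover have "B' *v p = vec3 0 0 1" using B' B(2) by metis
  then have "(?A *v p) $ 1 = 0" "(?A *v p) $ 2 = 0"
    by (simp_all add: Av lin_3 ls)
  moreover have "invertible ?A"
    using ls(1) B'(1) by (rule invertible_mult)
  ultimately show ?thesis using that by blast
qed

text \<open>Serves to compare coefficients: even and odd ones are separated by evaluating at 1 and
  -1, at the cost of a division by 2.\<close>

lemma sum_diff_inject:
  fixes x y x' y' :: "'a::field_char_0"
  assumes "x + y = x' + y'" "y - x = y' - x'"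
  shows "x = x' \<and> y = y'"
proof -
  have "2 * x = (x + y) - (y - x)" "2 * y = (x + y) + (y - x)" by simp_all
  then have "2 * x = 2 * x'" "2 * y = 2 * y'" unfolding assms by simp_all
  then show ?thesis by simp
qed

lemma coeff_eq_0_if_no_root:
  fixes p :: "'a::alg_closed_field poly"
  assumes "\<And>x. poly p x \<noteq> 0" "n > 0"
  shows "Polynomial.coeff p n = 0"
  using alg_closed_imp_poly_has_root[of p] assms coeff_eq_0[of p n] by fastforce

text \<open>The points (1, u, u^2) are the conic without (0, 0, 1). On them the cubic is a
  polynomial in u of degree at most 6 without zeros, hence constant. Monomials that share a power of
  u, such as x y^2 and x^2 z, therefore get opposite coefficients and combine to multiples of x z -
  y^2.\<close>

lemma cubic_tangent_to_normal_conic: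
  fixes G :: "'a::{alg_closed_field, field_char_0} ^ 3 \<Rightarrow> 'a"
  assumes "form 3 G" "\<And>u. G (vec3 1 u (u^2)) \<noteq> 0" "G (vec3 0 0 1) = 0"
  obtains c m where "c \<noteq> 0" "\<And>v. G v = lin m v * (v $ 1 * v $ 3 - (v $ 2)^2) + c * (v $ 1)^3"
proof -
  obtain c1 c2 c3 c4 c5 c6 c7 c8 c9 c0 where G: "\<And>v. G v = ternary_cubic c1 c2 c3 c4 c5 c6 c7 c8 c9 c0 (v $ 1) (v $ 2) (v $ 3)"
    using assms(1) by (rule cubic_form_in[of 1 2 3, rotated 3]) auto
  define p where "p = [:c1, c2, c3 + c5, c4 + c6, c7 + c8, c9, c0:]"
  have p: "poly p u \<noteq> 0" for u
    using assms(2)[of u] by (simp add: G p_def expand_simps)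
  have "Polynomial.coeff p n = 0" if "n > 0" for n
    by (rule coeff_eq_0_if_no_root[OF p that])
  from this[of 1] this[of 2] this[of 3] this[of 4] this[of 5] this[of 6]
  have z: "c2 = 0" "c5 = - c3" "c6 = - c4" "c8 = - c7" "c9 = 0" "c0 = 0"
    by (simp_all add: p_def numeral_eq_Suc add_eq_0_iff)
  have "c1 \<noteq> 0"
    using p[of 0] by (simp add: p_def)
  then show ?thesis
    by (rule that[of c1 "vec3 (- c3) (- c4) (- c7)"])
      (simp add: G z lin_3 expand_simps)
qed

text \<open>For uniqueness, the linear form in a second decomposition has no zero on the affine part
  of the conic either, so it is a multiple of the tangent line; the two cubes then agree, and Q can
  be cancelled.\<close>

lemma flex_of_tangent_conic:
  fixes F :: "'a::{alg_closed_field, field_char_0} ^ 3 \<Rightarrow> 'a"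
  assumes "form 3 F" "tangent_conic_fun F Q"
  shows "\<exists>!m. on_flex F Q m"
proof -
  obtain p where p: "p \<noteq> 0" "\<And>v. Q v = 0 \<and> F v = 0 \<longleftrightarrow> (\<exists>c. v = c *s p)"
    and Q: "form 2 Q" "\<nexists>a b. \<forall>v. Q v = lin a v * lin b v"
    using assms(2) unfolding tangent_conic_fun_def by blast
  have "Q p = 0" "F p = 0" using p(2)[of p] by (metis vector_smult_lid)+
  obtain A where A: "invertible (A :: 'a ^ 3 ^ 3)" "\<And>v. Q v = (A *v v) $ 1 * (A *v v) $ 3 - ((A *v v) $ 2)^2"
    "(A *v p) $ 1 = 0" "(A *v p) $ 2 = 0"
    using conic_normal_form[OF Q p(1) \<open>Q p = 0\<close>] by blast
  obtain B where B: "invertible B" "\<And>v. A *v (B *v v) = v" "\<And>v. B *v (A *v v) = v"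
    "\<And>m. (m v* B) v* A = m" "\<And>m. (m v* A) v* B = m"
    using invertible_obtain[OF A(1)] by metis
  define G where "G = (\<lambda>v. F (B *v v))"
  have QB: "Q (B *v v) = v $ 1 * v $ 3 - (v $ 2)^2" for v
    by (simp add: A(2) B)
  have no_zero: "G (vec3 1 u (u^2)) \<noteq> 0" for u
  proof
    assume "G (vec3 1 u (u^2)) = 0"
    moreover have "Q (B *v vec3 1 u (u^2)) = 0" by (simp add: QB)
    ultimately obtain c where "B *v vec3 1 u (u^2) = c *s p"
      using p(2) by (auto simp: G_def)
    then have "vec3 1 u (u^2) = c *s (A *v p)"
      by (metis B(2) vector_scalar_commute)
    then show False
      using A(3) by (simp add: vec3_eq_iff)
  qed
  have "A *v p = (A *v p) $ 3 *s vec3 0 0 1"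
    using A by (simp add: vec3_eq_iff)
  moreover have "(A *v p) $ 3 \<noteq> 0"
    using A p(1) matrix_vector_eq_0(1)[OF A(1), of p] by (auto simp: vec3_eq_iff)
  ultimately have "vec3 0 0 1 = inverse ((A *v p) $ 3) *s (A *v p)"
    by (simp add: vec3_eq_iff)
  then have "B *v vec3 0 0 1 = inverse ((A *v p) $ 3) *s p"
    by (metis B(3) vector_scalar_commute)
  then have G0: "G (vec3 0 0 1) = 0"
    using p(2) unfolding G_def by blast
  have "form 3 G"
    unfolding G_def by (rule form_linear_substitution[OF assms(1)])
  then obtain c m where G: "c \<noteq> 0" "\<And>v. G v = lin m v * (v $ 1 * v $ 3 - (v $ 2)^2) + c * (v $ 1)^3"
    using no_zero G0 by (rule cubic_tangent_to_normal_conic) (rule that)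
  show ?thesis
  proof
    have "F v = lin (m v* A) v * Q v + c * (lin (vec3 1 0 0 v* A) v)^3" for v
      using G(2)[of "A *v v"] by (simp add: G_def B A(2) lin_matrix[symmetric]) (simp add: lin_3)
    then show "on_flex F Q (m v* A)"
      unfolding on_flex_def by blast
  next
    fix n assume "on_flex F Q n"
    from on_flex_substitution[OF this, of B] obtain l d
      where ld: "\<And>v. G v = lin (n v* B) v * (v $ 1 * v $ 3 - (v $ 2)^2) + d * (lin l v)^3"
      unfolding on_flex_def G_def QB by blast
    have "G (vec3 1 u (u^2)) = d * (lin l (vec3 1 u (u^2)))^3" for u
      by (simp add: ld)
    then have "lin l (vec3 1 u (u^2)) \<noteq> 0" for u
      using no_zero[of u] by (metis mult_zero_right power_zero_numeral)
    then have "poly [:l $ 1, l $ 2, l $ 3:] u \<noteq> 0" for u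
      by (simp add: lin_3 algebra_simps power2_eq_square)
    from coeff_eq_0_if_no_root[OF this, of 1] coeff_eq_0_if_no_root[OF this, of 2]
    have l: "l $ 2 = 0" "l $ 3 = 0" by (simp_all add: numeral_2_eq_2)
    have "c = d * (l $ 1)^3"
      using ld[of "vec3 1 0 0"] G(2)[of "vec3 1 0 0"] by (simp add: lin_3 l)
    then have "lin (n v* B) v * (v $ 1 * v $ 3 - (v $ 2)^2) = lin m v * (v $ 1 * v $ 3 - (v $ 2)^2)" for v
      using ld[of v] G(2)[of v] by (auto simp: lin_3 l power_mult_distrib)
    note eq = this
    \<comment> \<open>Three points off the conic x z = y^2, where the quadratic factor is 1 or -1
      and cancels.\<close>
    have e: "(n v* B) $ 1 + (n v* B) $ 3 = m $ 1 + m $ 3" "(n v* B) $ 3 - (n v* B) $ 1 = m $ 3 - m $ 1"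
      "(n v* B) $ 2 = m $ 2"
      using eq[of "vec3 1 0 1"] eq[of "vec3 1 0 (-1)"] eq[of "vec3 0 1 0"]
      unfolding lin_3 vec3_nth by simp_all
    from sum_diff_inject[OF e(1,2)] e(3) have "n v* B = m"
      by (simp add: vec3_eq_iff)
    then show "n = m v* A"
      using B(4) by metis
  qed
qed

subsection \<open>The three conics belonging to a flex line\<close>

lemma cubic_roots:
  fixes a b c d :: "'a::alg_closed_field"
  assumes "a \<noteq> 0"
  obtains r s t where "\<And>x. a * x^3 + b * x^2 + c * x + d = a * (x - r) * (x - s) * (x - t)"
proof -
  let ?p = "[:d, c, b, a:]"
  obtain M where M: "size M = Polynomial.degree ?p" "?p = Polynomial.smult (Polynomial.lead_coeff ?p) (\<Prod>x\<in>#M. [:-x, 1:])"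
    using alg_closed_imp_factorization[of ?p] assms by auto
  from M(1) assms have "size M = Suc (Suc (Suc 0))" by simp
  then obtain r s t where "M = {#r, s, t#}"
    by (metis size_eq_Suc_imp_eq_union size_add_mset Suc_inject size_eq_0_iff_empty)
  have prod: "poly ?p x = a * (\<Prod>y\<in>#M. poly [:-y, 1:] x)" for x
    by (subst M(2)) (simp add: assms poly_prod_mset image_mset.compositionality o_def)
  have "poly ?p x = a * (x - r) * (x - s) * (x - t)" for x
    unfolding prod by (simp add: \<open>M = {#r, s, t#}\<close> mult.assoc)
  then show ?thesis
    by (intro that[of r s t]) (simp add: expand_simps)
qed

lemma cubic_coeffs_of_roots:
  fixes a b c d r s t :: "'a::field_char_0"
  assumes "\<And>x. a * x^3 + b * x^2 + c * x + d = a * (x - r) * (x - s) * (x - t)"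
  shows "b = - a * (r + s + t)" "c = a * (r * s + s * t + r * t)" "d = - a * r * s * t"
proof -
  have "poly [:d, c, b, a:] = poly [:- a * r * s * t, a * (r * s + s * t + r * t), - a * (r + s + t), a:]"
  proof
    fix x
    show "poly [:d, c, b, a:] x = poly [:- a * r * s * t, a * (r * s + s * t + r * t), - a * (r + s + t), a:] x"
      using assms[of x] by (simp add: expand_simps)
  qed
  then have "[:d, c, b, a:] = [:- a * r * s * t, a * (r * s + s * t + r * t), - a * (r + s + t), a:]"
    by (simp only: poly_eq_poly_eq_iff)
  then show "b = - a * (r + s + t)" "c = a * (r * s + s * t + r * t)" "d = - a * r * s * t"
    by simp_all
qed

definition residual_conic :: "'a::field \<Rightarrow> 'a \<Rightarrow> 'a \<Rightarrow> 'a \<Rightarrow> 'a \<Rightarrow> 'a \<Rightarrow> 'a ^ 3 \<Rightarrow> 'a" where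
  "residual_conic A B C D E H v = ternary_quadratic A B C D E H (v $ 1) (v $ 2) (v $ 3)"

text \<open>Normal form at a flex line: the line is x = 0 and the cubic restricts to k y^3 on it, so
  the flex is (0, 0, 1). The coefficient H of x z^2 is nonzero exactly when the flex is a smooth
  point.\<close>

definition flex_cubic :: "'a::field \<Rightarrow> 'a \<Rightarrow> 'a \<Rightarrow> 'a \<Rightarrow> 'a \<Rightarrow> 'a \<Rightarrow> 'a \<Rightarrow> 'a ^ 3 \<Rightarrow> 'a" where
  "flex_cubic A B C D E H k v = v $ 1 * residual_conic A B C D E H v + k * (v $ 2)^3"

text \<open>Replacing k y^3 by k (y + s x)^3 changes the cubic by a multiple of x, which is moved
  into the conic.\<close>

definition pencil_conic :: "'a::field \<Rightarrow> 'a \<Rightarrow> 'a \<Rightarrow> 'a \<Rightarrow> 'a \<Rightarrow> 'a \<Rightarrow> 'a \<Rightarrow> 'a \<Rightarrow> 'a ^ 3 \<Rightarrow> 'a" where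
  "pencil_conic A B C D E H k s v = residual_conic A B C D E H v
     - k * (3 * s * (v $ 2)^2 + 3 * s^2 * (v $ 1) * (v $ 2) + s^3 * (v $ 1)^2)"

text \<open>The discriminant of the binary form in x, z that the conic with parameter s cuts out on
  the line y = - s x.\<close>

definition tangency :: "'a::field \<Rightarrow> 'a \<Rightarrow> 'a \<Rightarrow> 'a \<Rightarrow> 'a \<Rightarrow> 'a \<Rightarrow> 'a \<Rightarrow> 'a \<Rightarrow> 'a" where
  "tangency A B C D E H k s = 4 * H * k * s^3 + (E^2 - 4 * H * C) * s^2 + (4 * H * B - 2 * D * E) * s + (D^2 - 4 * H * A)"

lemma form_residual_conic: "form 2 (residual_conic A B C D E H)"
  unfolding residual_conic_def[abs_def] by (rule form_quadratic)

lemma pencil_conic_eq_residual: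
  "pencil_conic A B C D E H k s =
     residual_conic (A - k * s^3) (B - 3 * k * s^2) (C - 3 * k * s) D E H"
  by (rule ext) (simp add: pencil_conic_def residual_conic_def algebra_simps)

text \<open>Only points with first coordinate 1 occur, because the identities to be compared carry a
  factor \<open>v $ 1\<close> that has to be cancelled.\<close>

lemma residual_conic_inject:
  fixes A :: "'a::field_char_0"
  assumes "\<And>y z. residual_conic A B C D E H (vec3 1 y z) = residual_conic A' B' C' D' E' H' (vec3 1 y z)"
  shows "A = A' \<and> B = B' \<and> C = C' \<and> D = D' \<and> E = E' \<and> H = H'"
proof -
  have A: "A = A'" using assms[of 0 0] by (simp add: residual_conic_def)
  have BC: "B = B' \<and> C = C'"
    using assms[of 1 0] assms[of "-1" 0] A by (intro sum_diff_inject) (simp_all add: residual_conic_def add.assoc)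
  have DH: "D = D' \<and> H = H'"
    using assms[of 0 1] assms[of 0 "-1"] A by (intro sum_diff_inject) (simp_all add: residual_conic_def add.assoc)
  have "E = E'" using assms[of 1 1] A BC DH by (simp add: residual_conic_def)
  then show ?thesis using A BC DH by blast
qed

text \<open>For nonzero k, the conic with parameter s can therefore meet the cubic only on the line
  y = - s x.\<close>

lemma flex_cubic_pencil:
  "flex_cubic A B C D E H k v = v $ 1 * pencil_conic A B C D E H k s v + k * (v $ 2 + s * v $ 1)^3"
  by (simp add: flex_cubic_def pencil_conic_def power2_eq_square power3_eq_cube algebra_simps)

context
  fixes A B C D E H k :: "'a::{alg_closed_field, field_char_0}"
  assumes H: "H \<noteq> 0" and k: "k \<noteq> 0"
    and smooth_cubic: "smooth (flex_cubic A B C D E H k)"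
begin

text \<open>A double root of \<open>tangency\<close> makes the cubic singular at \<open>(1, -s, z)\<close>, where \<open>z\<close> is the double
  root of the restriction of the conic to the tangent line.\<close>

lemma tangency_double_root:
  assumes "tangency A B C D E H k s = 0"
    and "12 * H * k * s^2 + 2 * (E^2 - 4 * H * C) * s + (4 * H * B - 2 * D * E) = 0"
  shows False
proof -
  define z where "z = - (D - E * s) / (2 * H)"
  have D: "D = E * s - 2 * H * z"
    using H by (simp add: z_def field_simps)
  have "4 * H * (B - (2 * C * s - 3 * k * s^2 - E * z)) = 0"
    using assms(2) unfolding D by (simp add: algebra_simps power2_eq_square)
  then have B: "B = 2 * C * s - 3 * k * s^2 - E * z"
    using H by simp
  have "4 * H * (B * s - C * s^2 + k * s^3 + H * z^2 - A) = 0"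
    using assms(1) unfolding D tangency_def by (simp add: expand_simps)
  then have A: "A = B * s - C * s^2 + k * s^3 + H * z^2"
    using H by simp
  have "singular_at (flex_cubic A B C D E H k) (vec3 1 (- s) z)"
    unfolding singular_at_def
  proof
    fix w :: "'a ^ 3"
    \<comment> \<open>After the substitutions for A, B, D the cubic is x K + k p^3, where K is a
      quadratic form in p = y + s x and in q, the third coordinate minus z x. It is visibly singular
      where p = q = 0.\<close>
    define p where "p = w $ 2 + s * w $ 1"
    define q where "q = w $ 3 - z * w $ 1"
    define K where "K = (C - 3 * k * s) * p^2 + E * p * q + H * q^2"
    have w: "w $ 2 = p - s * w $ 1" "w $ 3 = q + z * w $ 1"
      by (simp_all add: p_def q_def)
    have "flex_cubic A B C D E H k (vec3 1 (- s) z + t *s w) = t^2 * K + t^3 * (w $ 1 * K + k * p^3)" for t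
      unfolding flex_cubic_def residual_conic_def A B D K_def
      by (simp add: w) (simp add: power2_eq_square power3_eq_cube algebra_simps)
    then show "\<exists>a b. \<forall>t. flex_cubic A B C D E H k (vec3 1 (- s) z + t *s w) = t^2 * a + t^3 * b"
      by blast
  qed
  then have "vec3 1 (- s) z = 0"
    using smooth_cubic unfolding smooth_def by blast
  then show False
    by (simp add: vec3_eq_iff)
qed

lemma tangency_roots:
  obtains r s t where "r \<noteq> s" "s \<noteq> t" "r \<noteq> t"
    "\<And>x. tangency A B C D E H k x = 4 * H * k * (x - r) * (x - s) * (x - t)"
proof -
  have lc: "4 * H * k \<noteq> 0" using H k by simp
  obtain r s t where "\<And>x. 4 * H * k * x^3 + (E^2 - 4 * H * C) * x^2 + (4 * H * B - 2 * D * E) * x + (D^2 - 4 * H * A)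
      = 4 * H * k * (x - r) * (x - s) * (x - t)"
    by (rule cubic_roots[OF lc, of "E^2 - 4 * H * C" "4 * H * B - 2 * D * E" "D^2 - 4 * H * A"]) (rule that)
  then have roots: "tangency A B C D E H k x = 4 * H * k * (x - r) * (x - s) * (x - t)" for x
    by (simp add: tangency_def)
  note co = cubic_coeffs_of_roots[OF roots[unfolded tangency_def]]
  \<comment> \<open>The second premise is the derivative of \<open>tangency\<close> with its
    coefficients expressed by the roots; it holds at every double root.\<close>
  have simple: False if "tangency A B C D E H k x = 0"
    "12 * H * k * x^2 - 2 * (4 * H * k * (r + s + t)) * x + 4 * H * k * (r * s + s * t + r * t) = 0" for x
    by (rule tangency_double_root[OF that(1)]) (simp only: co, use that(2) in \<open>simp add: algebra_simps\<close>)
  have "r \<noteq> s"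
  proof
    assume "r = s"
    then show False
      by (intro simple[of r]) (simp_all add: roots algebra_simps power2_eq_square)
  qed
  moreover have "s \<noteq> t"
  proof
    assume "s = t"
    then show False
      by (intro simple[of s]) (simp_all add: roots algebra_simps power2_eq_square)
  qed
  moreover have "r \<noteq> t"
  proof
    assume "r = t"
    then show False
      by (intro simple[of r]) (simp_all add: roots algebra_simps power2_eq_square)
  qed
  ultimately show ?thesis using that roots by blast
qed

text \<open>H (z + d x)^2 is the completed square in z, so a vanishing discriminant makes the
  restriction a square.\<close>

lemma tangency_restriction:
  assumes "2 * H * d = D - E * s"
  shows "4 * H * pencil_conic A B C D E H k s (vec3 x (- s * x) z) = 4 * H * (H * (z + d * x)^2) - tangency A B C D E H k s * x^2"
proof -
  have D: "D = E * s + 2 * H * d" using assms by (simp add: algebra_simps)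
  show ?thesis
    unfolding D pencil_conic_def residual_conic_def tangency_def
    by (simp add: power2_eq_square power3_eq_cube algebra_simps)
qed

text \<open>On the line y = - s x the conic is H (z + d x)^2, which leaves p = (1, - s, - d) as the
  only common point. If the conic split into two lines, both would pass through p; then the conic
  has order 2 at p, the cube order 3, and the cubic would be singular there.\<close>

lemma pencil_conic_tangent:
  assumes "tangency A B C D E H k s = 0"
  shows "tangent_conic_fun (flex_cubic A B C D E H k) (pencil_conic A B C D E H k s)"
    and "on_flex (flex_cubic A B C D E H k) (pencil_conic A B C D E H k s) (vec3 1 0 0)"
proof -
  let ?F = "flex_cubic A B C D E H k" and ?Q = "pencil_conic A B C D E H k s"
  define d where "d = (D - E * s) / (2 * H)"
  have restr: "?Q (vec3 x (- s * x) z) = H * (z + d * x)^2" for x z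
    using tangency_restriction[of d s x z] H assms by (simp add: d_def)
  define p where "p = vec3 1 (- s) (- d)"
  have F: "?F v = v $ 1 * ?Q v + k * (v $ 2 + s * v $ 1)^3" for v
    by (rule flex_cubic_pencil)
  have "?Q v = 0 \<and> ?F v = 0 \<longleftrightarrow> (\<exists>c. v = c *s p)" for v
  proof
    assume v: "?Q v = 0 \<and> ?F v = 0"
    with F[of v] k have "v $ 2 + s * v $ 1 = 0" by simp
    then have v2: "v $ 2 = - s * v $ 1" by (simp add: eq_neg_iff_add_eq_0)
    then have "v = vec3 (v $ 1) (- s * v $ 1) (v $ 3)"
      by (simp add: vec3_eq_iff)
    with v restr[of "v $ 1" "v $ 3"] have "H * (v $ 3 + d * v $ 1)^2 = 0"
      by metis
    with H have "v $ 3 = - d * v $ 1" by (simp add: eq_neg_iff_add_eq_0)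
    with v2 have "v = v $ 1 *s p"
      by (simp add: vec3_eq_iff p_def)
    then show "\<exists>c. v = c *s p" by blast
  next
    assume "\<exists>c. v = c *s p"
    then obtain c where v: "v = c *s p" by blast
    then have v': "v = vec3 c (- s * c) (- d * c)"
      by (simp add: vec3_eq_iff p_def)
    have "?Q v = 0" unfolding v' restr by simp
    moreover have "v $ 2 + s * v $ 1 = 0" by (simp add: v')
    ultimately show "?Q v = 0 \<and> ?F v = 0" using F[of v] by simp
  qed
  moreover have "p \<noteq> 0" by (simp add: p_def vec3_eq_iff)
  moreover have "\<nexists>a b. \<forall>v. ?Q v = lin a v * lin b v"
  proof
    assume "\<exists>a b. \<forall>v. ?Q v = lin a v * lin b v"
    then obtain a b where ab: "\<And>v. ?Q v = lin a v * lin b v" by blast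
    define a1 a2 b1 b2 where "a1 = lin a (vec3 1 (- s) 0)" and "a2 = lin a (vec3 0 0 1)"
      and "b1 = lin b (vec3 1 (- s) 0)" and "b2 = lin b (vec3 0 0 1)"
    have prod: "(a1 * x + a2 * z) * (b1 * x + b2 * z) = H * (z + d * x)^2" for x z
    proof -
      have "vec3 x (- s * x) z = x *s vec3 1 (- s) 0 + z *s vec3 0 0 1"
        by (simp add: vec3_eq_iff)
      then show ?thesis
        using ab[of "vec3 x (- s * x) z"] unfolding restr
        by (simp add: lin_add lin_smult a1_def a2_def b1_def b2_def mult.commute)
    qed
    have p': "p = 1 *s vec3 1 (- s) 0 + (- d) *s vec3 0 0 1"
      by (simp add: p_def vec3_eq_iff)
    have ap: "lin a p = a1 - d * a2" and bp: "lin b p = b1 - d * b2"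
      unfolding p' lin_add lin_smult by (simp_all add: a1_def a2_def b1_def b2_def)
    have H2: "a2 * b2 = H" using prod[of 0 1] by simp
    \<comment> \<open>With X and Y the values of the two linear forms at p, evaluation at p and at p
      + (0, 0, 1) gives X Y = 0 and a2 Y + b2 X = 0, where a2 b2 = H is nonzero.\<close>
    have both: "lin a p = 0 \<and> lin b p = 0"
    proof -
      have "(a1 - d * a2) * (b1 - d * b2) = 0"
        using prod[of 1 "- d"] by (simp add: mult.commute)
      moreover have "(a1 + (1 - d) * a2) * (b1 + (1 - d) * b2) = H"
        using prod[of 1 "1 - d"] by (simp add: mult.commute)
      then have "(a1 - d * a2) * (b1 - d * b2) + a2 * (b1 - d * b2) + b2 * (a1 - d * a2) = 0"
        unfolding H2[symmetric] by (simp add: algebra_simps)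
      moreover have "a2 \<noteq> 0" "b2 \<noteq> 0" using H2 H by auto
      ultimately show ?thesis unfolding ap bp by auto
    qed
    have "singular_at ?F p"
      unfolding singular_at_def
    proof
      fix w
      have "?F (p + t *s w) = t^2 * (lin a w * lin b w) + t^3 * (w $ 1 * (lin a w * lin b w) + k * (w $ 2 + s * w $ 1)^3)" for t
      proof -
        have "?Q (p + t *s w) = t^2 * (lin a w * lin b w)"
          using both by (simp add: ab lin_add lin_smult power2_eq_square)
        moreover have "(p + t *s w) $ 1 = 1 + t * w $ 1"
          by (simp add: p_def)
        moreover have "(p + t *s w) $ 2 + s * (p + t *s w) $ 1 = t * (w $ 2 + s * w $ 1)"
          by (simp add: p_def algebra_simps)
        ultimately have "?F (p + t *s w) = (1 + t * w $ 1) * (t^2 * (lin a w * lin b w)) + k * (t * (w $ 2 + s * w $ 1))^3"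
          by (simp only: F[of "p + t *s w"])
        then show ?thesis
          by (simp add: expand_simps)
      qed
      then show "\<exists>a b. \<forall>t. ?F (p + t *s w) = t^2 * a + t^3 * b" by blast
    qed
    with smooth_cubic \<open>p \<noteq> 0\<close> show False unfolding smooth_def by blast
  qed
  ultimately show "tangent_conic_fun ?F ?Q"
    unfolding tangent_conic_fun_def pencil_conic_eq_residual
    using form_residual_conic by blast
  show "on_flex ?F ?Q (vec3 1 0 0)"
    unfolding on_flex_def F
    by (intro exI[of _ "vec3 s 1 0"] exI[of _ k]) (simp add: lin_3 add.commute)
qed

text \<open>Comparing values on the line x = 0 shows that the cube is k (y + s x)^3 with s = l1 /
  l2, so s determines Q. If \<open>tangency\<close> did not vanish at s, then Q would cut the line y
  = - s x in two different points, and there the cubic vanishes with Q.\<close>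

lemma pencil_conic_of_tangent:
  assumes "tangent_conic_fun (flex_cubic A B C D E H k) Q"
    and "on_flex (flex_cubic A B C D E H k) Q (vec3 1 0 0)"
  obtains s where "tangency A B C D E H k s = 0" "Q = pencil_conic A B C D E H k s"
proof -
  let ?F = "flex_cubic A B C D E H k"
  obtain p where p: "p \<noteq> 0" "\<And>v. Q v = 0 \<and> ?F v = 0 \<longleftrightarrow> (\<exists>c. v = c *s p)" and "form 2 Q"
    using assms(1) unfolding tangent_conic_fun_def by blast
  obtain A' B' C' D' E' H' where "\<And>v. Q v = ternary_quadratic A' B' C' D' E' H' (v $ 1) (v $ 2) (v $ 3)"
    using \<open>form 2 Q\<close> by (rule quadratic_form_in[of 1 2 3, rotated 3]) auto
  then have Q: "Q = residual_conic A' B' C' D' E' H'"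
    by (simp add: residual_conic_def fun_eq_iff)
  obtain l c where F: "\<And>v. ?F v = v $ 1 * Q v + c * (lin l v)^3"
    using assms(2) unfolding on_flex_def by (auto simp: lin_3)
  have k_eq: "c * (l $ 2)^3 = k"
    using F[of "vec3 0 1 0"] by (simp add: flex_cubic_def lin_3)
  then have c: "c \<noteq> 0" "l $ 2 \<noteq> 0" using k by auto
  have l3: "l $ 3 = 0"
    using F[of "vec3 0 0 1"] c by (simp add: flex_cubic_def lin_3)
  define s where "s = l $ 1 / l $ 2"
  have l1: "l $ 1 = s * l $ 2" using c by (simp add: s_def)
  have "c * (lin l v)^3 = k * (v $ 2 + s * v $ 1)^3" for v
  proof -
    have "lin l v = l $ 2 * (v $ 2 + s * v $ 1)"
      by (simp add: lin_3 l1 l3 algebra_simps)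
    then show ?thesis by (simp add: power_mult_distrib k_eq[symmetric])
  qed
  then have "v $ 1 * Q v = v $ 1 * pencil_conic A B C D E H k s v" for v
    using F[of v] flex_cubic_pencil[of A B C D E H k v s] by auto
  from this[of "vec3 1 _ _"] have Qs: "Q = pencil_conic A B C D E H k s"
    unfolding Q pencil_conic_eq_residual using residual_conic_inject
    by (metis mult_1 vec3_nth(1))
  have "tangency A B C D E H k s = 0"
  proof (rule ccontr)
    assume nz: "tangency A B C D E H k s \<noteq> 0"
    obtain r where r: "r^2 = tangency A B C D E H k s" using square_root_exists by blast
    with nz have "r \<noteq> 0" by auto
    define d where "d = (D - E * s) / (2 * H)"
    have dH: "2 * H * d = D - E * s" using H by (simp add: d_def)
    have "Q (vec3 1 (- s) z) = 0" if "2 * H * (z + d) = r \<or> 2 * H * (z + d) = - r" for z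
    proof -
      have "(2 * H * (z + d))^2 = tangency A B C D E H k s"
        using that r by auto
      then have "4 * H * Q (vec3 1 (- s) z) = 0"
        using tangency_restriction[OF dH, of 1 z] unfolding Qs
        by (simp add: power2_eq_square algebra_simps)
      then show ?thesis using H by simp
    qed
    moreover have "?F (vec3 1 (- s) z) = 1 * Q (vec3 1 (- s) z)" for z
      using flex_cubic_pencil[of A B C D E H k "vec3 1 (- s) z" s] unfolding Qs by simp
    ultimately have on_p: "\<exists>c. vec3 1 (- s) z = c *s p" if "2 * H * (z + d) = r \<or> 2 * H * (z + d) = - r" for z
      using p(2)[of "vec3 1 (- s) z"] that by simp
    \<comment> \<open>The two roots in z on this line. Two distinct vectors with first coordinate 1
      cannot both be multiples of p.\<close>
    define z1 z2 where "z1 = r / (2 * H) - d" and "z2 = - r / (2 * H) - d"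
    obtain c1 c2 where "vec3 1 (- s) z1 = c1 *s p" "vec3 1 (- s) z2 = c2 *s p"
      using on_p[of z1] on_p[of z2] H by (auto simp: z1_def z2_def)
    then have "1 = c1 * p $ 1" "1 = c2 * p $ 1" "z1 = c1 * p $ 3" "z2 = c2 * p $ 3"
      by (simp_all add: vec3_eq_iff)
    then have "z1 = z2" by (metis mult_right_cancel mult_zero_right zero_neq_one)
    then have "r / (2 * H) = - r / (2 * H)" by (simp add: z1_def z2_def)
    with H \<open>r \<noteq> 0\<close> show False by (simp add: field_simps)
  qed
  with Qs that show ?thesis by blast
qed

lemma pencil_conic_proportional:
  assumes "\<And>v. pencil_conic A B C D E H k s v = c * pencil_conic A B C D E H k t v"
  shows "s = t"
proof -
  have "c = 1"
    using assms[of "vec3 0 0 1"] H by (simp add: pencil_conic_def residual_conic_def)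
  then show ?thesis
    using assms[of "vec3 0 1 0"] k by (simp add: pencil_conic_def residual_conic_def)
qed

end

section \<open>The nine flex lines of a smooth cubic\<close>

lemma binary_cubic_inject:
  fixes a b c d a' b' c' d' :: "'a::field_char_0"
  assumes "\<And>x y. a * x^3 + b * x^2 * y + c * x * y^2 + d * y^3 = a' * x^3 + b' * x^2 * y + c' * x * y^2 + d' * y^3"
  shows "a = a'" "b = b'" "c = c'" "d = d'"
proof -
  show a: "a = a'" using assms[of 1 0] by simp
  show d: "d = d'" using assms[of 0 1] by simp
  have "b = b' \<and> c = c'"
    using assms[of 1 1] assms[of 1 "-1"] a d by (intro sum_diff_inject) (simp_all add: algebra_simps)
  then show "b = b'" "c = c'" by simp_all
qed

subsection \<open>Weierstrass form\<close>

text \<open>The flex line becomes the first coordinate and the form whose cube appears becomes the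
  second, which gives k = 1. Smoothness enters twice: the cube is not zero on the line, and the flex
  is not singular.\<close>

lemma flex_normal_form:
  fixes F :: "'a::{alg_closed_field, field_char_0} ^ 3 \<Rightarrow> 'a"
  assumes "smooth F" "form 3 F" "flex_line F m"
  obtains A B C D E H M where "invertible (M :: 'a ^ 3 ^ 3)" "H \<noteq> 0"
    "\<And>v. F v = flex_cubic A B C D E H 1 (M *v v)"
proof -
  have "m \<noteq> 0" using assms(3) by (simp add: flex_line_def)
  then obtain b c where M0: "invertible (mat3 m b c)" using extend_covector by blast
  let ?M0 = "mat3 m b c"
  obtain N0 where N0: "invertible N0" "\<And>v. ?M0 *v (N0 *v v) = v" "\<And>v. N0 *v (?M0 *v v) = v"
    using invertible_obtain[OF M0] by metis
  define G where "G = (\<lambda>v. F (N0 *v v))"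
  have "form 3 G" unfolding G_def by (rule form_linear_substitution[OF assms(2)])
  then obtain c1 c2 c3 c4 c5 c6 c7 c8 c9 c0 where G: "\<And>v. G v = ternary_cubic c1 c2 c3 c4 c5 c6 c7 c8 c9 c0 (v $ 1) (v $ 2) (v $ 3)"
    by (rule cubic_form_in[of 1 2 3, rotated 3]) auto
  have "smooth G" unfolding G_def by (rule smooth_substitution[OF assms(1) N0(1)])
  obtain l where l: "\<And>v. lin m v = 0 \<Longrightarrow> F v = (lin l v)^3"
    using assms(3) unfolding flex_line_def by blast
  define l' where "l' = l v* N0"
  define q where "q = (\<lambda>v. residual_conic c1 c2 c3 c5 c6 c8 v)"
  have Gq: "G v = v $ 1 * q v + (l' $ 2 * v $ 2 + l' $ 3 * v $ 3)^3" for v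
  proof -
    have "lin m (N0 *v vec3 0 (v $ 2) (v $ 3)) = 0"
      using mat3_mult(1)[of m b c "N0 *v vec3 0 (v $ 2) (v $ 3)"] by (simp add: N0)
    from l[OF this] have "G (vec3 0 (v $ 2) (v $ 3)) = (l' $ 2 * v $ 2 + l' $ 3 * v $ 3)^3"
      by (simp add: G_def lin_matrix l'_def[symmetric]) (simp add: lin_3)
    then show ?thesis
      by (simp add: G q_def residual_conic_def expand_simps)
  qed
  \<comment> \<open>Otherwise the cubic is x q, which is singular at a zero of q on the line x =
    0.\<close>
  have l'_nz: "l' $ 2 \<noteq> 0 \<or> l' $ 3 \<noteq> 0"
  proof (rule ccontr)
    assume "\<not> ?thesis"
    then have Gq': "G v = v $ 1 * q v" for v using Gq[of v] by simp
    obtain y z where yz: "q (vec3 0 y z) = 0" "(y, z) \<noteq> (0, 0)"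
    proof -
      obtain p q' r s where pq: "\<And>x y. c3 * x^2 + c6 * x * y + c8 * y^2 = (p * x + q' * y) * (r * x + s * y)"
        using binary_quadratic_factors[of c3 c6 c8] by blast
      show ?thesis
      proof (cases "p = 0 \<and> q' = 0")
        case True
        then show ?thesis using pq[of 0 1] by (intro that[of 0 1]) (simp_all add: q_def residual_conic_def)
      next
        case False
        then show ?thesis using pq[of q' "- p"] by (intro that[of q' "- p"]) (auto simp: q_def residual_conic_def algebra_simps)
      qed
    qed
    let ?p = "vec3 0 y z"
    have "singular_at G ?p"
      unfolding singular_at_def
    proof
      fix w
      have "q (?p + t *s w) = q ?p + t * (c2 * w $ 1 * y + 2 * c3 * w $ 2 * y + c5 * w $ 1 * z + c6 * (w $ 2 * z + w $ 3 * y) + 2 * c8 * w $ 3 * z)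
         + t^2 * q w" for t
        by (simp add: q_def residual_conic_def algebra_simps power2_eq_square)
      then have "G (?p + t *s w) = t^2 * (w $ 1 * (c2 * w $ 1 * y + 2 * c3 * w $ 2 * y + c5 * w $ 1 * z + c6 * (w $ 2 * z + w $ 3 * y) + 2 * c8 * w $ 3 * z))
          + t^3 * (w $ 1 * q w)" for t
        unfolding Gq' by (simp add: yz expand_simps)
      then show "\<exists>a b. \<forall>t. G (?p + t *s w) = t^2 * a + t^3 * b" by blast
    qed
    then show False
      using \<open>smooth G\<close> yz(2) unfolding smooth_def by (auto simp: vec3_eq_iff)
  qed
  obtain n2 n3 where n: "l' $ 2 * n3 - l' $ 3 * n2 \<noteq> 0"
    using l'_nz by (metis diff_zero mult_zero_right mult_1_right diff_0 neg_equal_0_iff_equal)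
  let ?M1 = "mat3 (vec3 1 0 0) (vec3 0 (l' $ 2) (l' $ 3)) (vec3 0 n2 n3)"
  have M1: "invertible ?M1" using n by (simp add: invertible_mat3)
  obtain N1 where N1: "invertible N1" "\<And>v. ?M1 *v (N1 *v v) = v" "\<And>v. N1 *v (?M1 *v v) = v"
    using invertible_obtain[OF M1] by metis
  have "form 2 (\<lambda>v. q (N1 *v v))"
    unfolding q_def by (rule form_linear_substitution) (rule form_residual_conic)
  then obtain A B C D E H where "\<And>v. q (N1 *v v) = ternary_quadratic A B C D E H (v $ 1) (v $ 2) (v $ 3)"
    by (rule quadratic_form_in[of 1 2 3, rotated 3]) auto
  then have qN: "q (N1 *v v) = residual_conic A B C D E H v" for v
    by (simp add: residual_conic_def)
  have GN: "G (N1 *v v) = flex_cubic A B C D E H 1 v" for v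
    using Gq[of "N1 *v v"] mat3_mult(1,2)[of "vec3 1 0 0" "vec3 0 (l' $ 2) (l' $ 3)" "vec3 0 n2 n3" "N1 *v v"]
    unfolding N1 qN by (simp add: lin_3 flex_cubic_def)
  have "H \<noteq> 0"
  proof
    assume "H = 0"
    have "smooth (\<lambda>v. G (N1 *v v))"
      by (rule smooth_substitution[OF \<open>smooth G\<close> N1(1)])
    moreover have "singular_at (\<lambda>v. G (N1 *v v)) (vec3 0 0 1)"
      unfolding singular_at_def
    proof
      fix w
      have "G (N1 *v (vec3 0 0 1 + t *s w)) = t^2 * (w $ 1 * (D * w $ 1 + E * w $ 2))
          + t^3 * (w $ 1 * residual_conic A B C D E H w + (w $ 2)^3)" for t
        unfolding GN flex_cubic_def residual_conic_def
        by (simp add: \<open>H = 0\<close> expand_simps)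
      then show "\<exists>a b. \<forall>t. G (N1 *v (vec3 0 0 1 + t *s w)) = t^2 * a + t^3 * b" by blast
    qed
    ultimately have "vec3 0 0 (1 :: 'a) = 0" unfolding smooth_def by blast
    then show False by (simp add: vec3_eq_iff)
  qed
  moreover have "F v = flex_cubic A B C D E H 1 ((?M1 ** ?M0) *v v)" for v
    using GN[of "?M1 *v (?M0 *v v)"] unfolding matrix_vector_mul_assoc[symmetric] by (simp only: N1 N0 G_def)
  ultimately show ?thesis
    using invertible_mult[OF M1 M0] that by blast
qed

text \<open>In the chart \<open>v $ 1 = 1\<close> this is z^2 + y^3 + a y + b, with flex (0, 0, 1)
  and flex line \<open>v $ 1 = 0\<close>.\<close>

definition weierstrass :: "'a::field \<Rightarrow> 'a \<Rightarrow> 'a ^ 3 \<Rightarrow> 'a" where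
  "weierstrass a b v = v $ 1 * (v $ 3)^2 + (v $ 2)^3 + a * (v $ 2) * (v $ 1)^2 + b * (v $ 1)^3"

lemma weierstrass_form:
  fixes A B C D E H :: "'a::{alg_closed_field, field_char_0}"
  assumes "H \<noteq> 0"
  obtains a b M where "invertible (M :: 'a ^ 3 ^ 3)"
    "\<And>v. flex_cubic A B C D E H 1 v = weierstrass a b (M *v v)"
proof -
  obtain h where h: "h^2 = H" using square_root_exists by blast
  then have "h \<noteq> 0" using assms by auto
  \<comment> \<open>d and e complete the square in z, c removes the y^2 term of the remaining cubic
    in y, and a and b are what is left.\<close>
  define d e where "d = D / (2 * H)" and "e = E / (2 * H)"
  have DE: "D = 2 * H * d" "E = 2 * H * e" using assms by (simp_all add: d_def e_def)
  define c where "c = (C - H * e^2) / 3"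
  have C: "C = 3 * c + H * e^2" by (simp add: c_def field_simps)
  define a where "a = B - 2 * H * d * e - 3 * c^2"
  have B: "B = a + 3 * c^2 + 2 * H * d * e" by (simp add: a_def)
  define b where "b = A - H * d^2 - a * c - c^3"
  have A: "A = b + H * d^2 + a * c + c^3" by (simp add: b_def)
  let ?M = "mat3 (vec3 1 0 0) (vec3 c 1 0) (vec3 (h * d) (h * e) h)"
  have "flex_cubic A B C D E H 1 v = weierstrass a b (?M *v v)" for v
    unfolding flex_cubic_def residual_conic_def weierstrass_def A B C DE h[symmetric]
    by (simp add: lin_3 expand_simps)
  moreover have "invertible ?M" using \<open>h \<noteq> 0\<close> by (simp add: invertible_mat3)
  ultimately show ?thesis using that by blast
qed

text \<open>A vanishing discriminant gives Y^3 + a Y + b a double root y, and then (1, y, 0) is a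
  singular point.\<close>

lemma weierstrass_discriminant:
  fixes a b :: "'a::field_char_0"
  assumes "smooth (weierstrass a b)"
  shows "4 * a^3 + 27 * b^2 \<noteq> 0"
proof
  assume disc: "4 * a^3 + 27 * b^2 = 0"
  obtain y where y: "a = - 3 * y^2" "b = 2 * y^3"
  proof (cases "a = 0")
    case True
    then show ?thesis using disc by (intro that[of 0]) auto
  next
    case False
    \<comment> \<open>The double root also satisfies 3 Y^2 + a = 0; eliminating Y^3 leaves 2 a Y + 3
      b = 0.\<close>
    define y where "y = - 3 * b / (2 * a)"
    have b: "b = - 2 * a * y / 3" using False by (simp add: y_def)
    have "4 * a^2 * (a + 3 * y^2) = 0"
      using disc unfolding b by (simp add: power2_eq_square power3_eq_cube field_simps)
    then have "a = - 3 * y^2" using False by (simp add: eq_neg_iff_add_eq_0)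
    moreover from this b have "b = 2 * y^3" by (simp add: power2_eq_square power3_eq_cube)
    ultimately show ?thesis by (rule that)
  qed
  have "singular_at (weierstrass a b) (vec3 1 y 0)"
    unfolding singular_at_def
  proof
    fix w :: "'a ^ 3"
    define p where "p = w $ 2 - y * w $ 1"
    have w: "w $ 2 = p + y * w $ 1" by (simp add: p_def)
    have "weierstrass a b (vec3 1 y 0 + t *s w) = t^2 * ((w $ 3)^2 + 3 * y * p^2)
        + t^3 * (w $ 1 * (w $ 3)^2 + p^2 * (p + 3 * y * w $ 1))" for t
      unfolding weierstrass_def y by (simp add: w) (simp add: expand_simps)
    then show "\<exists>a' b'. \<forall>t. weierstrass a b (vec3 1 y 0 + t *s w) = t^2 * a' + t^3 * b'" by blast
  qed
  then show False
    using assms unfolding smooth_def by (auto simp: vec3_eq_iff)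
qed

subsection \<open>Counting the flex lines of a Weierstrass cubic\<close>

text \<open>A root that occurs twice in the factorisation is also a root of the derivative, so here
  the multiset of roots is a set.\<close>

lemma card_roots_squarefree:
  fixes p :: "'a::{alg_closed_field, field_char_0} poly"
  assumes "p \<noteq> 0" "\<And>x. poly p x = 0 \<Longrightarrow> poly (pderiv p) x \<noteq> 0"
  shows "card {x. poly p x = 0} = Polynomial.degree p"
proof -
  obtain M where M: "size M = Polynomial.degree p"
    "p = Polynomial.smult (Polynomial.lead_coeff p) (\<Prod>x\<in>#M. [:-x, 1:])"
    using alg_closed_imp_factorization[OF assms(1)] by blast
  let ?c = "Polynomial.lead_coeff p"
  have c: "?c \<noteq> 0" using assms(1) by simp
  have "poly p x = ?c * (\<Prod>y\<in>#M. x - y)" for x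
    by (subst M(2)) (simp add: poly_prod_mset image_mset.compositionality o_def)
  then have roots: "{x. poly p x = 0} = set_mset M"
    using c by (auto simp: prod_mset_zero_iff)
  have "count M x = 1" if "x \<in># M" for x
  proof (rule ccontr)
    assume "count M x \<noteq> 1"
    moreover have "count M x \<ge> 1" using that by (simp add: Suc_leI)
    ultimately have "count M x \<ge> 2" by linarith
    then have "{#x, x#} \<subseteq># M" by (auto simp: subseteq_mset_def)
    then obtain N where "M = {#x, x#} + N" by (metis subset_mset.le_iff_add)
    then have N: "M = add_mset x (add_mset x N)" by simp
    define q L where "q = (\<Prod>x\<in>#N. [:-x, 1:])" and "L = [:-x, 1:]"
    have "(\<Prod>x\<in>#M. [:-x, 1:]) = L * (L * q)"
      unfolding N by (simp only: image_mset_add_mset prod_mset.add_mset q_def L_def)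
    with M(2) obtain c' where "p = Polynomial.smult c' (L * (L * q))" by metis
    moreover have "poly L x = 0" by (simp add: L_def)
    ultimately have "poly p x = 0" "poly (pderiv p) x = 0"
      by (simp_all add: pderiv_smult pderiv_mult)
    with assms(2) show False by blast
  qed
  then have "size M = card (set_mset M)"
    by (simp add: size_multiset_overloaded_eq)
  then show ?thesis using M(1) roots by simp
qed

text \<open>A pair (m, n) stands for the flex line z = m y + n x. Squaring the first equation and
  eliminating n^2 leaves a quartic for w = m^2, which is separable because the discriminant does not
  vanish. Each of its four roots carries two solutions, exchanged by changing the signs of m and
  n.\<close>

lemma card_flex_parameters:
  fixes a b :: "'a::{alg_closed_field, field_char_0}"
  assumes disc: "4 * a^3 + 27 * b^2 \<noteq> 0"
  shows "card {(m, n). 2 * m * n = m^4 / 3 - a \<and> n^2 = m^6 / 27 - b} = 8" (is "card ?S = 8")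
proof -
  define p where "p = [:- 27 * a^2, - 108 * b, 18 * a, 0, 1:]"
  have p: "poly p w = w^4 + 18 * a * w^2 - 108 * b * w - 27 * a^2" for w
    by (simp add: p_def algebra_simps power2_eq_square eval_nat_numeral)
  have "card {w. poly p w = 0} = Polynomial.degree p"
  proof (rule card_roots_squarefree)
    show "p \<noteq> 0" by (simp add: p_def)
    fix w assume w: "poly p w = 0"
    show "poly (pderiv p) w \<noteq> 0"
    proof
      assume "poly (pderiv p) w = 0"
      moreover have "4 * (w^3 + 9 * a * w - 27 * b) = poly (pderiv p) w"
        by (simp add: p_def pderiv_pCons expand_simps)
      ultimately have "w^3 + 9 * a * w - 27 * b = 0"
        by (metis mult_eq_0_iff zero_neq_numeral)
      then have b: "b = (w^3 + 9 * a * w) / 27" by (simp add: field_simps)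
      \<comment> \<open>Once the derivative vanishes, the quartic is -3 times a square, so a double
        root forces w^2 = - 3 a; then a and b are expressed by w and have discriminant 0.\<close>
      have "- 3 * (w^2 + 3 * a)^2 = poly p w"
        unfolding p b by (simp add: algebra_simps power2_eq_square eval_nat_numeral)
      with w have "w^2 + 3 * a = 0" by simp
      then have "3 * a = - (w^2)" by (simp add: eq_neg_iff_add_eq_0 add.commute)
      then have a: "a = - (w^2) / 3" by (metis nonzero_mult_div_cancel_left zero_neq_numeral)
      have "4 * a^3 + 27 * b^2 = 0"
        unfolding b a by (simp add: field_simps power2_eq_square power3_eq_cube)
      with disc show False by blast
    qed
  qed
  then have R: "card {w. poly p w = 0} = 4" by (simp add: p_def)
  then have "finite {w. poly p w = 0}" by (metis card.infinite zero_neq_numeral)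
  define f where "f w = {(m, n). (m, n) \<in> ?S \<and> m^2 = w}" for w
  have S: "?S = (\<Union>w\<in>{w. poly p w = 0}. f w)"
  proof -
    have "poly p (m^2) = 0" if "2 * m * n = m^4 / 3 - a" "n^2 = m^6 / 27 - b" for m n
    proof -
      have a: "a = m^4 / 3 - 2 * m * n" and b: "b = m^6 / 27 - n^2" using that by simp_all
      \<comment> \<open>Writing m = 3 r clears the denominators 3 and 27.\<close>
      define r where "r = m / 3"
      have m: "m = 3 * r" by (simp add: r_def)
      show ?thesis
        unfolding p a b m by (simp add: power_mult_distrib) (simp add: algebra_simps power2_eq_square eval_nat_numeral)
    qed
    then show ?thesis by (auto simp: f_def)
  qed
  have f2: "finite (f w) \<and> card (f w) = 2" if w: "poly p w = 0" for w
  proof (cases "w = 0")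
    case True
    \<comment> \<open>For w = 0 the first equation does not determine n. Instead a = 0, and the
      second equation gives two values of n.\<close>
    with w have a: "a = 0" by (simp add: p)
    with disc have "b \<noteq> 0" by auto
    obtain n where n: "n^2 = - b" using square_root_exists by blast
    with \<open>b \<noteq> 0\<close> have "n \<noteq> 0" by auto
    have "f w = {(0, n), (0, - n)}"
    proof -
      have "x \<in> f w \<longleftrightarrow> fst x = 0 \<and> (snd x)^2 = - b" for x
        by (cases x) (auto simp: f_def True a)
      moreover have "n'^2 = - b \<longleftrightarrow> n' = n \<or> n' = - n" for n'
        unfolding n[symmetric] by (rule power2_eq_iff)
      ultimately have "x \<in> f w \<longleftrightarrow> x \<in> {(0, n), (0, - n)}" for x
        by (cases x) auto
      then show ?thesis by blast
    qed
    with \<open>n \<noteq> 0\<close> show ?thesis by simp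
  next
    case False
    obtain m where m: "m^2 = w" using square_root_exists by blast
    with False have "m \<noteq> 0" by auto
    define n where "n = (m^4 / 3 - a) / (2 * m)"
    have n: "2 * m * n = m^4 / 3 - a" using \<open>m \<noteq> 0\<close> by (simp add: n_def)
    then have a: "a = m^4 / 3 - 2 * m * n" by simp
    have "108 * m^2 * (m^6 / 27 - b - n^2) = poly p (m^2)"
    proof -
      define r where "r = m / 3"
      have m: "m = 3 * r" by (simp add: r_def)
      show ?thesis
        unfolding p a m by (simp add: power_mult_distrib) (simp add: algebra_simps power2_eq_square eval_nat_numeral)
    qed
    then have n2: "n^2 = m^6 / 27 - b" using w m \<open>m \<noteq> 0\<close> False by simp
    have "f w = {(m, n), (- m, - n)}"
    proof -
      have "(m', n') = (m, n) \<or> (m', n') = (- m, - n)"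
        if "m'^2 = w" "2 * m' * n' = m'^4 / 3 - a" for m' n'
      proof -
        have "m' = m \<or> m' = - m" using that(1) m power2_eq_iff by metis
        then show ?thesis
        proof
          assume "m' = m"
          then have "2 * m * n' = 2 * m * n" using that(2) n by simp
          then show ?thesis using \<open>m' = m\<close> \<open>m \<noteq> 0\<close> by simp
        next
          assume "m' = - m"
          then have "2 * m * (- n') = 2 * m * n" using that(2) n by simp
          moreover have "2 * m \<noteq> 0" using \<open>m \<noteq> 0\<close> by simp
          ultimately have "- n' = n" by (metis mult_left_cancel)
          then show ?thesis using \<open>m' = - m\<close> by auto
        qed
      qed
      then have "f w \<subseteq> {(m, n), (- m, - n)}" by (auto simp only: f_def case_prod_conv mem_Collect_eq)
      moreover have "(m, n) \<in> f w" "(- m, - n) \<in> f w"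
        using m n n2 by (simp_all add: f_def)
      ultimately show ?thesis by blast
    qed
    moreover have "m \<noteq> - m" using \<open>m \<noteq> 0\<close> by simp
    ultimately show ?thesis by simp
  qed
  have "card (\<Union>w\<in>{w. poly p w = 0}. f w) = (\<Sum>w\<in>{w. poly p w = 0}. card (f w))"
    by (rule card_UN_disjoint) (use \<open>finite {w. poly p w = 0}\<close> f2 in \<open>auto simp: f_def\<close>)
  also have "\<dots> = 8" using f2 R by simp
  finally show ?thesis unfolding S .
qed

section \<open>Flex lines as points of the dual projective plane\<close>

lemma proj_point_eq_iff: "proj_point v = proj_point w \<longleftrightarrow> (\<exists>c. c \<noteq> 0 \<and> w = c *s v)"
proof
  assume "proj_point v = proj_point w"
  moreover have "w \<in> proj_point w" unfolding proj_point_def by (auto intro!: exI[of _ 1])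
  ultimately show "\<exists>c. c \<noteq> 0 \<and> w = c *s v" by (auto simp: proj_point_def)
next
  assume "\<exists>c. c \<noteq> 0 \<and> w = c *s v"
  then obtain c where c: "c \<noteq> 0" "w = c *s v" by blast
  show "proj_point v = proj_point w"
  proof (intro subset_antisym subsetI)
    fix x assume "x \<in> proj_point v"
    then obtain d where "d \<noteq> 0" "x = d *s v" by (auto simp: proj_point_def)
    with c have "d / c \<noteq> 0" "x = (d / c) *s w" by simp_all
    then show "x \<in> proj_point w" unfolding proj_point_def by blast
  next
    fix x assume "x \<in> proj_point w"
    then obtain d where "d \<noteq> 0" "x = d *s w" by (auto simp: proj_point_def)
    with c have "d * c \<noteq> 0" "x = (d * c) *s v" by simp_all
    then show "x \<in> proj_point v" unfolding proj_point_def by blast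
  qed
qed

text \<open>On z = m y + n x the cubic is y^3 + m^2 x y^2 + (2 m n + a) x^2 y + (n^2 + b) x^3. It is
  a cube exactly when it equals (y + r x)^3 for some r, and inserting r = m^2 / 3 leaves the two
  equations. Among the lines through (0, 0, 1), those with \<open>c $ 3 = 0\<close>, only x = 0 is a
  flex line.\<close>

lemma weierstrass_flex_line_iff:
  fixes a b :: "'a::{alg_closed_field, field_char_0}"
  shows "flex_line (weierstrass a b) c \<longleftrightarrow> c \<noteq> 0 \<and> ((c $ 2 = 0 \<and> c $ 3 = 0) \<or>
    (\<exists>m n. c = (- (c $ 3)) *s vec3 n m (-1) \<and> 2 * m * n = m^4 / 3 - a \<and> n^2 = m^6 / 27 - b))"
    (is "_ \<longleftrightarrow> _ \<and> (?I \<or> ?J)")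
proof
  assume fl: "flex_line (weierstrass a b) c"
  then have "c \<noteq> 0" by (simp add: flex_line_def)
  obtain l where l: "\<And>v. lin c v = 0 \<Longrightarrow> weierstrass a b v = (lin l v)^3"
    using fl unfolding flex_line_def by blast
  have "?I \<or> ?J"
  proof (cases "c $ 3 = 0")
    case True
    have "c $ 2 = 0"
    proof (rule ccontr)
      assume c2: "c $ 2 \<noteq> 0"
      define u where "u = - c $ 1 / c $ 2"
      have eq: "weierstrass a b (vec3 x (u * x) z) = (lin l (vec3 x (u * x) z))^3" for x z
        using c2 True by (intro l) (simp add: lin_3 u_def)
      from eq[of 0 1] have "l $ 3 = 0" by (simp add: weierstrass_def lin_3)
      \<comment> \<open>The cube does not depend on z, whereas the cubic contains x z^2.\<close>
      then have "lin l (vec3 1 (u * 1) 1) = lin l (vec3 1 (u * 1) 0)"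
        by (simp add: lin_3)
      with eq[of 1 0] eq[of 1 1] have "weierstrass a b (vec3 1 (u * 1) 1) = weierstrass a b (vec3 1 (u * 1) 0)"
        by simp
      then show False by (simp add: weierstrass_def)
    qed
    with True show ?thesis by blast
  next
    case False
    define m n where "m = - c $ 2 / c $ 3" and "n = - c $ 1 / c $ 3"
    have c: "c = (- (c $ 3)) *s vec3 n m (-1)"
      using False by (simp add: vec3_eq_iff m_def n_def)
    define p q where "p = l $ 1 + l $ 3 * n" and "q = l $ 2 + l $ 3 * m"
    have eq: "weierstrass a b (vec3 x y (m * y + n * x)) = (p * x + q * y)^3" for x y
    proof -
      have "lin c (vec3 x y (m * y + n * x)) = 0"
        by (subst c) (simp add: lin_3 algebra_simps)
      from l[OF this] show ?thesis by (simp add: lin_3 p_def q_def algebra_simps)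
    qed
    have "(n^2 + b) * x^3 + (2 * m * n + a) * x^2 * y + m^2 * x * y^2 + 1 * y^3
        = p^3 * x^3 + (3 * p^2 * q) * x^2 * y + (3 * p * q^2) * x * y^2 + q^3 * y^3" for x y
      using eq[of x y] by (simp add: weierstrass_def expand_simps)
    note co = binary_cubic_inject[OF this]
    \<comment> \<open>Since q^3 = 1, this is p / q, and (p x + q y)^3 = (r x + y)^3.\<close>
    define r where "r = p * q^2"
    have q3: "q^3 = 1" using co(4) by simp
    have m2: "m^2 = 3 * r" using co(3) by (simp add: r_def)
    have "r^2 = p^2 * q * q^3" by (simp add: r_def power2_eq_square power3_eq_cube)
    then have r2: "3 * r^2 = 2 * m * n + a" using co(2) q3 by simp
    have "r^3 = p^3 * q^3 * q^3" by (simp add: r_def power2_eq_square power3_eq_cube)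
    then have r3: "r^3 = n^2 + b" using co(1) q3 by simp
    have "m^4 = (3 * r)^2" "m^6 = (3 * r)^3"
      unfolding m2[symmetric] by (simp_all add: power_mult[symmetric])
    then have "m^4 = 9 * r^2" "m^6 = 27 * r^3" by (simp_all add: power_mult_distrib)
    then have "2 * m * n = m^4 / 3 - a" "n^2 = m^6 / 27 - b"
      using r2 r3 by (simp_all add: field_simps)
    with c show ?thesis by blast
  qed
  with \<open>c \<noteq> 0\<close> show "c \<noteq> 0 \<and> (?I \<or> ?J)" by blast
next
  assume c: "c \<noteq> 0 \<and> (?I \<or> ?J)"
  have "\<exists>l. \<forall>v. lin c v = 0 \<longrightarrow> weierstrass a b v = (lin l v)^3"
  proof (cases ?I)
    case True
    with c have "c $ 1 \<noteq> 0" by (auto simp: vec3_eq_iff)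
    then show ?thesis using True
      by (intro exI[of _ "vec3 0 1 0"]) (simp add: lin_3 weierstrass_def)
  next
    case False
    with c obtain m n where mn: "c = (- (c $ 3)) *s vec3 n m (-1)" "2 * m * n = m^4 / 3 - a" "n^2 = m^6 / 27 - b"
      by blast
    have "c $ 3 \<noteq> 0" using mn(1) c by (metis neg_equal_0_iff_equal vector_smult_lzero)
    have ab: "a = m^4 / 3 - 2 * m * n" "b = m^6 / 27 - n^2" using mn by simp_all
    have "weierstrass a b v = (lin (vec3 (m^2 / 3) 1 0) v)^3" if "lin c v = 0" for v
    proof -
      have "- (c $ 3) * lin (vec3 n m (-1)) v = 0"
        using that mn(1) lin_smult_left by metis
      with \<open>c $ 3 \<noteq> 0\<close> have v3: "v $ 3 = n * v $ 1 + m * v $ 2" by (simp add: lin_3)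
      show ?thesis
        unfolding weierstrass_def lin_3 v3 ab vec3_nth
        by (simp add: field_simps power2_eq_square eval_nat_numeral)
    qed
    then show ?thesis by blast
  qed
  with c show "flex_line (weierstrass a b) c" unfolding flex_line_def by blast
qed

text \<open>The last coordinate -1 normalises the covector, so distinct parameters give distinct
  lines; x = 0 is the ninth.\<close>

lemma card_weierstrass_flex_lines:
  fixes a b :: "'a::{alg_closed_field, field_char_0}"
  assumes "4 * a^3 + 27 * b^2 \<noteq> 0"
  shows "card {proj_point c | c. flex_line (weierstrass a b) c} = 9"
proof -
  define S where "S = {(m, n). 2 * m * n = m^4 / 3 - a \<and> n^2 = m^6 / 27 - b}"
  have S: "card S = 8" unfolding S_def by (rule card_flex_parameters[OF assms])
  then have "finite S" by (metis card.infinite zero_neq_numeral)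
  define g where "g = (\<lambda>(m, n). proj_point (vec3 n m (-1 :: 'a)))"
  have "inj_on g S"
    by (auto simp: inj_on_def g_def proj_point_eq_iff vec3_eq_iff)
  have "{proj_point c | c. flex_line (weierstrass a b) c} = insert (proj_point (vec3 1 0 0)) (g ` S)"
  proof (intro subset_antisym subsetI)
    fix Z assume "Z \<in> {proj_point c | c. flex_line (weierstrass a b) c}"
    then obtain c where Z: "Z = proj_point c" and fl: "flex_line (weierstrass a b) c" by blast
    from fl consider "c \<noteq> 0" "c $ 2 = 0" "c $ 3 = 0" | m n where "c \<noteq> 0" "c = (- (c $ 3)) *s vec3 n m (-1)" "(m, n) \<in> S"
      unfolding weierstrass_flex_line_iff S_def by blast
    then show "Z \<in> insert (proj_point (vec3 1 0 0)) (g ` S)"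
    proof cases
      case 1
      then have "c $ 1 \<noteq> 0" "c = c $ 1 *s vec3 1 0 0" by (auto simp: vec3_eq_iff)
      then have "Z = proj_point (vec3 1 0 0)"
        unfolding Z by (metis proj_point_eq_iff)
      then show ?thesis by blast
    next
      case 2
      then have "- (c $ 3) \<noteq> 0" by (metis vector_smult_lzero)
      then have "Z = g (m, n)"
        unfolding Z g_def using 2(2) by (metis case_prod_conv proj_point_eq_iff)
      then show ?thesis using 2(3) by blast
    qed
  next
    fix Z assume "Z \<in> insert (proj_point (vec3 1 0 0)) (g ` S)"
    then consider "Z = proj_point (vec3 1 0 0)" | m n where "(m, n) \<in> S" "Z = proj_point (vec3 n m (-1))"
      by (auto simp: g_def)
    then show "Z \<in> {proj_point c | c. flex_line (weierstrass a b) c}"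
    proof cases
      case 1
      have "flex_line (weierstrass a b) (vec3 1 0 0)"
        unfolding weierstrass_flex_line_iff by (simp add: vec3_eq_iff)
      then show ?thesis using 1 by blast
    next
      case 2
      have "flex_line (weierstrass a b) (vec3 n m (-1))"
        unfolding weierstrass_flex_line_iff using 2(1)
        by (auto simp: vec3_eq_iff S_def intro!: exI[of _ m] exI[of _ n])
      then show ?thesis using 2 by blast
    qed
  qed
  moreover have "proj_point (vec3 1 0 0) \<notin> g ` S"
    by (auto simp: g_def proj_point_eq_iff vec3_eq_iff)
  moreover have "card (g ` S) = 8"
    using S card_image[OF \<open>inj_on g S\<close>] by simp
  ultimately show ?thesis using \<open>finite S\<close> by simp
qed

lemma flex_line_smult:
  assumes "flex_line F m" "c \<noteq> 0"
  shows "flex_line F (c *s m)"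
  using assms unfolding flex_line_def by (auto simp: lin_smult_left)

lemma card_flex_lines_substitution:
  fixes M :: "'a::field ^ 3 ^ 3"
  assumes M: "invertible M" and F: "\<And>v. F v = G (M *v v)"
  shows "card {proj_point m | m. flex_line F m} = card {proj_point m | m. flex_line G m}"
proof -
  obtain N where N: "invertible N" "\<And>v. M *v (N *v v) = v" "\<And>m. (m v* N) v* M = m" "\<And>m. (m v* M) v* N = m"
    using invertible_obtain[OF M] by metis
  define h where "h = (\<lambda>m. m v* M)"
  have "inj h" by (metis N(4) h_def injI)
  have F': "F = (\<lambda>v. G (M *v v))" using F by blast
  have G': "G = (\<lambda>v. F (N *v v))" using F N by simp
  have "(c *s m) v* M = c *s (m v* M)" for c m
    by (simp add: vec_eq_iff vector_matrix_mult_def sum_distrib_left mult_ac)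
  then have "h (c *s m) = c *s h m" for c m by (simp add: h_def)
  then have h: "h ` proj_point m = proj_point (h m)" for m
    unfolding proj_point_def setcompr_eq_image image_image by simp
  have "{proj_point m | m. flex_line F m} = image h ` {proj_point m | m. flex_line G m}"
  proof (intro subset_antisym subsetI)
    fix Z assume "Z \<in> {proj_point m | m. flex_line F m}"
    then obtain m where m: "Z = proj_point m" "flex_line F m" by blast
    have "flex_line G (m v* N)" unfolding G' by (rule flex_line_substitution[OF m(2) N(1)])
    moreover have "Z = h ` proj_point (m v* N)" unfolding h m by (simp add: h_def N)
    ultimately show "Z \<in> image h ` {proj_point m | m. flex_line G m}" by blast
  next
    fix Z assume "Z \<in> image h ` {proj_point m | m. flex_line G m}"
    then obtain m where m: "Z = h ` proj_point m" "flex_line G m" by blast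
    have "flex_line F (h m)" unfolding F' h_def by (rule flex_line_substitution[OF m(2) M])
    then show "Z \<in> {proj_point m | m. flex_line F m}" using m(1) h by blast
  qed
  then show ?thesis
    using card_image[of "image h" "{proj_point m | m. flex_line G m}"] \<open>inj h\<close>
    by (simp add: inj_on_def inj_image_eq_iff)
qed

lemma card_flex_lines_if_flex_line:
  fixes F :: "'a::{alg_closed_field, field_char_0} ^ 3 \<Rightarrow> 'a"
  assumes "smooth F" "form 3 F" "flex_line F m"
  shows "card {proj_point m | m. flex_line F m} = 9"
proof -
  obtain A B C D E H M where M: "invertible (M :: 'a ^ 3 ^ 3)" "H \<noteq> 0"
    "\<And>v. F v = flex_cubic A B C D E H 1 (M *v v)"
    by (rule flex_normal_form[OF assms]) (rule that)
  obtain a b N where N: "invertible (N :: 'a ^ 3 ^ 3)" "\<And>v. flex_cubic A B C D E H 1 v = weierstrass a b (N *v v)"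
    by (rule weierstrass_form[OF M(2)]) (rule that)
  have F: "F v = weierstrass a b ((N ** M) *v v)" for v
    by (simp add: M(3) N(2) matrix_vector_mul_assoc)
  have NM: "invertible (N ** M)" by (rule invertible_mult[OF N(1) M(1)])
  obtain K where K: "invertible K" "\<And>v. (N ** M) *v (K *v v) = v"
    using invertible_obtain[OF NM] by metis
  have "smooth (\<lambda>v. F (K *v v))" by (rule smooth_substitution[OF assms(1) K(1)])
  then have "smooth (weierstrass a b)" unfolding F K by (simp add: eta_contract_eq)
  then show ?thesis
    using card_weierstrass_flex_lines[OF weierstrass_discriminant]
      card_flex_lines_substitution[where G = "weierstrass a b", OF NM F] by simp
qed

subsection \<open>Existence of a flex line\<close>

text \<open>Either (1, 0) is a zero, or the coefficient of x^d is nonzero and the polynomial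
  obtained for y = 1 has a root.\<close>

lemma binary_form_zero:
  fixes f :: "'a::alg_closed_field ^ 3 \<Rightarrow> 'a"
  assumes "form d f" "d > 0"
  obtains x y where "(x, y) \<noteq> (0, 0)" "f (vec3 x y 0) = 0"
proof -
  obtain P where P: "homogeneous d P" "\<And>v. teval P v = f v"
    using assms(1) by (auto simp: form_iff)
  define e where "e a = lookup P (expo 1 2 3 a (d - a) 0)" for a
  have f: "f (vec3 x y 0) = (\<Sum>a\<le>d. e a * (x ^ a * y ^ (d - a)))" for x y
  proof -
    have inner: "(\<Sum>b\<le>d - a. lookup P (expo 1 2 3 a b (d - a - b)) * (x ^ a * y ^ b * 0 ^ (d - a - b)))
        = e a * (x ^ a * y ^ (d - a))" if "a \<le> d" for a
    proof -
      have "(\<Sum>b\<le>d - a. lookup P (expo 1 2 3 a b (d - a - b)) * (x ^ a * y ^ b * 0 ^ (d - a - b)))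
        = (\<Sum>b\<le>d - a. if b = d - a then e a * (x ^ a * y ^ (d - a)) else 0)"
        by (rule sum.cong) (auto simp: e_def power_0_left)
      then show ?thesis by simp
    qed
    have "(1 :: 3) \<noteq> 2" "(2 :: 3) \<noteq> 3" "(1 :: 3) \<noteq> 3" by simp_all
    from teval_expansion[OF this P(1), of "vec3 x y 0"] show ?thesis
      unfolding P(2) vec3_nth by (simp only:) (rule sum.cong[OF refl], rule inner, simp)
  qed
  show ?thesis
  proof (cases "e d = 0")
    case True
    have "f (vec3 1 0 0) = (\<Sum>a\<le>d. if a = d then e d else 0)"
      unfolding f by (rule sum.cong) (auto simp: power_0_left)
    with True have "f (vec3 1 0 0) = 0" by simp
    then show ?thesis by (intro that[of 1 0]) auto
  next
    case False
    then obtain x where "(\<Sum>a\<le>d. e a * x ^ a) = 0"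
      using alg_closed[OF assms(2)] by blast
    then show ?thesis by (intro that[of x 1]) (simp_all add: f)
  qed
qed

text \<open>The left-hand side is the resultant of \<open>z^3 + a z^2 + b z + c\<close>, with roots \<open>r, s, t\<close>, and
  \<open>p z^2 + q z + u\<close>, written in terms of the coefficients.\<close>

lemma resultant_cubic_quadratic:
  fixes p q u r s t :: "'a::comm_ring_1"
  assumes "a = - (r + s + t)" "b = r * s + s * t + r * t" "c = - r * s * t"
  shows "p*p*p*c*c + (-1)*(p*p*q*c*b) + p*p*u*b*b + (-2)*(p*p*u*a*c) + p*q*q*a*c + (-1)*(p*q*u*a*b)
     + 3*(p*q*u*c) + p*u*u*a*a + (-2)*(p*u*u*b) + (-1)*(q*q*q*c) + q*q*u*b + (-1)*(q*u*u*a) + u*u*u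
     = (p * r^2 + q * r + u) * (p * s^2 + q * s + u) * (p * t^2 + q * t + u)"
  unfolding assms by (simp add: algebra_simps power2_eq_square)

text \<open>Elimination of the third coordinate z. As F has a nonzero coefficient at z^3, G can be
  reduced modulo F to degree 2 in z. The resultant R is a form of degree 9 in the first two
  coordinates and has a nontrivial zero (x, y), over which the two polynomials in z share a
  root.\<close>

lemma common_zero:
  fixes F G :: "'a::{alg_closed_field, field_char_0} ^ 3 \<Rightarrow> 'a"
  assumes "form 3 F" "form 3 G" "F (vec3 0 0 1) \<noteq> 0"
  obtains v where "v \<noteq> 0" "F v = 0" "G v = 0"
proof -
  obtain c1 c2 c3 c4 c5 c6 c7 c8 c9 c0 where F: "\<And>v. F v = ternary_cubic c1 c2 c3 c4 c5 c6 c7 c8 c9 c0 (v $ 1) (v $ 2) (v $ 3)"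
    using assms(1) by (rule cubic_form_in[of 1 2 3, rotated 3]) auto
  have c0: "c0 \<noteq> 0" using assms(3) by (simp add: F)
  obtain d1 d2 d3 d4 d5 d6 d7 d8 d9 d0 where G: "\<And>v. G v = ternary_cubic d1 d2 d3 d4 d5 d6 d7 d8 d9 d0 (v $ 1) (v $ 2) (v $ 3)"
    using assms(2) by (rule cubic_form_in[of 1 2 3, rotated 3]) auto
  define f1 where "f1 a b v = a * v $ 1 + b * v $ 2" for a b and v :: "'a ^ 3"
  define f2 where "f2 a b c v = a * (v $ 1 * v $ 1) + b * (v $ 1 * v $ 2) + c * (v $ 2 * v $ 2)" for a b c and v :: "'a ^ 3"
  define f3 where "f3 a b c d v = a * (v $ 1 * v $ 1 * v $ 1) + b * (v $ 1 * v $ 1 * v $ 2) + c * (v $ 1 * v $ 2 * v $ 2)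
     + d * (v $ 2 * v $ 2 * v $ 2)" for a b c d and v :: "'a ^ 3"
  have form1: "form 1 (f1 a b)" for a b
    unfolding f1_def[abs_def] by (intro form_add form_scale form_var)
  have form2: "form 2 (f2 a b c)" for a b c
    unfolding f2_def[abs_def] by (intro form_add form_scale form_mult_11 form_var)
  have form_21: "form 3 (\<lambda>v. f v * g v)" if "form 2 f" "form 1 g" for f g :: "'a ^ 3 \<Rightarrow> 'a"
    using form_mult[OF that] by simp
  have form3: "form 3 (f3 a b c d)" for a b c d
    unfolding f3_def[abs_def] by (intro form_add form_scale form_21 form_mult_11 form_var)
  define a where "a = f1 (c8 / c0) (c9 / c0)"
  define b where "b = f2 (c5 / c0) (c6 / c0) (c7 / c0)"
  define c where "c = f3 (c1 / c0) (c2 / c0) (c3 / c0) (c4 / c0)"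
  define p where "p = f1 (d8 - d0 * (c8 / c0)) (d9 - d0 * (c9 / c0))"
  define q where "q = f2 (d5 - d0 * (c5 / c0)) (d6 - d0 * (c6 / c0)) (d7 - d0 * (c7 / c0))"
  define u where "u = f3 (d1 - d0 * (c1 / c0)) (d2 - d0 * (c2 / c0)) (d3 - d0 * (c3 / c0)) (d4 - d0 * (c4 / c0))"
  have forms: "form 1 a" "form 2 b" "form 3 c" "form 1 p" "form 2 q" "form 3 u"
    unfolding a_def b_def c_def p_def q_def u_def by (rule form1 form2 form3)+
  have F': "F v = c0 * ((v $ 3)^3 + a v * (v $ 3)^2 + b v * v $ 3 + c v)" for v
    unfolding F a_def b_def c_def f1_def f2_def f3_def
    using c0 by (simp add: field_simps power2_eq_square power3_eq_cube)
  have G': "G v = d0 * ((v $ 3)^3 + a v * (v $ 3)^2 + b v * v $ 3 + c v) + (p v * (v $ 3)^2 + q v * v $ 3 + u v)" for v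
    unfolding G a_def b_def c_def p_def q_def u_def f1_def f2_def f3_def
    by (simp add: expand_simps)
  define R where "R v = p v * p v * p v * c v * c v + (-1) * (p v * p v * q v * c v * b v) + p v * p v * u v * b v * b v
     + (-2) * (p v * p v * u v * a v * c v) + p v * q v * q v * a v * c v + (-1) * (p v * q v * u v * a v * b v)
     + 3 * (p v * q v * u v * c v) + p v * u v * u v * a v * a v + (-2) * (p v * u v * u v * b v) + (-1) * (q v * q v * q v * c v)
     + q v * q v * u v * b v + (-1) * (q v * u v * u v * a v) + u v * u v * u v" for v
  have deg: "form m f \<Longrightarrow> m = n \<Longrightarrow> form n f" for m n and f :: "'a ^ 3 \<Rightarrow> 'a" by simp
  have "form 9 R"
    unfolding R_def[abs_def]
    apply (intro form_add form_scale)
    apply (rule deg, (rule form_mult forms)+, simp)+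
    done
  then obtain x y where xy: "(x, y) \<noteq> (0, 0)" "R (vec3 x y 0) = 0"
    by (rule binary_form_zero) auto
  let ?w = "vec3 x y 0"
  obtain r s t where rst: "\<And>z. 1 * z^3 + a ?w * z^2 + b ?w * z + c ?w = 1 * (z - r) * (z - s) * (z - t)"
    by (rule cubic_roots[of 1 "a ?w" "b ?w" "c ?w"]) auto
  have "R ?w = (p ?w * r^2 + q ?w * r + u ?w) * (p ?w * s^2 + q ?w * s + u ?w) * (p ?w * t^2 + q ?w * t + u ?w)"
    unfolding R_def using cubic_coeffs_of_roots[OF rst] by (intro resultant_cubic_quadratic) simp_all
  with xy(2) obtain z where z: "p ?w * z^2 + q ?w * z + u ?w = 0" "z \<in> {r, s, t}"
    by auto
  then have z': "z^3 + a ?w * z^2 + b ?w * z + c ?w = 0" using rst[of z] by auto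
  \<comment> \<open>These coefficients depend on the first two coordinates only, so the value found
    for z may be put back.\<close>
  have only_xy: "f (vec3 x y z) = f ?w" if "f \<in> {a, b, c, p, q, u}" for f
    using that by (auto simp: a_def b_def c_def p_def q_def u_def f1_def f2_def f3_def)
  have "F (vec3 x y z) = 0" "G (vec3 x y z) = 0"
    using z z' by (simp_all add: F' G' only_xy)
  moreover have "vec3 x y z \<noteq> 0" using xy(1) by (auto simp: vec3_eq_iff)
  ultimately show ?thesis using that by blast
qed

text \<open>The covector m is the cross product of p and w; the coefficients with respect to p and w
  come from Cramer's rule, using a coordinate of m that is not zero.\<close>

lemma plane_spanned:
  fixes p w :: "'a::field ^ 3"
  assumes "w \<noteq> 0" "\<And>c. p \<noteq> c *s w"
  obtains m \<alpha> \<beta> where "m \<noteq> 0" "\<And>v. lin m v = 0 \<Longrightarrow> v = lin \<alpha> v *s p + lin \<beta> v *s w"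
proof -
  define m where "m = vec3 (p $ 2 * w $ 3 - p $ 3 * w $ 2) (p $ 3 * w $ 1 - p $ 1 * w $ 3) (p $ 1 * w $ 2 - p $ 2 * w $ 1)"
  have m: "m $ 1 = p $ 2 * w $ 3 - p $ 3 * w $ 2" "m $ 2 = p $ 3 * w $ 1 - p $ 1 * w $ 3"
    "m $ 3 = p $ 1 * w $ 2 - p $ 2 * w $ 1" by (simp_all add: m_def)
  have "m \<noteq> 0"
  proof
    assume "m = 0"
    then have c: "p $ 2 * w $ 3 = p $ 3 * w $ 2" "p $ 3 * w $ 1 = p $ 1 * w $ 3" "p $ 1 * w $ 2 = p $ 2 * w $ 1"
      using m by simp_all
    consider "w $ 1 \<noteq> 0" | "w $ 2 \<noteq> 0" | "w $ 3 \<noteq> 0" using assms(1) by (auto simp: vec3_eq_iff)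
    then have "\<exists>c. p = c *s w"
    proof cases
      case 1
      then show ?thesis using c by (intro exI[of _ "p $ 1 / w $ 1"]) (simp add: vec3_eq_iff field_simps)
    next
      case 2
      then show ?thesis using c by (intro exI[of _ "p $ 2 / w $ 2"]) (simp add: vec3_eq_iff field_simps)
    next
      case 3
      then show ?thesis using c by (intro exI[of _ "p $ 3 / w $ 3"]) (simp add: vec3_eq_iff field_simps)
    qed
    then show False using assms(2) by blast
  qed
  then consider "m $ 1 \<noteq> 0" | "m $ 2 \<noteq> 0" | "m $ 3 \<noteq> 0" by (auto simp: vec3_eq_iff)
  then have "\<exists>\<alpha> \<beta>. \<forall>v. lin m v = 0 \<longrightarrow> v = lin \<alpha> v *s p + lin \<beta> v *s w"
  proof cases
    case 1
    have "v = lin (vec3 0 (w $ 3 / m $ 1) (- w $ 2 / m $ 1)) v *s p + lin (vec3 0 (- p $ 3 / m $ 1) (p $ 2 / m $ 1)) v *s w"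
      if "lin m v = 0" for v
    proof -
      have "m $ 1 * v $ 1 = - (m $ 2 * v $ 2) - m $ 3 * v $ 3" using that by (simp add: lin_3 algebra_simps eq_neg_iff_add_eq_0)
      then have v1: "v $ 1 = (- (m $ 2 * v $ 2) - m $ 3 * v $ 3) / m $ 1" using 1 by (simp add: field_simps)
      show ?thesis using 1 unfolding vec3_eq_iff
        by (simp add: lin_3 v1 divide_simps) (simp add: m algebra_simps)
    qed
    then show ?thesis by blast
  next
    case 2
    have "v = lin (vec3 (- w $ 3 / m $ 2) 0 (w $ 1 / m $ 2)) v *s p + lin (vec3 (p $ 3 / m $ 2) 0 (- p $ 1 / m $ 2)) v *s w"
      if "lin m v = 0" for v
    proof -
      have "m $ 2 * v $ 2 = - (m $ 1 * v $ 1) - m $ 3 * v $ 3" using that by (simp add: lin_3 algebra_simps eq_neg_iff_add_eq_0)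
      then have v1: "v $ 2 = (- (m $ 1 * v $ 1) - m $ 3 * v $ 3) / m $ 2" using 2 by (simp add: field_simps)
      show ?thesis using 2 unfolding vec3_eq_iff
        by (simp add: lin_3 v1 divide_simps) (simp add: m algebra_simps)
    qed
    then show ?thesis by blast
  next
    case 3
    have "v = lin (vec3 (w $ 2 / m $ 3) (- w $ 1 / m $ 3) 0) v *s p + lin (vec3 (- p $ 2 / m $ 3) (p $ 1 / m $ 3) 0) v *s w"
      if "lin m v = 0" for v
    proof -
      have "m $ 3 * v $ 3 = - (m $ 1 * v $ 1) - m $ 2 * v $ 2" using that by (simp add: lin_3 algebra_simps eq_neg_iff_add_eq_0)
      then have v1: "v $ 3 = (- (m $ 1 * v $ 1) - m $ 2 * v $ 2) / m $ 3" using 3 by (simp add: field_simps)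
      show ?thesis using 3 unfolding vec3_eq_iff
        by (simp add: lin_3 v1 divide_simps) (simp add: m algebra_simps)
    qed
    then show ?thesis by blast
  qed
  with \<open>m \<noteq> 0\<close> show ?thesis using that by blast
qed

text \<open>If \<open>p\<close> is a zero of the cubic and of its Hessian, and \<open>w\<close> spans the kernel of the second
  derivative at \<open>p\<close>, then the cubic restricted to the line through \<open>p\<close> and \<open>w\<close> is a cube.\<close>

lemma flex_line_exists:
  fixes F :: "'a::{alg_closed_field, field_char_0} ^ 3 \<Rightarrow> 'a"
  assumes "smooth F" "form 3 F" "F (vec3 0 0 1) \<noteq> 0"
  obtains m where "flex_line F m"
proof -
  obtain c1 c2 c3 c4 c5 c6 c7 c8 c9 c0 where F: "\<And>v. F v = ternary_cubic c1 c2 c3 c4 c5 c6 c7 c8 c9 c0 (v $ 1) (v $ 2) (v $ 3)"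
    using assms(2) by (rule cubic_form_in[of 1 2 3, rotated 3]) auto
  define a11 where "a11 = lin (vec3 (6 * c1) (2 * c2) (2 * c5))"
  define a12 where "a12 = lin (vec3 (2 * c2) (2 * c3) c6)"
  define a13 where "a13 = lin (vec3 (2 * c5) c6 (2 * c8))"
  define a22 where "a22 = lin (vec3 (2 * c3) (6 * c4) (2 * c7))"
  define a23 where "a23 = lin (vec3 c6 (2 * c7) (2 * c9))"
  define a33 where "a33 = lin (vec3 (2 * c8) (2 * c9) (6 * c0))"
  note a_defs = a11_def a12_def a13_def a22_def a23_def a33_def
  \<comment> \<open>The matrix of second partial derivatives; its entries are linear in v, so its
    determinant is again a cubic form.\<close>
  define Hess where "Hess v = mat3 (vec3 (a11 v) (a12 v) (a13 v)) (vec3 (a12 v) (a22 v) (a23 v)) (vec3 (a13 v) (a23 v) (a33 v))" for v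
  have form_12: "form 3 (\<lambda>v. f v * g v)" if "form 1 f" "form 2 g" for f g :: "'a ^ 3 \<Rightarrow> 'a"
    using form_mult[OF that] by (simp add: numeral_3_eq_3)
  have "form 3 (\<lambda>v. det (Hess v))"
    unfolding Hess_def det_mat3 vec3_nth a_defs
    by (intro form_add form_diff form_12 form_mult_11 form_lin)
  then obtain p where p: "p \<noteq> 0" "F p = 0" "det (Hess p) = 0"
    using common_zero[OF assms(2) _ assms(3)] by blast
  then obtain w where w: "w \<noteq> 0" "Hess p *v w = 0"
    using invertible_left_inverse[of "Hess p"] invertible_det_nz[of "Hess p"] matrix_left_invertible_ker[of "Hess p"] by blast
  \<comment> \<open>Taylor expansion in s and t. By Euler's relation the first derivative at p in
    direction v is half of \<open>lin p (Hess p *v v)\<close>; the overall factor 2 avoids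
    fractions.\<close>
  have taylor: "2 * F (s *s p + t *s v) = 2 * s^3 * F p + s^2 * t * lin p (Hess p *v v) + s * t^2 * lin v (Hess p *v v) + 2 * t^3 * F v" for s t v
    unfolding F lin_3[of _ "Hess p *v v"] Hess_def mat3_mult a_defs lin_3 vec3_nth
    by (simp add: expand_simps)
  have sym: "lin v (Hess p *v v') = lin v' (Hess p *v v)" for v v'
    unfolding lin_3[of _ "Hess p *v _"] Hess_def mat3_mult lin_3 vec3_nth by (simp add: algebra_simps)
  \<comment> \<open>If p itself were in the kernel, all terms of order below 2 at p would
    vanish.\<close>
  have "p \<noteq> c *s w" for c
  proof
    assume "p = c *s w"
    then have Hp: "Hess p *v p = 0"
      using w(2) by (metis vector_scalar_commute vector_smult_rzero)
    have "singular_at F p"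
      unfolding singular_at_def
    proof
      fix v
      have "lin p (Hess p *v v) = 0" using sym[of p v] Hp by (simp add: lin_3)
      then have "2 * F (p + t *s v) = 2 * (t^2 * (lin v (Hess p *v v) / 2) + t^3 * F v)" for t
        using taylor[of 1 t v] p(2) by (simp add: algebra_simps)
      then have "F (p + t *s v) = t^2 * (lin v (Hess p *v v) / 2) + t^3 * F v" for t
        by (metis mult_left_cancel zero_neq_numeral)
      then show "\<exists>a b. \<forall>t. F (p + t *s v) = t^2 * a + t^3 * b" by blast
    qed
    with assms(1) p(1) show False unfolding smooth_def by blast
  qed
  then obtain m \<alpha> \<beta> where m: "m \<noteq> 0" "\<And>v. lin m v = 0 \<Longrightarrow> v = lin \<alpha> v *s p + lin \<beta> v *s w"
    by (rule plane_spanned[OF w(1)]) (rule that)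
  have restr: "F (s *s p + t *s w) = t^3 * F w" for s t
    using taylor[of s t w] p(2) w(2) by (simp add: lin_3)
  obtain r where r: "r^3 = F w" using cube_root_exists by blast
  have "F v = (lin (r *s \<beta>) v)^3" if "lin m v = 0" for v
    using m(2)[OF that] restr[of "lin \<alpha> v" "lin \<beta> v"] r
    by (metis lin_smult_left mult.commute power_mult_distrib)
  then show ?thesis
    using m(1) that unfolding flex_line_def by blast
qed

text \<open>The value at (0, 0, 1) is the leading coefficient for the elimination. In the
  application this point is a vertex of the limiting triangle, where the cubic is small but not
  zero.\<close>

theorem card_flex_lines:
  fixes F :: "'a::{alg_closed_field, field_char_0} ^ 3 \<Rightarrow> 'a"
  assumes "smooth F" "form 3 F" "F (vec3 0 0 1) \<noteq> 0"
  shows "card {proj_point m | m. flex_line F m} = 9"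
  using flex_line_exists[OF assms] card_flex_lines_if_flex_line[OF assms(1,2)] by blast

lemma other_indices:
  fixes i :: 3
  obtains j k where "i \<noteq> j" "j \<noteq> k" "i \<noteq> k"
proof -
  consider "i = 1" | "i = 2" | "i = 3" using exhaust_3[of i] by blast
  then show ?thesis
  proof cases
    case 1
    then show ?thesis by (intro that[of 2 3]) simp_all
  next
    case 2
    then show ?thesis by (intro that[of 1 3]) simp_all
  next
    case 3
    then show ?thesis by (intro that[of 1 2]) simp_all
  qed
qed

section \<open>Valuation rings\<close>

text \<open>A valuation ring in which 2 is a unit. This makes 4 H a unit whenever H is, as is needed
  for the leading coefficient 4 H k of \<open>tangency\<close>.\<close>

locale residue_char_not_2 =
  fixes V :: "'a::field_char_0 set"
  assumes diff_closed: "\<And>x y. x \<in> V \<Longrightarrow> y \<in> V \<Longrightarrow> x - y \<in> V"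
    and mult_closed: "\<And>x y. x \<in> V \<Longrightarrow> y \<in> V \<Longrightarrow> x * y \<in> V"
    and inverse_mem: "\<And>x. x \<in> V \<or> inverse x \<in> V"
    and half_mem: "inverse 2 \<in> V"
begin

abbreviation "M \<equiv> max_ideal V"

section \<open>Units and the maximal ideal of a valuation ring\<close>

lemma V_0 [simp]: "0 \<in> V"
  using inverse_mem[of 0] by simp

lemma V_1 [simp]: "1 \<in> V"
  using inverse_mem[of 1] by simp

lemma V_uminus [intro]: "x \<in> V \<Longrightarrow> - x \<in> V"
  using diff_closed[of 0 x] by simp

lemma V_add [intro]: "x \<in> V \<Longrightarrow> y \<in> V \<Longrightarrow> x + y \<in> V"
  using diff_closed[of x "- y"] by (simp add: V_uminus)

lemmas V_diff [intro] = diff_closed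
lemmas V_mult [intro] = mult_closed

lemma V_power [intro]: "x \<in> V \<Longrightarrow> x ^ n \<in> V"
  by (induction n) (auto intro: V_mult)

lemma V_of_nat: "of_nat n \<in> V"
  by (induction n) auto

lemma V_numeral [simp]: "numeral n \<in> V"
  using V_of_nat[of "numeral n"] by simp

lemma M_V: "x \<in> M \<Longrightarrow> x \<in> V"
  by (simp add: max_ideal_def)

lemma unit_iff: "x \<in> V \<Longrightarrow> x \<notin> M \<longleftrightarrow> x \<noteq> 0 \<and> inverse x \<in> V"
  by (auto simp: max_ideal_def)

lemma M_0 [simp]: "0 \<in> M"
  by (simp add: max_ideal_def)

lemma M_1 [simp]: "1 \<notin> M"
  by (simp add: max_ideal_def)

lemma M_mult_left [intro]:
  assumes "x \<in> V" "y \<in> M"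
  shows "x * y \<in> M"
proof (rule ccontr)
  assume "x * y \<notin> M"
  moreover have "x * y \<in> V" using assms M_V by blast
  ultimately have "x * y \<noteq> 0" "inverse (x * y) \<in> V" using unit_iff by blast+
  then have eq: "inverse y = x * inverse (x * y)" and "y \<noteq> 0" by auto
  have "inverse y \<in> V" by (subst eq) (rule V_mult[OF assms(1) \<open>inverse (x * y) \<in> V\<close>])
  with \<open>y \<noteq> 0\<close> show False using assms(2) by (simp add: max_ideal_def)
qed

lemma M_mult_right [intro]: "x \<in> M \<Longrightarrow> y \<in> V \<Longrightarrow> x * y \<in> M"
  using M_mult_left[of y x] by (simp add: mult.commute)

lemma M_uminus [intro]: "x \<in> M \<Longrightarrow> - x \<in> M"
  using M_mult_left[of "-1" x] by (simp add: V_uminus)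

text \<open>One of x / y and y / x lies in V, so the sum is a multiple of y or of x by an element of
  V.\<close>

lemma M_add [intro]:
  assumes "x \<in> M" "y \<in> M"
  shows "x + y \<in> M"
proof -
  have *: "x + y \<in> M" if "x \<in> M" "y \<in> M" "x / y \<in> V" for x y
  proof (cases "y = 0")
    case False
    then have "x + y = (1 + x / y) * y" by (simp add: field_simps)
    then show ?thesis using that by (auto intro!: M_mult_left V_add)
  qed (use that in simp)
  have "x / y \<in> V \<or> y / x \<in> V"
    using inverse_mem[of "x / y"] by simp
  then show ?thesis using *[of x y] *[of y x] assms by (auto simp: add.commute)
qed

lemma M_diff [intro]: "x \<in> M \<Longrightarrow> y \<in> M \<Longrightarrow> x - y \<in> M"
  using M_add[of x "- y"] by (simp add: M_uminus)

lemma M_power [intro]: "x \<in> M \<Longrightarrow> n > 0 \<Longrightarrow> x ^ n \<in> M"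
  by (cases n) (auto intro!: M_mult_right simp: M_V)

lemma M_prime: "x \<in> V \<Longrightarrow> y \<in> V \<Longrightarrow> x * y \<in> M \<Longrightarrow> x \<in> M \<or> y \<in> M"
  using unit_iff[of x] unit_iff[of y] unit_iff[of "x * y"] by auto

lemma M_prime_power: "x \<in> V \<Longrightarrow> x ^ n \<in> M \<Longrightarrow> x \<in> M"
  by (induction n) (auto dest: M_prime[rotated 2])

lemma M_cancel_unit: "x \<in> V \<Longrightarrow> x \<notin> M \<Longrightarrow> y \<in> V \<Longrightarrow> x * y \<in> M \<Longrightarrow> y \<in> M"
  using M_prime by blast

lemma unit_add: "x \<notin> M \<Longrightarrow> y \<in> M \<Longrightarrow> x + y \<notin> M"
  using M_diff[of "x + y" y] by auto

lemma V_divide_unit: "x \<in> V \<Longrightarrow> y \<in> V \<Longrightarrow> y \<notin> M \<Longrightarrow> x / y \<in> V"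
  using unit_iff[of y] by (simp add: divide_inverse V_mult)

lemma M_divide_unit: "x \<in> M \<Longrightarrow> y \<in> V \<Longrightarrow> y \<notin> M \<Longrightarrow> x / y \<in> M"
  using unit_iff[of y] by (simp add: divide_inverse M_mult_right)

lemma four_unit: "4 \<notin> M"
proof -
  have "(inverse 2)^2 \<in> V" using half_mem by blast
  then have "inverse 4 \<in> V" by (simp add: power2_eq_square)
  then show ?thesis by (simp add: max_ideal_def)
qed

text \<open>If x were not in V, then 1 / x would be, and dividing the equation by x^2 would express
  x in V. Degree three serves all uses: quadratic equations are multiplied by x, and cube roots are
  the case a = b = 0.\<close>

lemma V_integrally_closed:
  assumes "x^3 + a * x^2 + b * x + c = 0" "a \<in> V" "b \<in> V" "c \<in> V"
  shows "x \<in> V"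
proof (rule ccontr)
  assume "x \<notin> V"
  then have x: "x \<noteq> 0" "inverse x \<in> V" using inverse_mem[of x] V_0 by metis+
  have "x = - (a + b * inverse x + c * (inverse x)^2)"
  proof -
    have "x^2 * (x + (a + b * inverse x + c * (inverse x)^2)) = x^3 + a * x^2 + b * x + c"
      using x(1) by (simp add: field_simps power2_eq_square power3_eq_cube)
    with assms(1) x(1) have "x + (a + b * inverse x + c * (inverse x)^2) = 0" by simp
    then show ?thesis by (simp only: eq_neg_iff_add_eq_0)
  qed
  moreover have "- (a + b * inverse x + c * (inverse x)^2) \<in> V"
    using assms x(2) by (intro V_uminus V_add V_mult V_power)
  ultimately show False using \<open>x \<notin> V\<close> by simp
qed

text \<open>Divisibility in a valuation ring is total, so some coordinate divides the other two;
  scaling by it makes the vector integral with an entry 1.\<close>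

lemma maximal_coordinate:
  fixes p :: "'a ^ 3"
  assumes "p \<noteq> 0"
  obtains i where "p $ i \<noteq> 0" "\<And>l. p $ l / p $ i \<in> V"
proof -
  have two: "\<exists>z\<in>{x, y}. z \<noteq> 0 \<and> x / z \<in> V \<and> y / z \<in> V" if "x \<noteq> 0 \<or> y \<noteq> 0" for x y
    using that inverse_mem[of "x / y"] by (cases "x = 0"; cases "y = 0") auto
  have "\<exists>z\<in>{p $ 1, p $ 2, p $ 3}. z \<noteq> 0 \<and> p $ 1 / z \<in> V \<and> p $ 2 / z \<in> V \<and> p $ 3 / z \<in> V"
  proof (cases "p $ 1 = 0 \<and> p $ 2 = 0")
    case True
    then show ?thesis using assms by (auto simp: vec3_eq_iff)
  next
    case False
    then obtain z where z: "z \<in> {p $ 1, p $ 2}" "z \<noteq> 0" "p $ 1 / z \<in> V" "p $ 2 / z \<in> V"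
      using two by blast
    obtain y where y: "y \<in> {z, p $ 3}" "y \<noteq> 0" "z / y \<in> V" "p $ 3 / y \<in> V"
      using two[of z "p $ 3"] z(2) by blast
    have "p $ 1 / y = (p $ 1 / z) * (z / y)" "p $ 2 / y = (p $ 2 / z) * (z / y)"
      using z(2) by simp_all
    then have "p $ 1 / y \<in> V" "p $ 2 / y \<in> V"
      using z y V_mult by metis+
    then show ?thesis using z(1) y by blast
  qed
  moreover have "p $ l / z \<in> V" if "p $ 1 / z \<in> V \<and> p $ 2 / z \<in> V \<and> p $ 3 / z \<in> V" for l z
    using exhaust_3[of l] that by auto
  ultimately show ?thesis using that by blast
qed

section \<open>Forms with coefficients in the valuation ring and in its maximal ideal\<close>

lemma form_V_add: "form_in V d f \<Longrightarrow> form_in V d g \<Longrightarrow> form_in V d (\<lambda>v. f v + g v)"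
  by (rule form_in_add) auto

lemma form_V_scale: "c \<in> V \<Longrightarrow> form_in V d f \<Longrightarrow> form_in V d (\<lambda>v. c * f v)"
  by (rule form_in_scale) auto

lemma form_V_mult: "form_in V 1 f \<Longrightarrow> form_in V 1 g \<Longrightarrow> form_in V 2 (\<lambda>v. f v * g v)"
  using form_in_mult[of V V V 1 f 1 g] by (simp add: numeral_2_eq_2 V_mult V_add)

lemma form_V_var: "form_in V 1 (\<lambda>v. v $ i)"
  by (rule form_in_var) auto

lemma form_M_add: "form_in M d f \<Longrightarrow> form_in M d g \<Longrightarrow> form_in M d (\<lambda>v. f v + g v)"
  by (rule form_in_add) auto

lemma form_M_scale: "c \<in> V \<Longrightarrow> form_in M d f \<Longrightarrow> form_in M d (\<lambda>v. c * f v)"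
  by (rule form_in_scale) auto

lemma form_M_scale_V: "c \<in> M \<Longrightarrow> form_in V d f \<Longrightarrow> form_in M d (\<lambda>v. c * f v)"
  by (rule form_in_scale[of V]) auto

lemma form_M_mult: "form_in M 1 f \<Longrightarrow> form_in V 1 g \<Longrightarrow> form_in M 2 (\<lambda>v. f v * g v)"
  using form_in_mult[of M V M 1 f 1 g] by (simp add: numeral_2_eq_2 M_mult_right M_add)

lemma form_M_V: "form_in M d f \<Longrightarrow> form_in V d f"
  by (rule form_in_mono) (auto simp: M_V)

section \<open>Cubics degenerating to the triangle\<close>

text \<open>That R takes unit values at the vertices is the trace of the smooth total space. It
  keeps the perturbation exactly of size \<tau> there, while \<tau> itself may be any nonzero
  element of M.\<close>

definition degenerating_cubic :: "'a \<Rightarrow> ('a ^ 3 \<Rightarrow> 'a) \<Rightarrow> bool" where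
  "degenerating_cubic \<tau> F \<longleftrightarrow> \<tau> \<in> M \<and> \<tau> \<noteq> 0 \<and>
     (\<exists>e R. e \<in> V \<and> e \<notin> M \<and> form_in V 3 R \<and> (\<forall>i. R (axis i 1) \<notin> M) \<and>
        (\<forall>v. F v = e * (\<Prod>i\<in>UNIV. v $ i) + \<tau> * R v))"

lemma degenerating_cubic_coeffs:
  fixes i j k :: 3
  assumes "degenerating_cubic \<tau> F" and ijk: "i \<noteq> j" "j \<noteq> k" "i \<noteq> k"
  obtains e d1 d2 d3 d4 d5 d6 d7 d8 d9 d0 where
    "e \<in> V" "e \<notin> M" "{d1, d2, d3, d4, d5, d6, d7, d8, d9, d0} \<subseteq> V" "d1 \<notin> M" "d4 \<notin> M" "d0 \<notin> M"
    "\<And>v. F v = e * v $ i * v $ j * v $ k + \<tau> * (ternary_cubic d1 d2 d3 d4 d5 d6 d7 d8 d9 d0 (v $ i) (v $ j) (v $ k))"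
proof -
  obtain e R where R: "e \<in> V" "e \<notin> M" "form_in V 3 R" "\<And>i. R (axis i 1) \<notin> M"
    "\<And>v. F v = e * (\<Prod>i\<in>UNIV. v $ i) + \<tau> * R v"
    using assms(1) unfolding degenerating_cubic_def by blast
  obtain d1 d2 d3 d4 d5 d6 d7 d8 d9 d0 where d: "{d1, d2, d3, d4, d5, d6, d7, d8, d9, d0} \<subseteq> V"
    "\<And>v. R v = ternary_cubic d1 d2 d3 d4 d5 d6 d7 d8 d9 d0 (v $ i) (v $ j) (v $ k)"
    by (rule cubic_form_in[OF ijk R(3)]) (rule that)
  have "(\<Prod>l\<in>UNIV. v $ l) = v $ i * v $ j * v $ k" for v :: "'a ^ 3"
    unfolding UNIV_3_distinct[OF ijk] using ijk by (simp add: mult_ac)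
  then have F: "F v = e * v $ i * v $ j * v $ k + \<tau> * R v" for v
    by (simp add: R(5) mult_ac)
  have "R (axis i 1) = d1" "R (axis j 1) = d4" "R (axis k 1) = d0"
    using ijk by (simp_all add: d(2) axis_def)
  then have "d1 \<notin> M" "d4 \<notin> M" "d0 \<notin> M" using R(4) by metis+
  then show ?thesis
    by (rule that[OF R(1,2) d(1)]) (simp add: F d(2))
qed

lemma singular_coeffs:
  fixes c0 c1 c2 c3 a b :: 'a
  assumes "\<And>t. c0 + c1 * t + c2 * t^2 + c3 * t^3 = t^2 * a + t^3 * b"
  shows "c0 = 0" "c1 = 0"
proof -
  have "poly [:c0, c1, c2, c3:] = poly [:0, 0, a, b:]"
    by (rule ext) (use assms in \<open>simp add: expand_simps\<close>)
  then have "[:c0, c1, c2, c3:] = [:0, 0, a, b:]" by (simp only: poly_eq_poly_eq_iff)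
  then show "c0 = 0" "c1 = 0" by simp_all
qed

text \<open>Scale a singular point so that its largest coordinate is 1. The derivatives in the other
  two directions put the remaining coordinates y, z into \<tau> V, so the point reduces to a vertex.
  Then e y z is \<tau> times an element of M, and dividing F(p) = 0 by \<tau> puts the unit d1 into
  M.\<close>

lemma degenerating_cubic_smooth:
  assumes deg: "degenerating_cubic \<tau> F"
  shows "smooth F"
  unfolding smooth_def
proof (intro allI impI)
  fix p assume sing: "singular_at F p"
  show "p = 0"
  proof (rule ccontr)
    assume "p \<noteq> 0"
    then obtain i where i: "p $ i \<noteq> 0" "\<And>l. p $ l / p $ i \<in> V" using maximal_coordinate by blast
    obtain j k where ijk: "i \<noteq> j" "j \<noteq> k" "i \<noteq> k"
      by (rule other_indices) (rule that)
    obtain e d1 d2 d3 d4 d5 d6 d7 d8 d9 d0 where e: "e \<in> V" "e \<notin> M"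
      and d: "{d1, d2, d3, d4, d5, d6, d7, d8, d9, d0} \<subseteq> V" "d1 \<notin> M" "d4 \<notin> M" "d0 \<notin> M"
      and F: "\<And>v. F v = e * v $ i * v $ j * v $ k + \<tau> * (ternary_cubic d1 d2 d3 d4 d5 d6 d7 d8 d9 d0 (v $ i) (v $ j) (v $ k))"
      by (rule degenerating_cubic_coeffs[OF deg ijk]) (rule that)
    have \<tau>: "\<tau> \<in> M" "\<tau> \<noteq> 0" using deg by (simp_all add: degenerating_cubic_def)
    define P where "P = p $ i"
    define y where "y = p $ j / P"
    define z where "z = p $ k / P"
    have yz: "y \<in> V" "z \<in> V" using i(2) by (simp_all add: y_def z_def P_def)
    have P: "P \<noteq> 0" "p $ i = P" "p $ j = y * P" "p $ k = z * P" using i(1) by (simp_all add: P_def y_def z_def)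
    \<comment> \<open>Fy and Fz are the partial derivatives of the perturbation in the directions j
      and k, at the scaled point.\<close>
    define Fy where "Fy = d2 + 2 * d3 * y + 3 * d4 * y^2 + d6 * z + 2 * d7 * y * z + d9 * z^2"
    define Fz where "Fz = d5 + 2 * d8 * z + 3 * d0 * z^2 + d6 * y + d7 * y^2 + 2 * d9 * y * z"
    have FyV: "Fy \<in> V" "Fz \<in> V"
      using d yz unfolding Fy_def Fz_def by (auto intro!: V_add V_mult V_power)
    have "P^2 * (e * z + \<tau> * Fy) = 0"
    proof -
      obtain a b where "\<And>t. F (p + t *s axis j 1) = t^2 * a + t^3 * b"
        using sing unfolding singular_at_def by blast
      moreover have "F (p + t *s axis j 1) = F p + P^2 * (e * z + \<tau> * Fy) * t + \<tau> * (d3 * P + 3 * d4 * y * P + d7 * z * P) * t^2 + \<tau> * d4 * t^3" for t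
        using ijk by (simp add: F Fy_def axis_def P expand_simps)
      ultimately show ?thesis using singular_coeffs(2) by metis
    qed
    then have z: "e * z = - \<tau> * Fy" using P(1) by (simp add: eq_neg_iff_add_eq_0)
    have "P^2 * (e * y + \<tau> * Fz) = 0"
    proof -
      obtain a b where "\<And>t. F (p + t *s axis k 1) = t^2 * a + t^3 * b"
        using sing unfolding singular_at_def by blast
      moreover have "F (p + t *s axis k 1) = F p + P^2 * (e * y + \<tau> * Fz) * t + \<tau> * (d8 * P + d9 * y * P + 3 * d0 * z * P) * t^2 + \<tau> * d0 * t^3" for t
        using ijk by (simp add: F Fz_def axis_def P expand_simps)
      ultimately show ?thesis using singular_coeffs(2) by metis
    qed
    then have y: "e * y = - \<tau> * Fz" using P(1) by (simp add: eq_neg_iff_add_eq_0)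
    have yM: "y \<in> M" and zM: "z \<in> M"
      using M_cancel_unit[OF e yz(1)] M_cancel_unit[OF e yz(2)] y z \<tau>(1) FyV
      by (metis M_mult_right M_uminus)+
    have "F (p + 0 *s p) = 0" using sing unfolding singular_at_def by (metis add.right_neutral mult_zero_left power_zero_numeral)
    then have "P^3 * \<tau> * (d1 + (d2 * y + d3 * y^2 + d4 * y^3 + d5 * z + d6 * y * z + d7 * y^2 * z
       + d8 * z^2 + d9 * y * z^2 + d0 * z^3 - Fz * z)) = 0"
    proof -
      have "P^3 * (e * y) * z = P^3 * (- \<tau> * Fz) * z" by (simp only: y)
      with \<open>F (p + 0 *s p) = 0\<close> show ?thesis
        unfolding F by (simp add: P expand_simps)
    qed
    then have "d1 + (d2 * y + d3 * y^2 + d4 * y^3 + d5 * z + d6 * y * z + d7 * y^2 * z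
       + d8 * z^2 + d9 * y * z^2 + d0 * z^3 - Fz * z) = 0"
      using P(1) \<tau>(2) by simp
    then have "d1 = - (d2 * y + d3 * y^2 + d4 * y^3 + d5 * z + d6 * y * z + d7 * y^2 * z
       + d8 * z^2 + d9 * y * z^2 + d0 * z^3 - Fz * z)"
      by (simp only: eq_neg_iff_add_eq_0)
    moreover have "- (d2 * y + d3 * y^2 + d4 * y^3 + d5 * z + d6 * y * z + d7 * y^2 * z
       + d8 * z^2 + d9 * y * z^2 + d0 * z^3 - Fz * z) \<in> M"
      using d(1) yz yM zM FyV by (intro M_uminus M_diff M_add M_mult_left M_power) (auto intro!: V_mult V_power M_power)
    ultimately show False using d(2) by metis
  qed
qed

subsection \<open>The limits of the conics belonging to a flex line\<close>

text \<open>With \<open>\<theta> = k s\<close> the equation becomes monic up to a unit, with reduction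
  \<open>\<theta>^2 (4 H \<theta> + E^2)\<close>.\<close>

lemma tangency_root_valuations:
  assumes co: "A \<in> M" "B \<in> M" "C \<in> M" "D \<in> M" "E \<in> V" "E \<notin> M" "H \<in> V" "H \<notin> M" "k \<in> M" "k \<noteq> 0"
    and roots: "\<And>x. tangency A B C D E H k x = 4 * H * k * (x - r) * (x - s) * (x - t)"
  shows "\<exists>r' s' t'. {r', s', t'} = {r, s, t} \<and> r' \<in> M \<and> s' \<in> M \<and> k * t' \<in> V \<and> k * t' \<notin> M"
proof -
  define P where "P = 4 * H"
  define g where "g = E^2 - 4 * H * C"
  define h where "h = 4 * H * B - 2 * D * E"
  define l where "l = D^2 - 4 * H * A"
  have tang: "tangency A B C D E H k x = P * k * x^3 + g * x^2 + h * x + l" for x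
    by (simp add: tangency_def P_def g_def h_def l_def)
  have P: "P \<in> V" "P \<notin> M"
    using co four_unit M_prime[of 4 H] by (auto simp: P_def)
  then have "P \<noteq> 0" by auto
  have g: "g \<in> V" "g \<notin> M"
  proof -
    have "E^2 \<notin> M" using M_prime_power[of E 2] co by blast
    moreover have "- (4 * H * C) \<in> M" using co by (intro M_uminus M_mult_left) auto
    ultimately show "g \<notin> M" using unit_add[of "E^2" "- (4 * H * C)"] by (simp add: g_def)
    show "g \<in> V" using co by (auto simp: g_def M_V intro!: V_diff V_mult V_power)
  qed
  have hl: "h \<in> M" "l \<in> M"
  proof -
    have "4 * H * B \<in> M" "4 * H * A \<in> M"
      using co by (auto intro!: M_mult_left[of "4 * H"])
    moreover have "2 * D * E \<in> M" using co by (auto intro!: M_mult_right[of "2 * D"] M_mult_left[of 2])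
    moreover have "D^2 \<in> M" using co by auto
    ultimately show "h \<in> M" "l \<in> M" by (auto simp: h_def l_def)
  qed
  from roots have roots': "(P * k) * x^3 + g * x^2 + h * x + l = (P * k) * (x - r) * (x - s) * (x - t)" for x
    by (simp add: tang P_def)
  note vieta = cubic_coeffs_of_roots[OF roots']
  define u where "u = - (g / P)"
  have u: "u \<in> V" "u \<notin> M"
  proof -
    show "u \<in> V" using V_divide_unit[OF g(1) P] by (auto simp: u_def)
    have "P * u = - g" using \<open>P \<noteq> 0\<close> by (simp add: u_def)
    then show "u \<notin> M" using g(2) P(1) M_mult_left[of P u] M_uminus[of "- g"] by auto
  qed
  have sum: "k * r + k * s + k * t = u"
  proof -
    have "P * (k * r + k * s + k * t) = - g"
      unfolding vieta(1) by (simp add: algebra_simps)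
    also have "\<dots> = P * u" using \<open>P \<noteq> 0\<close> by (simp add: u_def)
    finally show ?thesis using \<open>P \<noteq> 0\<close> by simp
  qed
  have pairs: "(k * r) * (k * s) + (k * s) * (k * t) + (k * r) * (k * t) = k * (h / P)"
  proof -
    have "h = P * (k * (r * s + s * t + r * t))" by (simp only: vieta(2) mult.assoc)
    then have hP: "h / P = k * (r * s + s * t + r * t)" using \<open>P \<noteq> 0\<close> by simp
    show ?thesis unfolding hP by (simp add: algebra_simps)
  qed
  have pairsM: "(k * r) * (k * s) + (k * s) * (k * t) + (k * r) * (k * t) \<in> M"
    unfolding pairs by (rule M_mult_left[OF M_V[OF co(9)] M_divide_unit[OF hl(1) P]])
  have prod: "(k * r) * (k * s) * (k * t) = - (k * (k * (l / P)))"
  proof -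
    have "l = P * (- (k * r * s * t))" by (simp add: vieta(3) algebra_simps)
    then have lP: "l / P = - (k * r * s * t)" using \<open>P \<noteq> 0\<close> by simp
    show ?thesis unfolding lP by (simp add: algebra_simps)
  qed
  have prodM: "(k * r) * (k * s) * (k * t) \<in> M"
    unfolding prod
    by (rule M_uminus[OF M_mult_left[OF M_V[OF co(9)] M_mult_left[OF M_V[OF co(9)] M_divide_unit[OF hl(2) P]]]])
  \<comment> \<open>k x is a root of the monic cubic with roots k r, k s, k t, whose coefficients
    lie in V by the relations above.\<close>
  have V3: "k * x \<in> V" if "x \<in> {r, s, t}" for x
  proof (rule V_integrally_closed)
    show "(k * x)^3 + (- (k * r + k * s + k * t)) * (k * x)^2
        + ((k * r) * (k * s) + (k * s) * (k * t) + (k * r) * (k * t)) * (k * x) + (- ((k * r) * (k * s) * (k * t))) = 0"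
      using that by (auto simp: expand_simps)
  qed (use u(1) sum pairsM prodM in \<open>auto simp: M_V\<close>)
  \<comment> \<open>If k x is in M, then P k x^3 + g x^2 is a unit times x^2, so x satisfies a monic
    quadratic equation whose lower coefficients are in M.\<close>
  have small: "x \<in> M" if "x \<in> {r, s, t}" "k * x \<in> M" for x
  proof -
    have "tangency A B C D E H k x = 0" using roots[of x] that(1) by auto
    then have eq: "(g + P * (k * x)) * x^2 + h * x + l = 0"
      by (simp add: tang expand_simps)
    define q where "q = g + P * (k * x)"
    have "P * (k * x) \<in> M" using P that(2) by blast
    then have q: "q \<in> V" "q \<notin> M" using g unit_add by (auto simp: q_def M_V)
    then have "q \<noteq> 0" by auto
    have hq: "h / q \<in> M" "l / q \<in> M" using M_divide_unit[OF _ q] hl by blast+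
    have "q * (x^2 + h / q * x + l / q) = 0"
      using eq \<open>q \<noteq> 0\<close> unfolding q_def[symmetric] by (simp add: field_simps)
    then have eq': "x^2 + h / q * x + l / q = 0" using \<open>q \<noteq> 0\<close> by simp
    have "x^3 + h / q * x^2 + l / q * x + 0 = x * (x^2 + h / q * x + l / q)"
      by (simp add: expand_simps)
    then have "x \<in> V"
      using eq' hq by (intro V_integrally_closed[of x "h / q" "l / q" 0]) (auto simp: M_V)
    moreover have "x^2 = - (h / q * x + l / q)" using eq' by (simp only: eq_neg_iff_add_eq_0 add.assoc)
    then have "x^2 \<in> M" using hq \<open>x \<in> V\<close> by (metis M_uminus M_add M_mult_right)
    ultimately show ?thesis by (rule M_prime_power)
  qed
  \<comment> \<open>The pairwise products force a second one of the three k x into M; their sum is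
    the unit u, so the third is a unit.\<close>
  have step: "\<exists>r' s' t'. {r', s', t'} = {x, y, z} \<and> r' \<in> M \<and> s' \<in> M \<and> k * t' \<in> V \<and> k * t' \<notin> M"
    if xyz: "{x, y, z} = {r, s, t}" "k * x \<in> M" "k * x + k * y + k * z = u"
      "(k * x) * (k * y) + (k * y) * (k * z) + (k * x) * (k * z) \<in> M" for x y z
  proof -
    have V: "k * x \<in> V" "k * y \<in> V" "k * z \<in> V" using V3 xyz(1) by blast+
    have "(k * y) * (k * z) = ((k * x) * (k * y) + (k * y) * (k * z) + (k * x) * (k * z)) - (k * x) * (k * y + k * z)"
      by (simp add: algebra_simps)
    moreover have "\<dots> \<in> M" by (rule M_diff[OF xyz(4) M_mult_right[OF xyz(2) V_add[OF V(2,3)]]])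
    ultimately have "(k * y) * (k * z) \<in> M" by (simp only:)
    then have "k * y \<in> M \<or> k * z \<in> M" using M_prime V by blast
    then show ?thesis
    proof
      assume y: "k * y \<in> M"
      have "k * z \<notin> M" using u(2) xyz(2,3) y M_add by metis
      moreover have "x \<in> M" "y \<in> M" using small xyz(1,2) y by blast+
      ultimately show ?thesis using V by blast
    next
      assume z: "k * z \<in> M"
      have "k * y \<notin> M" using u(2) xyz(2,3) z M_add by metis
      moreover have "x \<in> M" "z \<in> M" using small xyz(1,2) z by blast+
      moreover have "{x, z, y} = {x, y, z}" by blast
      ultimately show ?thesis using V by blast
    qed
  qed
  have "k * r \<in> M \<or> k * s \<in> M \<or> k * t \<in> M"
    using prodM M_prime V3 by (metis V_mult insertCI)
  then consider "k * r \<in> M" | "k * s \<in> M" | "k * t \<in> M" by blast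
  then show ?thesis
  proof cases
    case 1
    then show ?thesis using step[of r s t] sum pairsM by simp
  next
    case 2
    have "{s, r, t} = {r, s, t}" by blast
    with 2 step[of s r t] sum pairsM show ?thesis by (simp add: algebra_simps)
  next
    case 3
    have "{t, s, r} = {r, s, t}" by blast
    with 3 step[of t s r] sum pairsM show ?thesis by (simp add: algebra_simps)
  qed
qed

end

text \<open>Fixing the covector m, and not only its line, fixes the scale of Q as well, so functions
  can be counted instead of classes up to scalars.\<close>

definition flexes_conics :: "('a::field ^ 3 \<Rightarrow> 'a) \<Rightarrow> 'a ^ 3 \<Rightarrow> ('a ^ 3 \<Rightarrow> 'a) set" where
  "flexes_conics F m = {Q. tangent_conic_fun F Q \<and> on_flex F Q m}"

text \<open>Transports the analysis of the pencil by N, whose first row is the flex line.\<close>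

lemma flexes_conics_in_flex_coordinates:
  fixes F :: "'a::{alg_closed_field, field_char_0} ^ 3 \<Rightarrow> 'a"
  assumes "smooth F" "invertible (N :: 'a ^ 3 ^ 3)" "\<And>v. F v = flex_cubic A B C D E H k (N *v v)" "H \<noteq> 0" "k \<noteq> 0"
  shows "flexes_conics F (vec3 1 0 0 v* N)
       = {(\<lambda>v. pencil_conic A B C D E H k s (N *v v)) | s. tangency A B C D E H k s = 0}"
    and "smooth (flex_cubic A B C D E H k)"
proof -
  let ?G = "flex_cubic A B C D E H k"
  obtain K where K: "invertible K" "\<And>v. N *v (K *v v) = v" "\<And>v. K *v (N *v v) = v"
     "\<And>m. (m v* N) v* K = m"
    using invertible_obtain[OF assms(2)] by metis
  have F: "F = (\<lambda>v. ?G (N *v v))" using assms(3) by blast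
  have G: "?G = (\<lambda>v. F (K *v v))" unfolding F K by simp
  show smooth_G: "smooth ?G" unfolding G by (rule smooth_substitution[OF assms(1) K(1)])
  note pencil = pencil_conic_tangent[OF assms(4,5) smooth_G] pencil_conic_of_tangent[OF assms(4,5) smooth_G]
  show "flexes_conics F (vec3 1 0 0 v* N)
       = {(\<lambda>v. pencil_conic A B C D E H k s (N *v v)) | s. tangency A B C D E H k s = 0}"
  proof (intro subset_antisym subsetI)
    fix Q assume "Q \<in> flexes_conics F (vec3 1 0 0 v* N)"
    then have Q: "tangent_conic_fun F Q" "on_flex F Q (vec3 1 0 0 v* N)"
      by (simp_all add: flexes_conics_def)
    have "tangent_conic_fun ?G (\<lambda>v. Q (K *v v))"
      unfolding G by (rule tangent_conic_fun_substitution[OF Q(1) K(1)])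
    moreover have "on_flex ?G (\<lambda>v. Q (K *v v)) (vec3 1 0 0)"
      using on_flex_substitution[OF Q(2), of K] unfolding G K(4) .
    ultimately obtain s where s: "tangency A B C D E H k s = 0" "(\<lambda>v. Q (K *v v)) = pencil_conic A B C D E H k s"
      by (rule pencil(3))
    have "Q v = pencil_conic A B C D E H k s (N *v v)" for v
      using fun_cong[OF s(2), of "N *v v"] by (simp add: K)
    with s(1) show "Q \<in> {(\<lambda>v. pencil_conic A B C D E H k s (N *v v)) | s. tangency A B C D E H k s = 0}"
      by blast
  next
    fix Q assume "Q \<in> {(\<lambda>v. pencil_conic A B C D E H k s (N *v v)) | s. tangency A B C D E H k s = 0}"
    then obtain s where s: "Q = (\<lambda>v. pencil_conic A B C D E H k s (N *v v))" "tangency A B C D E H k s = 0"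
      by blast
    show "Q \<in> flexes_conics F (vec3 1 0 0 v* N)"
      unfolding flexes_conics_def mem_Collect_eq F s(1)
      using tangent_conic_fun_substitution[OF pencil(1)[OF s(2)] assms(2)]
        on_flex_substitution[OF pencil(2)[OF s(2)], of N] by blast
  qed
qed

context residue_char_not_2
begin

text \<open>Functional counterpart of \<open>has_limit\<close>; \<open>limits_to_lookup\<close>
  translates it back into coefficients.\<close>

definition limits_to :: "('a ^ 3 \<Rightarrow> 'a) \<Rightarrow> ('a ^ 3 \<Rightarrow> 'a) \<Rightarrow> bool" where
  "limits_to Q f \<longleftrightarrow> (\<exists>u R. u \<noteq> 0 \<and> form_in M 2 R \<and> (\<forall>v. u * Q v = f v + R v))"

end

locale alg_closed_residue_char_not_2 = residue_char_not_2 V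
  for V :: "'a::{alg_closed_field, field_char_0} set"
begin

text \<open>A flex line reduces to a side \<open>v $ i = 0\<close> of the triangle, and its flex to an interior point
  of that side.\<close>

lemma degenerating_cubic_at_flex:
  assumes deg: "degenerating_cubic \<tau> F" and flex: "flex_line F m"
    and m: "m $ i = 1" "\<And>l. m $ l \<in> V"
  obtains j k e R \<zeta> \<kappa> where "i \<noteq> j" "j \<noteq> k" "i \<noteq> k" "m $ j \<in> M" "m $ k \<in> M"
    "e \<in> V" "e \<notin> M" "\<zeta> \<in> V" "\<zeta> \<notin> M" "\<kappa> \<in> M" "\<kappa> \<noteq> 0" "form_in V 2 R"
    "\<And>v. F v = lin m v * (e * (v $ j * v $ k) + \<tau> * R v) + \<kappa> * (v $ j + \<zeta> * v $ k)^3"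
proof -
  obtain j k where ijk: "i \<noteq> j" "j \<noteq> k" "i \<noteq> k" by (rule other_indices) (rule that)
  have lin: "lin a v = a $ i * v $ i + a $ j * v $ j + a $ k * v $ k" for a v :: "'a ^ 3"
    unfolding lin_def UNIV_3_distinct[OF ijk] using ijk by (simp add: add.assoc)
  obtain e d1 d2 d3 d4 d5 d6 d7 d8 d9 d0 where e: "e \<in> V" "e \<notin> M"
    and d: "{d1, d2, d3, d4, d5, d6, d7, d8, d9, d0} \<subseteq> V" "d1 \<notin> M" "d4 \<notin> M" "d0 \<notin> M"
    and F: "\<And>v. F v = e * v $ i * v $ j * v $ k + \<tau> * (ternary_cubic d1 d2 d3 d4 d5 d6 d7 d8 d9 d0 (v $ i) (v $ j) (v $ k))"
    by (rule degenerating_cubic_coeffs[OF deg ijk]) (rule that)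
  have \<tau>: "\<tau> \<in> M" "\<tau> \<noteq> 0" using deg by (simp_all add: degenerating_cubic_def)
  \<comment> \<open>On the flex line the coordinate i equals \<beta> y + \<gamma> z, and D0 to D3
    are the coefficients of the perturbation restricted to it.\<close>
  define \<beta> \<gamma> where "\<beta> = - (m $ j)" and "\<gamma> = - (m $ k)"
  have bg: "\<beta> \<in> V" "\<gamma> \<in> V" using m(2) by (auto simp: \<beta>_def \<gamma>_def)
  define D0 where "D0 = d1 * \<beta>^3 + d2 * \<beta>^2 + d3 * \<beta> + d4"
  define D1 where "D1 = 3 * d1 * \<beta>^2 * \<gamma> + 2 * d2 * \<beta> * \<gamma> + d3 * \<gamma> + d5 * \<beta>^2 + d6 * \<beta> + d7"
  define D2 where "D2 = 3 * d1 * \<beta> * \<gamma>^2 + d2 * \<gamma>^2 + 2 * d5 * \<beta> * \<gamma> + d6 * \<gamma> + d8 * \<beta> + d9"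
  define D3 where "D3 = d1 * \<gamma>^3 + d5 * \<gamma>^2 + d8 * \<gamma> + d0"
  have DV: "D0 \<in> V" "D1 \<in> V" "D2 \<in> V" "D3 \<in> V"
    using d bg unfolding D0_def D1_def D2_def D3_def by (auto intro!: V_add V_mult V_power)
  obtain l where l: "\<And>v. lin m v = 0 \<Longrightarrow> F v = (lin l v)^3"
    using flex unfolding flex_line_def by blast
  define l1 l2 where "l1 = l $ j + l $ i * \<beta>" and "l2 = l $ k + l $ i * \<gamma>"
  have "\<tau> * D0 * y^3 + (e * \<beta> + \<tau> * D1) * y^2 * z + (e * \<gamma> + \<tau> * D2) * y * z^2 + \<tau> * D3 * z^3
      = l1^3 * y^3 + (3 * l1^2 * l2) * y^2 * z + (3 * l1 * l2^2) * y * z^2 + l2^3 * z^3" for y z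
  proof -
    define v :: "'a ^ 3" where "v = (\<chi> l. if l = i then \<beta> * y + \<gamma> * z else if l = j then y else z)"
    have v: "v $ i = \<beta> * y + \<gamma> * z" "v $ j = y" "v $ k = z"
      using ijk by (simp_all add: v_def)
    have "lin m v = 0" by (simp add: lin v m \<beta>_def \<gamma>_def)
    from l[OF this] have "F v = (l1 * y + l2 * z)^3"
      by (simp add: lin v l1_def l2_def algebra_simps)
    then show ?thesis
      unfolding F v D0_def D1_def D2_def D3_def
      by (simp add: expand_simps)
  qed
  note co = binary_cubic_inject[OF this]
  define \<kappa> where "\<kappa> = l1^3"
  have \<kappa>: "\<kappa> = \<tau> * D0" "l2^3 = \<tau> * D3" using co by (simp_all add: \<kappa>_def)
  have cubesM: "l1^3 \<in> M" "l2^3 \<in> M" using co(1,4) \<tau> DV by (metis M_mult_right)+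
  have lV: "x \<in> V" if "x^3 \<in> V" for x
    by (rule V_integrally_closed[of x 0 0 "- (x^3)"]) (use that in auto)
  \<comment> \<open>Integral closedness puts the cube roots l1, l2 into V, primality into M.\<close>
  have l12: "l1 \<in> M" "l2 \<in> M"
    using M_prime_power[of l1 3] M_prime_power[of l2 3] cubesM lV[of l1] lV[of l2] M_V by blast+
  have "3 * l1^2 * l2 \<in> M" "3 * l1 * l2^2 \<in> M" using l12 M_V[OF l12(1)] by (auto intro!: M_mult_left V_mult V_power)
  then have "e * \<beta> + \<tau> * D1 \<in> M" "e * \<gamma> + \<tau> * D2 \<in> M" using co(2,3) by simp_all
  moreover have "\<tau> * D1 \<in> M" "\<tau> * D2 \<in> M" using \<tau>(1) DV by auto
  ultimately have "e * \<beta> \<in> M" "e * \<gamma> \<in> M"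
    by (metis M_diff add_diff_cancel_right')+
  then have bgM: "\<beta> \<in> M" "\<gamma> \<in> M" using M_cancel_unit[OF e] bg by blast+
  \<comment> \<open>Modulo M the outer coefficients of the restriction are the vertex values d4 and
    d0. So D0 and D3 are units, and \<kappa> is \<tau> times a unit.\<close>
  have "d1 * \<beta>^3 + d2 * \<beta>^2 + d3 * \<beta> \<in> M" "d1 * \<gamma>^3 + d5 * \<gamma>^2 + d8 * \<gamma> \<in> M"
    using d(1) bgM by (auto intro!: M_add M_mult_left M_power)
  from unit_add[OF d(3) this(1)] unit_add[OF d(4) this(2)] have DM: "D0 \<notin> M" "D3 \<notin> M"
    unfolding D0_def D3_def by (simp_all only: add.commute not_False_eq_True)
  then have D_nz: "D0 \<noteq> 0" "D3 \<noteq> 0" by auto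
  have "\<kappa> \<noteq> 0" using \<kappa> \<tau> D_nz by simp
  then have "l1 \<noteq> 0" by (auto simp: \<kappa>_def)
  define \<zeta> where "\<zeta> = l2 / l1"
  have z3: "\<zeta>^3 = D3 / D0"
    unfolding \<zeta>_def power_divide \<kappa>(2) \<kappa>_def[symmetric] \<kappa>(1) using \<tau>(2) by simp
  have "\<zeta>^3 \<in> V" unfolding z3 using V_divide_unit DV DM by blast
  then have "\<zeta> \<in> V" by (rule lV)
  have "\<zeta> \<notin> M"
  proof
    assume "\<zeta> \<in> M"
    then have "\<zeta>^3 \<in> M" by auto
    then have "D3 / D0 * D0 \<in> M" unfolding z3 using DV by blast
    then show False using DM D_nz by simp
  qed
  \<comment> \<open>The difference quotient (T(x) - T(w)) / (x - w), where T is the perturbation as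
    a polynomial in the coordinate i and w = \<beta> y + \<gamma> z is the value of that coordinate
    on the flex line.\<close>
  define R where "R v = d1 * (v $ i * v $ i + v $ i * (\<beta> * v $ j + \<gamma> * v $ k) + (\<beta> * v $ j + \<gamma> * v $ k) * (\<beta> * v $ j + \<gamma> * v $ k))
    + (d2 * v $ j + d5 * v $ k) * (v $ i + (\<beta> * v $ j + \<gamma> * v $ k))
    + (d3 * (v $ j * v $ j) + d6 * (v $ j * v $ k) + d8 * (v $ k * v $ k))" for v
  have "form_in V 2 R"
    unfolding R_def[abs_def] using d(1) bg
    by (intro form_V_add form_V_scale form_V_mult form_V_var) auto
  moreover have "F v = lin m v * (e * (v $ j * v $ k) + \<tau> * R v) + \<kappa> * (v $ j + \<zeta> * v $ k)^3" for v
  proof -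
    define w where "w = \<beta> * v $ j + \<gamma> * v $ k"
    have lin_w: "lin m v = v $ i - w" by (simp add: lin m w_def \<beta>_def \<gamma>_def)
    have "\<kappa> * (v $ j + \<zeta> * v $ k)^3 = (l1 * (v $ j + \<zeta> * v $ k))^3"
      by (simp add: \<kappa>_def power_mult_distrib)
    also have "l1 * (v $ j + \<zeta> * v $ k) = l1 * v $ j + l2 * v $ k"
      using \<open>l1 \<noteq> 0\<close> by (simp add: \<zeta>_def algebra_simps)
    also have "(l1 * v $ j + l2 * v $ k)^3 = \<tau> * D0 * (v $ j)^3 + (e * \<beta> + \<tau> * D1) * (v $ j)^2 * v $ k
        + (e * \<gamma> + \<tau> * D2) * v $ j * (v $ k)^2 + \<tau> * D3 * (v $ k)^3"
      unfolding co by (simp add: expand_simps)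
    also have "\<dots> = e * w * v $ j * v $ k + \<tau> * (d1 * w^3 + d2 * w^2 * (v $ j) + d3 * w * (v $ j)^2 + d4 * (v $ j)^3
        + d5 * w^2 * (v $ k) + d6 * w * (v $ j) * (v $ k) + d7 * (v $ j)^2 * (v $ k) + d8 * w * (v $ k)^2
        + d9 * (v $ j) * (v $ k)^2 + d0 * (v $ k)^3)"
      unfolding D0_def D1_def D2_def D3_def w_def
      by (simp add: expand_simps)
    finally show ?thesis
      unfolding F R_def w_def[symmetric] lin_w
      by (simp add: expand_simps)
  qed
  moreover have "m $ j \<in> M" "m $ k \<in> M" using bgM M_uminus by (force simp: \<beta>_def \<gamma>_def)+
  moreover have "\<kappa> \<in> M" using cubesM by (simp add: \<kappa>_def)
  ultimately show ?thesis
    using ijk e \<open>\<zeta> \<in> V\<close> \<open>\<zeta> \<notin> M\<close> \<open>\<kappa> \<noteq> 0\<close> by (intro that) auto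
qed

text \<open>Let y, z be the coordinates j, k. In the new coordinates \<open>lin m\<close>, Y = y +
  \<zeta> z and Z = z, the product y z is Y Z - \<zeta> Z^2, so E and H are units while A, B, C, D
  are multiples of \<tau>. This is the situation of \<open>tangency_root_valuations\<close>.\<close>

lemma limits_of_flex_conics:
  assumes deg: "degenerating_cubic \<tau> F" and flex: "flex_line F m"
    and m: "m $ i = 1" "\<And>l. m $ l \<in> V"
  obtains j k Q1 Q2 Q3 where "i \<noteq> j" "j \<noteq> k" "i \<noteq> k" "flexes_conics F m = {Q1, Q2, Q3}"
    "\<And>c. Q1 \<noteq> (\<lambda>v. c * Q2 v)" "\<And>c. Q2 \<noteq> (\<lambda>v. c * Q3 v)" "\<And>c. Q1 \<noteq> (\<lambda>v. c * Q3 v)"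
    "limits_to Q1 (\<lambda>v. v $ j * v $ k)" "limits_to Q2 (\<lambda>v. v $ j * v $ k)" "limits_to Q3 (\<lambda>v. v $ i * v $ i)"
proof -
  obtain j k e R \<zeta> \<kappa> where ijk: "i \<noteq> j" "j \<noteq> k" "i \<noteq> k" and mM: "m $ j \<in> M" "m $ k \<in> M"
    and e: "e \<in> V" "e \<notin> M" and \<zeta>: "\<zeta> \<in> V" "\<zeta> \<notin> M" and \<kappa>: "\<kappa> \<in> M" "\<kappa> \<noteq> 0"
    and R: "form_in V 2 R"
    and F: "\<And>v. F v = lin m v * (e * (v $ j * v $ k) + \<tau> * R v) + \<kappa> * (v $ j + \<zeta> * v $ k)^3"
    by (rule degenerating_cubic_at_flex[OF deg flex m]) (rule that)
  have \<tau>: "\<tau> \<in> M" using deg by (simp add: degenerating_cubic_def)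
  have lin: "lin a v = a $ i * v $ i + a $ j * v $ j + a $ k * v $ k" for a v :: "'a ^ 3"
    unfolding lin_def UNIV_3_distinct[OF ijk] using ijk by (simp add: add.assoc)
  define n2 n3 :: "'a ^ 3" where "n2 = (\<chi> l. if l = j then 1 else if l = k then \<zeta> else 0)"
    and "n3 = (\<chi> l. if l = k then 1 else 0)"
  define N where "N = mat3 m n2 n3"
  have "invertible N"
  proof -
    consider "i = 1" "j = 2" "k = 3" | "i = 1" "j = 3" "k = 2" | "i = 2" "j = 1" "k = 3" | "i = 2" "j = 3" "k = 1"
      | "i = 3" "j = 1" "k = 2" | "i = 3" "j = 2" "k = 1"
      using exhaust_3[of i] exhaust_3[of j] exhaust_3[of k] ijk by metis
    then show ?thesis
      unfolding N_def invertible_mat3 n2_def n3_def by cases (use m(1) in simp_all)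
  qed
  have N1: "(N *v v) $ 1 = lin m v" and N2: "(N *v v) $ 2 = v $ j + \<zeta> * v $ k" and N3: "(N *v v) $ 3 = v $ k" for v
    unfolding N_def mat3_mult using ijk by (simp_all add: lin n2_def n3_def)
  have mN: "vec3 1 0 0 v* N = m"
  proof -
    have "lin (vec3 1 0 0 v* N) v = lin m v" for v
      unfolding lin_matrix[symmetric] by (simp add: lin_3 N1)
    then show ?thesis using lin_eq_iff by blast
  qed
  \<comment> \<open>The inverse of N, written in the coordinates i, j, k, so that the transported R
    visibly has coefficients in V.\<close>
  define coord :: "'a ^ 3 \<Rightarrow> 'a ^ 3" where
    "coord v = (\<chi> l. if l = i then v $ 1 - m $ j * (v $ 2 - \<zeta> * v $ 3) - m $ k * v $ 3
        else if l = j then v $ 2 - \<zeta> * v $ 3 else v $ 3)" for v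
  have coord: "coord v $ i = v $ 1 + (- (m $ j)) * (v $ 2 + (- \<zeta>) * v $ 3) + (- (m $ k)) * v $ 3"
    "coord v $ j = v $ 2 + (- \<zeta>) * v $ 3" "coord v $ k = v $ 3" for v
    using ijk by (simp_all add: coord_def)
  have coordN: "coord (N *v v) $ i = v $ i" "coord (N *v v) $ j = v $ j" "coord (N *v v) $ k = v $ k" for v
    unfolding coord N1 N2 N3 by (simp_all add: lin m(1) algebra_simps)
  obtain r1 r2 r3 r4 r5 r6 where r: "{r1, r2, r3, r4, r5, r6} \<subseteq> V"
    "\<And>v. R v = ternary_quadratic r1 r2 r3 r4 r5 r6 (v $ i) (v $ j) (v $ k)"
    by (rule quadratic_form_in[OF ijk R]) (rule that)
  have "form_in V 2 (\<lambda>v. R (coord v))"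
    unfolding r(2) coord power2_eq_square mult.assoc using r(1) mM \<zeta>(1)
    by (intro form_V_add form_V_scale form_V_mult form_V_var) (auto simp: M_V)
  then obtain a b c d f h where co: "{a, b, c, d, f, h} \<subseteq> V"
    "\<And>v. R (coord v) = ternary_quadratic a b c d f h (v $ 1) (v $ 2) (v $ 3)"
    by (rule quadratic_form_in[of 1 2 3, rotated 3]) auto
  define A B C D E H where "A = \<tau> * a" and "B = \<tau> * b" and "C = \<tau> * c" and "D = \<tau> * d"
    and "E = e + \<tau> * f" and "H = - (e * \<zeta>) + \<tau> * h"
  have ABCD: "A \<in> M" "B \<in> M" "C \<in> M" "D \<in> M"
    using co(1) \<tau> by (auto simp: A_def B_def C_def D_def)
  have E: "E \<in> V" "E \<notin> M"
  proof -
    have "\<tau> * f \<in> M" using co(1) \<tau> by auto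
    then show "E \<in> V" "E \<notin> M" using e unit_add[OF e(2)] M_V by (auto simp: E_def)
  qed
  have H: "H \<in> V" "H \<notin> M"
  proof -
    have "e * \<zeta> \<notin> M" using M_prime e \<zeta> by blast
    then have "- (e * \<zeta>) \<notin> M" using M_uminus by force
    then show "H \<notin> M" using co(1) \<tau> unit_add[of "- (e * \<zeta>)" "\<tau> * h"] by (auto simp: H_def)
    have "\<tau> * h \<in> V" using co(1) M_V[OF \<tau>] by auto
    then show "H \<in> V" using e \<zeta> by (auto simp: H_def)
  qed
  have RN: "R v = a * (lin m v)^2 + b * lin m v * (v $ j + \<zeta> * v $ k) + c * (v $ j + \<zeta> * v $ k)^2 + d * lin m v * v $ k
      + f * (v $ j + \<zeta> * v $ k) * v $ k + h * (v $ k)^2" for v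
    using co(2)[of "N *v v"] unfolding r(2) coordN N1 N2 N3 by simp
  have residual: "residual_conic A B C D E H (N *v v) = e * (v $ j * v $ k) + \<tau> * R v" for v
    unfolding residual_conic_def N1 N2 N3 RN A_def B_def C_def D_def E_def H_def
    by (simp add: algebra_simps power2_eq_square)
  have FN: "F v = flex_cubic A B C D E H \<kappa> (N *v v)" for v
    unfolding flex_cubic_def residual F N1 N2 ..
  have "H \<noteq> 0" using H by auto
  have "smooth F" by (rule degenerating_cubic_smooth[OF deg])
  note flex_coords = flexes_conics_in_flex_coordinates[OF \<open>smooth F\<close> \<open>invertible N\<close> FN \<open>H \<noteq> 0\<close> \<kappa>(2)]
  obtain r s t where rst: "r \<noteq> s" "s \<noteq> t" "r \<noteq> t"
    and roots: "\<And>x. tangency A B C D E H \<kappa> x = 4 * H * \<kappa> * (x - r) * (x - s) * (x - t)"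
    by (rule tangency_roots[OF \<open>H \<noteq> 0\<close> \<kappa>(2) flex_coords(2)]) (rule that)
  obtain r' s' t' where perm: "{r', s', t'} = {r, s, t}" and small: "r' \<in> M" "s' \<in> M"
    and large: "\<kappa> * t' \<in> V" "\<kappa> * t' \<notin> M"
    using tangency_root_valuations[OF ABCD E H \<kappa> roots] by blast
  have "card {r', s', t'} = 3" unfolding perm using rst by simp
  then have distinct: "r' \<noteq> s'" "s' \<noteq> t'" "r' \<noteq> t'" by (auto simp: card_insert_if split: if_splits)
  define Q where "Q s v = pencil_conic A B C D E H \<kappa> s (N *v v)" for s v
  have "4 * H * \<kappa> \<noteq> 0" using \<open>H \<noteq> 0\<close> \<kappa>(2) by simp
  then have "tangency A B C D E H \<kappa> x = 0 \<longleftrightarrow> x \<in> {r, s, t}" for x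
    unfolding roots by auto
  then have "flexes_conics F m = {Q x | x. x \<in> {r', s', t'}}"
    unfolding perm using flex_coords(1) by (simp add: mN Q_def[abs_def])
  then have "flexes_conics F m = {Q r', Q s', Q t'}" by blast
  moreover have "Q x \<noteq> (\<lambda>v. c * Q y v)" if "x \<noteq> y" for x y c
  proof
    assume eq: "Q x = (\<lambda>v. c * Q y v)"
    obtain K where "\<And>v. N *v (K *v v) = v" using invertible_obtain[OF \<open>invertible N\<close>] by metis
    then have "pencil_conic A B C D E H \<kappa> x v = c * pencil_conic A B C D E H \<kappa> y v" for v
      using fun_cong[OF eq, of "K *v v"] by (simp add: Q_def)
    then show False
      using pencil_conic_proportional[OF \<open>H \<noteq> 0\<close> \<kappa>(2) flex_coords(2)] that by blast
  qed
  moreover have linV: "form_in V 1 (lin m)" "form_in V 1 (\<lambda>v. v $ j + \<zeta> * v $ k)"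
    unfolding lin[abs_def] using m(2) \<zeta>(1) by (intro form_V_add form_V_scale form_V_var; simp)+
  have small_limit: "limits_to (Q x) (\<lambda>v. v $ j * v $ k)" if "x \<in> M" for x
    unfolding limits_to_def
  proof (intro exI conjI allI)
    \<comment> \<open>After scaling by 1 / e every correction term has a factor \<kappa> or
      \<tau>.\<close>
    have "e \<noteq> 0" "inverse e \<in> V" using e unit_iff by blast+
    then show "inverse e \<noteq> 0" by simp
    let ?R = "\<lambda>v. (inverse e * \<tau>) * R v + ((- (inverse e * \<kappa> * (3 * x))) * ((v $ j + \<zeta> * v $ k) * (v $ j + \<zeta> * v $ k))
       + ((- (inverse e * \<kappa> * (3 * x^2))) * (lin m v * (v $ j + \<zeta> * v $ k))
       + (- (inverse e * \<kappa> * x^3)) * (lin m v * lin m v)))"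
    have "inverse e * \<tau> \<in> M" using \<open>inverse e \<in> V\<close> \<tau> by blast
    moreover have "- (inverse e * \<kappa> * y) \<in> M" if "y \<in> V" for y
      using \<open>inverse e \<in> V\<close> \<kappa>(1) that by blast
    moreover have "3 * x \<in> V" "3 * x^2 \<in> V" "x^3 \<in> V"
      using M_V[OF that] by (auto intro!: V_mult V_power)
    ultimately have "inverse e * \<tau> \<in> M" "- (inverse e * \<kappa> * (3 * x)) \<in> M"
      "- (inverse e * \<kappa> * (3 * x^2)) \<in> M" "- (inverse e * \<kappa> * x^3) \<in> M"
      by blast+
    then show "form_in M 2 ?R"
      by (intro form_M_add form_M_scale_V form_V_mult R linV)
    show "inverse e * Q x v = v $ j * v $ k + ?R v" for v
      unfolding Q_def pencil_conic_def residual N1 N2 using \<open>e \<noteq> 0\<close>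
      by (simp add: expand_simps)
  qed
  moreover have "limits_to (Q t') (\<lambda>v. v $ i * v $ i)"
    unfolding limits_to_def
  proof (intro exI conjI allI)
    define \<theta> where "\<theta> = \<kappa> * t'"
    have "\<theta> \<noteq> 0" "inverse \<theta> \<in> V" using large unit_iff unfolding \<theta>_def by blast+
    have t': "t' = \<theta> / \<kappa>" using \<kappa>(2) by (simp add: \<theta>_def)
    \<comment> \<open>With t' = \<theta> / \<kappa> the dominating coefficient is - \<kappa> t'^3 =
      - \<theta>^3 / \<kappa>^2, and this scale turns it into 1.\<close>
    let ?u = "- (\<kappa>^2 * inverse \<theta>^3)"
    show "?u \<noteq> 0" using \<kappa>(2) \<open>\<theta> \<noteq> 0\<close> by simp
    define w where "w v = (- (m $ j)) * v $ j + (- (m $ k)) * v $ k" for v :: "'a ^ 3"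
    have lin_w: "lin m v = v $ i - w v" for v by (simp add: lin m(1) w_def)
    let ?R = "\<lambda>v. (- 2) * (w v * v $ i) + (w v * w v + ((3 * inverse \<theta> * \<kappa>) * (lin m v * (v $ j + \<zeta> * v $ k))
       + ((3 * inverse \<theta>^2 * \<kappa>^2) * ((v $ j + \<zeta> * v $ k) * (v $ j + \<zeta> * v $ k)) + (?u * e) * (v $ j * v $ k) + (?u * \<tau>) * R v)))"
    have "\<kappa>^2 \<in> M" using \<kappa>(1) by auto
    have coM: "3 * inverse \<theta> * \<kappa> \<in> M" "3 * inverse \<theta>^2 * \<kappa>^2 \<in> M"
      using \<kappa>(1) \<open>\<kappa>^2 \<in> M\<close> \<open>inverse \<theta> \<in> V\<close> by (auto intro!: M_mult_left V_mult V_power)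
    have "?u \<in> M" using \<open>\<kappa>^2 \<in> M\<close> \<open>inverse \<theta> \<in> V\<close> by (intro M_uminus M_mult_right V_power)
    then have uM: "?u * e \<in> M" "?u * \<tau> \<in> M" using e \<tau> by (intro M_mult_right; simp add: M_V)+
    have "- (m $ j) \<in> M" "- (m $ k) \<in> M" using mM by blast+
    then have wM: "form_in M 1 w"
      unfolding w_def[abs_def] by (intro form_M_add form_M_scale_V form_V_var)
    show "form_in M 2 ?R"
      using coM uM R linV wM form_M_V[OF wM]
      by (intro form_M_add form_M_mult form_M_scale form_M_scale_V[OF coM(1)] form_M_scale_V[OF coM(2)]
          form_M_scale_V[OF uM(1)] form_M_scale_V[OF uM(2)] form_V_mult form_V_var) auto
    show "?u * Q t' v = v $ i * v $ i + ?R v" for v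
    proof -
      have "?u * (\<kappa> * (3 * t' * (v $ j + \<zeta> * v $ k)^2 + 3 * t'^2 * lin m v * (v $ j + \<zeta> * v $ k) + t'^3 * (lin m v)^2))
        = - ((3 * inverse \<theta>^2 * \<kappa>^2) * ((v $ j + \<zeta> * v $ k) * (v $ j + \<zeta> * v $ k)))
          - ((3 * inverse \<theta> * \<kappa>) * (lin m v * (v $ j + \<zeta> * v $ k))) - lin m v * lin m v"
        unfolding t' using \<open>\<theta> \<noteq> 0\<close> \<kappa>(2) by (simp add: field_simps power2_eq_square power3_eq_cube)
      moreover have "lin m v * lin m v = v $ i * v $ i + (- 2) * (w v * v $ i) + w v * w v"
        unfolding lin_w by (simp add: algebra_simps)
      ultimately show ?thesis
        unfolding Q_def pencil_conic_def residual N1 N2 right_diff_distrib[of ?u] by (simp add: algebra_simps)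
    qed
  qed
  ultimately show ?thesis
    using ijk distinct small by (intro that[of j k "Q r'" "Q s'" "Q t'"]) auto
qed

end

section \<open>Conics as polynomials\<close>

text \<open>The bridge back from functions to polynomials: in degree 2 the values determine all six
  coefficients.\<close>

lemma quadratic_eqI:
  fixes P Q :: "'a::field_char_0 ternary"
  assumes "homogeneous 2 P" "homogeneous 2 Q" "\<And>v. teval P v = teval Q v"
  shows "P = Q"
proof -
  have distinct: "(1::3) \<noteq> 2" "(2::3) \<noteq> 3" "(1::3) \<noteq> 3" by simp_all
  let ?e = "expo 1 2 3"
  let ?l = "\<lambda>P a b c. lookup P (?e a b c)"
  have res: "teval P v = residual_conic (?l P 2 0 0) (?l P 1 1 0) (?l P 0 2 0) (?l P 1 0 1) (?l P 0 1 1) (?l P 0 0 2) v"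
    if "homogeneous 2 P" for P :: "'a ternary" and v
    unfolding quadratic_teval[OF distinct that] residual_conic_def ..
  have co: "?l P 2 0 0 = ?l Q 2 0 0 \<and> ?l P 1 1 0 = ?l Q 1 1 0 \<and> ?l P 0 2 0 = ?l Q 0 2 0
    \<and> ?l P 1 0 1 = ?l Q 1 0 1 \<and> ?l P 0 1 1 = ?l Q 0 1 1 \<and> ?l P 0 0 2 = ?l Q 0 0 2"
    by (rule residual_conic_inject) (simp only: res[OF assms(1), symmetric] res[OF assms(2), symmetric] assms(3))
  show ?thesis
  proof (rule poly_mapping_eqI)
    fix m
    obtain a b c where m: "m = ?e a b c" using expo_cases[OF distinct] by blast
    show "lookup P m = lookup Q m"
    proof (cases "a + b + c = 2")
      case True
      then have "(a, b, c) \<in> {(2,0,0), (1,1,0), (0,2,0), (1,0,1), (0,1,1), (0,0,2)}"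
        by (cases a; cases b; cases c) (auto simp: numeral_2_eq_2)
      then show ?thesis using co m by auto
    next
      case False
      then have "total_degree m \<noteq> 2" by (simp add: m distinct)
      then have "m \<notin> keys P" "m \<notin> keys Q"
        using assms(1,2) by (auto simp: homogeneous_iff)
      then show ?thesis by (simp add: in_keys_iff)
    qed
  qed
qed

section \<open>Irreducibility of conics as polynomials\<close>

definition lin_poly :: "'a::comm_ring_1 ^ 3 \<Rightarrow> 'a ternary" where
  "lin_poly a = const (a $ 1) * var 1 + const (a $ 2) * var 2 + const (a $ 3) * var 3"

lemma teval_lin_poly: "teval (lin_poly a) v = lin a v"
  by (simp add: lin_poly_def teval_add teval_mult lin_3)

lemma homogeneous_lin_poly: "homogeneous 1 (lin_poly a)"
  unfolding lin_poly_def
  using homogeneous_mult[OF homogeneous_const homogeneous_var] by (auto intro!: homogeneous_add)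

lemma teval_at_0:
  assumes "homogeneous d P" "d > 0"
  shows "teval P 0 = 0"
proof -
  have "monom_fun m (0 :: 'a ^ 3) = 0" if "m \<in> keys P" for m
  proof -
    have "(\<Sum>i\<in>UNIV. lookup m i) \<noteq> 0"
      using assms that by (auto simp: homogeneous_def)
    then obtain i where "lookup m i \<noteq> 0" by (meson sum.neutral)
    then show ?thesis unfolding monom_fun_def by (intro prod_zero) (auto simp: power_0_left)
  qed
  then show ?thesis
    unfolding teval_superset[OF finite_keys subset_refl] by simp
qed

definition component :: "nat \<Rightarrow> 'a::comm_ring_1 ternary \<Rightarrow> 'a ternary" where
  "component n P = (\<Sum>m | m \<in> keys P \<and> total_degree m = n. single m (lookup P m))"

lemma lookup_component:
  "lookup (component n P) m = (if total_degree m = n then lookup P m else 0)"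
proof -
  have "lookup (component n P) m
      = (\<Sum>k | k \<in> keys P \<and> total_degree k = n. if k = m then lookup P m else 0)"
    unfolding component_def lookup_sum by (rule sum.cong) (auto simp: lookup_single when_def)
  then show ?thesis by (auto simp: in_keys_iff)
qed

text \<open>As (i, k) is the only pair of degrees with its sum, nothing cancels the product of the
  components of degrees i and k, and a monomial of degree i + k survives. This applies to the two
  minimal and to the two maximal degrees.\<close>

lemma extremal_components:
  fixes A B :: "'a::idom ternary"
  assumes "homogeneous d (A * B)" "i \<in> total_degree ` keys A" "k \<in> total_degree ` keys B"
    and extremal: "\<And>x y. x \<in> total_degree ` keys A \<Longrightarrow> y \<in> total_degree ` keys B \<Longrightarrow>
      x + y = i + k \<Longrightarrow> x = i \<and> y = k"
  shows "d = i + k"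
proof -
  define A0 A1 B0 B1 where "A0 = component i A" and "A1 = A - A0" and "B0 = component k B" and "B1 = B - B0"
  have keys: "keys A0 = {m\<in>keys A. total_degree m = i}"
    "keys A1 = {m\<in>keys A. total_degree m \<noteq> i}"
    "keys B0 = {m\<in>keys B. total_degree m = k}"
    "keys B1 = {m\<in>keys B. total_degree m \<noteq> k}"
    by (auto simp: A0_def A1_def B0_def B1_def in_keys_iff lookup_component lookup_minus split: if_splits)
  have "A0 \<noteq> 0" "B0 \<noteq> 0"
    using assms(2,3) keys by (auto simp: keys_eq_empty[symmetric] simp del: keys_eq_empty)
  then have "A0 * B0 \<noteq> 0" by simp
  then obtain m where m: "m \<in> keys (A0 * B0)"
    by (metis all_not_in_conv keys_eq_empty)
  then have deg_m: "total_degree m = i + k"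
    using keys_mult[of A0 B0] keys by (auto simp: total_degree_add)
  have no_key: "m \<notin> keys (S * T)"
    if "keys S \<subseteq> keys A" "keys T \<subseteq> keys B"
      "\<And>x y. x \<in> keys S \<Longrightarrow> y \<in> keys T \<Longrightarrow> \<not> (total_degree x = i \<and> total_degree y = k)" for S T
  proof
    assume "m \<in> keys (S * T)"
    then obtain x y where xy: "x \<in> keys S" "y \<in> keys T" "m = x + y"
      using keys_mult[of S T] by blast
    then have "total_degree x + total_degree y = i + k" using deg_m by (simp add: total_degree_add)
    then show False using extremal[of "total_degree x" "total_degree y"] xy that by blast
  qed
  have "A * B = A0 * B0 + (A0 * B1 + (A1 * B0 + A1 * B1))"
    by (simp add: A1_def B1_def algebra_simps)
  moreover have "m \<notin> keys (A0 * B1)" "m \<notin> keys (A1 * B0)"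
    "m \<notin> keys (A1 * B1)"
    by (rule no_key; auto simp: keys)+
  then have "lookup (A0 * B1) m = 0" "lookup (A1 * B0) m = 0" "lookup (A1 * B1) m = 0"
    by (simp_all add: in_keys_iff)
  ultimately have "lookup (A * B) m = lookup (A0 * B0) m"
    by (simp add: lookup_add)
  then have "m \<in> keys (A * B)" using m by (simp add: in_keys_iff)
  then show ?thesis using assms(1) deg_m by (simp add: homogeneous_iff)
qed

text \<open>The minimal degrees and the maximal degrees of the factors both add up to d, so they
  coincide in each factor.\<close>

lemma homogeneous_factors:
  fixes A B :: "'a::idom ternary"
  assumes "homogeneous d (A * B)" "A * B \<noteq> 0"
  obtains i k where "d = i + k" "homogeneous i A" "homogeneous k B"
proof -
  let ?dA = "total_degree ` keys A" and ?dB = "total_degree ` keys B"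
  have ne: "?dA \<noteq> {}" "?dB \<noteq> {}" using assms(2) by auto
  have fin: "finite ?dA" "finite ?dB" by simp_all
  have "x = Min ?dA \<and> y = Min ?dB" if "x \<in> ?dA" "y \<in> ?dB" "x + y = Min ?dA + Min ?dB" for x y
    using Min_le[OF fin(1) that(1)] Min_le[OF fin(2) that(2)] that(3) by linarith
  then have d1: "d = Min ?dA + Min ?dB"
    by (rule extremal_components[OF assms(1) Min_in[OF fin(1) ne(1)] Min_in[OF fin(2) ne(2)]])
  have "x = Max ?dA \<and> y = Max ?dB" if "x \<in> ?dA" "y \<in> ?dB" "x + y = Max ?dA + Max ?dB" for x y
    using Max_ge[OF fin(1) that(1)] Max_ge[OF fin(2) that(2)] that(3) by linarith
  then have d2: "d = Max ?dA + Max ?dB"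
    by (rule extremal_components[OF assms(1) Max_in[OF fin(1) ne(1)] Max_in[OF fin(2) ne(2)]])
  have "Min ?dA \<le> Max ?dA" "Min ?dB \<le> Max ?dB" using ne fin by simp_all
  with d1 d2 have eq: "Min ?dA = Max ?dA" "Min ?dB = Max ?dB" by linarith+
  have "homogeneous (Min ?dA) A" "homogeneous (Min ?dB) B"
    unfolding homogeneous_iff using Min_le[OF fin(1)] Max_ge[OF fin(1)] Min_le[OF fin(2)] Max_ge[OF fin(2)] eq
    by (metis antisym imageI)+
  with d1 that show ?thesis by blast
qed

lemma unit_if_homogeneous_0:
  fixes A :: "'a::field ternary"
  assumes "homogeneous 0 A" "A \<noteq> 0"
  shows "A dvd 1"
proof -
  have "m = 0" if "m \<in> keys A" for m
  proof (rule poly_mapping_eqI)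
    fix i
    have "(\<Sum>i\<in>UNIV. lookup m i) = 0" using assms(1) that by (simp add: homogeneous_def)
    then show "lookup m i = lookup 0 i" by simp
  qed
  then have "keys A = {0}" using assms(2) by (metis keys_eq_empty subset_singletonD subsetI singletonI singleton_iff)
  then have A: "A = single 0 (lookup A 0)"
    using sum_singles[of A] by simp
  have "lookup A 0 \<noteq> 0" using \<open>keys A = {0}\<close> by (metis in_keys_iff singletonI)
  then have "A * single 0 (inverse (lookup A 0)) = 1"
    by (subst A) (simp add: mult_single)
  then show ?thesis by (metis dvd_triv_left)
qed

text \<open>Factors of a form are forms, so a factorisation either has a constant factor or consists
  of two linear forms.\<close>

lemma irreducible_quadratic_iff:
  fixes Q :: "'a::field_char_0 ternary"
  assumes Q: "homogeneous 2 Q"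
  shows "Factorial_Ring.irreducible Q \<longleftrightarrow> (\<nexists>a b. \<forall>v. teval Q v = lin a v * lin b v)"
proof
  assume irr: "Factorial_Ring.irreducible Q"
  show "\<nexists>a b. \<forall>v. teval Q v = lin a v * lin b v"
  proof
    assume "\<exists>a b. \<forall>v. teval Q v = lin a v * lin b v"
    then obtain a b where ab: "\<And>v. teval Q v = lin a v * lin b v" by blast
    have "homogeneous 2 (lin_poly a * lin_poly b)"
      using homogeneous_mult[OF homogeneous_lin_poly homogeneous_lin_poly, of a b] by (simp add: numeral_2_eq_2)
    then have "Q = lin_poly a * lin_poly b"
      by (intro quadratic_eqI Q) (simp_all add: teval_mult teval_lin_poly ab)
    from Factorial_Ring.irreducibleD[OF irr this] have "lin_poly a dvd 1 \<or> lin_poly b dvd 1" .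
    moreover have "\<not> lin_poly c dvd 1" for c :: "'a ^ 3"
    proof
      assume "lin_poly c dvd 1"
      then obtain S where "1 = lin_poly c * S" by (auto elim: dvdE)
      then have "teval 1 0 = teval (lin_poly c * S) 0" by simp
      then show False by (simp add: teval_mult teval_lin_poly lin_3)
    qed
    ultimately show False by blast
  qed
next
  assume not_product: "\<nexists>a b. \<forall>v. teval Q v = lin a v * lin b v"
  show "Factorial_Ring.irreducible Q"
  proof (rule Factorial_Ring.irreducibleI)
    show "Q \<noteq> 0"
    proof
      assume "Q = 0"
      then have "teval Q v = lin 0 v * lin 0 v" for v by (simp add: lin_3)
      with not_product show False by blast
    qed
    show "\<not> Q dvd 1"
    proof
      assume "Q dvd 1"
      then obtain S where "1 = Q * S" by (auto elim: dvdE)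
      then have "teval 1 0 = teval (Q * S) 0" by simp
      then show False using teval_at_0[OF Q] by (simp add: teval_mult)
    qed
    fix A B assume AB: "Q = A * B"
    have nz: "A \<noteq> 0" "B \<noteq> 0" using \<open>Q \<noteq> 0\<close> AB by auto
    obtain i k where ik: "2 = i + k" "homogeneous i A" "homogeneous k B"
      using homogeneous_factors[of 2 A B] Q \<open>Q \<noteq> 0\<close> AB by blast
    have "i = 0 \<or> k = 0 \<or> (i = 1 \<and> k = 1)" using ik(1) by auto
    then consider "i = 0" | "k = 0" | "i = 1" "k = 1" by blast
    then show "A dvd 1 \<or> B dvd 1"
    proof cases
      case 1
      then show ?thesis using unit_if_homogeneous_0 ik(2) nz by blast
    next
      case 2
      then show ?thesis using unit_if_homogeneous_0 ik(3) nz by blast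
    next
      case 3
      have linear: "\<exists>a. \<forall>v. teval S v = lin a v" if S: "homogeneous 1 S" for S :: "'a ternary"
      proof -
        obtain a b c where "\<And>v. teval S v = a * (v $ 1) + b * (v $ 2) + c * (v $ 3)"
          using form_teval[OF S] by (rule linear_form_in[of 1 2 3, rotated 3]) auto
        then have "\<forall>v. teval S v = lin (vec3 a b c) v" by (simp add: lin_3)
        then show ?thesis by blast
      qed
      obtain a b where "\<And>v. teval A v = lin a v" "\<And>v. teval B v = lin b v"
        using linear[of A] linear[of B] ik 3 by blast
      then have "\<forall>v. teval Q v = lin a v * lin b v" by (simp add: AB teval_mult)
      with not_product show ?thesis by blast
    qed
  qed
qed

section \<open>Zero loci and plane curves\<close>

lemma teval_smult:
  assumes "homogeneous d P"
  shows "teval P (c *s v) = c ^ d * teval P v"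
proof -
  have "monom_fun m (c *s v) = c ^ d * monom_fun m v" if "m \<in> keys P" for m
  proof -
    have "monom_fun m (c *s v) = (\<Prod>i\<in>UNIV. c ^ lookup m i) * monom_fun m v"
      by (simp add: monom_fun_def power_mult_distrib prod.distrib)
    also have "(\<Prod>i\<in>UNIV. c ^ lookup m i) = c ^ total_degree m"
      by (simp add: total_degree_def power_sum)
    finally show ?thesis using assms that by (simp add: homogeneous_iff)
  qed
  then show ?thesis
    unfolding teval_superset[OF finite_keys subset_refl] sum_distrib_left
    by (intro sum.cong) (simp_all add: mult_ac)
qed

text \<open>The zero vector is a common zero because both degrees are positive; on the right-hand
  side it is the multiple with c = 0.\<close>

lemma singleton_intersection_iff:
  fixes P Q :: "'a::field ternary"
  assumes P: "homogeneous d P" "d > 0" and Q: "homogeneous e Q" "e > 0"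
  shows "is_singleton (zero_locus Q \<inter> zero_locus P) \<longleftrightarrow>
    (\<exists>p. p \<noteq> 0 \<and> (\<forall>v. teval Q v = 0 \<and> teval P v = 0 \<longleftrightarrow> (\<exists>c. v = c *s p)))"
proof -
  have zl: "proj_point v \<in> zero_locus S \<longleftrightarrow> teval S v = 0"
    if "homogeneous n S" "v \<noteq> 0" for S :: "'a ternary" and n v
  proof
    assume "proj_point v \<in> zero_locus S"
    then obtain w where w: "proj_point v = proj_point w" "teval S w = 0"
      by (auto simp: zero_locus_def)
    then obtain c where "c \<noteq> 0" "w = c *s v" using proj_point_eq_iff by blast
    then show "teval S v = 0" using w(2) teval_smult[OF that(1)] by simp
  next
    assume "teval S v = 0"
    then show "proj_point v \<in> zero_locus S" using that by (auto simp: zero_locus_def)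
  qed
  have elem: "\<exists>v. v \<noteq> 0 \<and> Z = proj_point v" if "Z \<in> zero_locus S" for Z and S :: "'a ternary"
    using that by (auto simp: zero_locus_def)
  show ?thesis
  proof
    assume "is_singleton (zero_locus Q \<inter> zero_locus P)"
    then obtain Z where Z: "zero_locus Q \<inter> zero_locus P = {Z}" by (auto simp: is_singleton_def)
    then have Z_mem: "Z \<in> zero_locus Q" "Z \<in> zero_locus P" by auto
    obtain p where p: "p \<noteq> 0" "Z = proj_point p" using elem[OF Z_mem(1)] by blast
    have p0: "teval Q p = 0" "teval P p = 0"
      using Z_mem zl[OF Q(1) p(1)] zl[OF P(1) p(1)] unfolding p(2) by simp_all
    have "teval Q v = 0 \<and> teval P v = 0 \<longleftrightarrow> (\<exists>c. v = c *s p)" for v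
    proof
      assume v: "teval Q v = 0 \<and> teval P v = 0"
      show "\<exists>c. v = c *s p"
      proof (cases "v = 0")
        case True
        then show ?thesis by (intro exI[of _ 0]) simp
      next
        case False
        then have "proj_point v \<in> zero_locus Q \<inter> zero_locus P"
          using v zl[OF Q(1) False] zl[OF P(1) False] by simp
        then have "proj_point p = proj_point v" unfolding Z p(2) by simp
        then show ?thesis using proj_point_eq_iff by blast
      qed
    next
      assume "\<exists>c. v = c *s p"
      then show "teval Q v = 0 \<and> teval P v = 0"
        using p0 teval_smult[OF Q(1)] teval_smult[OF P(1)] by auto
    qed
    with p(1) show "\<exists>p. p \<noteq> 0 \<and> (\<forall>v. teval Q v = 0 \<and> teval P v = 0 \<longleftrightarrow> (\<exists>c. v = c *s p))" by blast
  next
    assume "\<exists>p. p \<noteq> 0 \<and> (\<forall>v. teval Q v = 0 \<and> teval P v = 0 \<longleftrightarrow> (\<exists>c. v = c *s p))"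
    then obtain p where p: "p \<noteq> 0" "\<And>v. teval Q v = 0 \<and> teval P v = 0 \<longleftrightarrow> (\<exists>c. v = c *s p)" by blast
    have "zero_locus Q \<inter> zero_locus P = {proj_point p}"
    proof (intro subset_antisym subsetI)
      fix Z assume Z: "Z \<in> zero_locus Q \<inter> zero_locus P"
      then obtain v where v: "v \<noteq> 0" "Z = proj_point v" using elem by blast
      then have "teval Q v = 0 \<and> teval P v = 0"
        using Z zl[OF Q(1) v(1)] zl[OF P(1) v(1)] by simp
      then obtain c where "v = c *s p" using p(2) by blast
      moreover from this v(1) have "c \<noteq> 0" by auto
      ultimately show "Z \<in> {proj_point p}" using v(2) proj_point_eq_iff by blast
    next
      fix Z assume "Z \<in> {proj_point p}"
      moreover have "teval Q p = 0 \<and> teval P p = 0"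
        unfolding p(2) by (rule exI[of _ 1]) simp
      ultimately show "Z \<in> zero_locus Q \<inter> zero_locus P"
        using zl[OF Q(1) p(1)] zl[OF P(1) p(1)] by simp
    qed
    then show "is_singleton (zero_locus Q \<inter> zero_locus P)" by (simp add: is_singleton_def)
  qed
qed

lemma tangent_conics_eq:
  fixes P :: "'a::field_char_0 ternary"
  assumes "homogeneous 3 P"
  shows "tangent_conics P = {plane_curve Q | Q. homogeneous 2 Q \<and> tangent_conic_fun (teval P) (teval Q)}"
proof -
  have "homogeneous 2 Q \<and> Factorial_Ring.irreducible Q \<and> is_singleton (zero_locus Q \<inter> zero_locus P)
     \<longleftrightarrow> homogeneous 2 Q \<and> tangent_conic_fun (teval P) (teval Q)" for Q :: "'a ternary"
    using irreducible_quadratic_iff[of Q] singleton_intersection_iff[OF assms _ _, of 2 Q] form_teval[of 2 Q]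
    unfolding tangent_conic_fun_def by auto
  then show ?thesis unfolding tangent_conics_def by blast
qed

lemma plane_curve_eqD:
  assumes "plane_curve P = plane_curve Q"
  obtains c where "c \<noteq> 0" "Q = const c * P"
proof -
  have "const 1 * Q = Q" by (simp add: const_def)
  then have "Q \<in> plane_curve Q" unfolding plane_curve_def by (auto intro!: exI[of _ 1])
  with assms have "Q \<in> plane_curve P" by simp
  then show ?thesis using that by (auto simp: plane_curve_def)
qed

lemma plane_curve_const_mult:
  assumes "c \<noteq> 0"
  shows "plane_curve (const c * P) = plane_curve P"
proof -
  have mult: "const a * (const b * P) = const (a * b) * P" for a b
    by (simp add: const_def mult.assoc[symmetric] mult_single)
  show ?thesis
  proof (intro subset_antisym subsetI)
    fix Z assume "Z \<in> plane_curve (const c * P)"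
    then obtain d where "d \<noteq> 0" "Z = const d * (const c * P)" by (auto simp: plane_curve_def)
    then have "Z = const (d * c) * P" "d * c \<noteq> 0" using assms by (simp_all add: mult)
    then show "Z \<in> plane_curve P" unfolding plane_curve_def by blast
  next
    fix Z assume "Z \<in> plane_curve P"
    then obtain d where "d \<noteq> 0" "Z = const d * P" by (auto simp: plane_curve_def)
    then have "Z = const (d / c) * (const c * P)" "d / c \<noteq> 0"
      unfolding mult using assms by simp_all
    then show "Z \<in> plane_curve (const c * P)" unfolding plane_curve_def by blast
  qed
qed

section \<open>Limits over the origin\<close>

text \<open>Gives \<open>'k gen\<close> characteristic zero, as the lemmas on cubics and conics
  demand.\<close>

instance fract :: ("{idom, ring_char_0}") field_char_0
proof
  have "of_nat n = (to_fract (of_nat n) :: 'a fract)" for n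
    by (induction n) simp_all
  then show "inj (of_nat :: nat \<Rightarrow> 'a fract)"
    by (intro injI) (metis of_nat_eq_iff to_fract_eq_iff)
qed

lemma gen_of_poly_simps [simp]:
  "gen_of_poly 0 = 0" "gen_of_poly 1 = 1"
  "gen_of_poly (p + q) = gen_of_poly p + gen_of_poly q"
  "gen_of_poly (p - q) = gen_of_poly p - gen_of_poly q"
  "gen_of_poly (p * q) = gen_of_poly p * gen_of_poly q"
  "gen_of_poly p = 0 \<longleftrightarrow> p = 0"
  by (simp_all add: gen_of_poly_def)

context
  fixes V :: "'k::{alg_closed_field, field_char_0} gen set"
  assumes V: "valuation_ring_over_0 V"
begin

lemma valuation_ring_residue_char: "residue_char_not_2 V"
proof
  show "x - y \<in> V" "x * y \<in> V" if "x \<in> V" "y \<in> V" for x y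
    using V that by (auto simp: valuation_ring_over_0_def)
  show "x \<in> V \<or> inverse x \<in> V" for x
    using V by (auto simp: valuation_ring_over_0_def)
  have "gen_of_poly [:inverse 2:] * 2 = gen_of_poly [:inverse 2 :: 'k:] * (gen_of_poly 1 + gen_of_poly 1)"
    by simp
  also have "\<dots> = gen_of_poly ([:inverse 2:] * (1 + 1))"
    by (simp only: gen_of_poly_simps)
  also have "[:inverse 2:] * (1 + 1) = (1 :: 'k poly)"
    by (simp add: one_pCons)
  finally have "gen_of_poly [:inverse 2 :: 'k:] = inverse 2"
    by (metis gen_of_poly_simps(2) inverse_unique mult.commute)
  then show "inverse 2 \<in> V"
    using V by (auto simp: valuation_ring_over_0_def)
qed

interpretation alg_closed_residue_char_not_2 V
  using valuation_ring_residue_char by (simp add: alg_closed_residue_char_not_2_def)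

lemma gen_of_poly_V: "gen_of_poly p \<in> V"
  using V by (auto simp: valuation_ring_over_0_def)

lemma parameter_M: "gen_of_poly [:0, 1:] \<in> M"
  using V gen_of_poly_V unfolding valuation_ring_over_0_def max_ideal_def by blast

text \<open>Write p = p(0) + t q: the second summand is in M, and nonzero constants are
  units.\<close>

lemma gen_of_poly_M_iff: "gen_of_poly p \<in> M \<longleftrightarrow> poly p 0 = 0"
proof -
  have const_unit: "gen_of_poly [:c:] \<notin> M" if "c \<noteq> 0" for c
  proof -
    have "gen_of_poly [:c:] * gen_of_poly [:inverse c:] = 1"
      using that by (simp add: gen_of_poly_simps(5)[symmetric] one_pCons[symmetric] del: gen_of_poly_simps(5))
    then show ?thesis using M_mult_right[of "gen_of_poly [:c:]", OF _ gen_of_poly_V] M_1 by metis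
  qed
  obtain q where q: "p = [:poly p 0:] + [:0, 1:] * q"
    by (cases p) auto
  then have eq: "gen_of_poly p = gen_of_poly [:poly p 0:] + gen_of_poly [:0, 1:] * gen_of_poly q"
    by (metis gen_of_poly_simps(3,5))
  have M: "gen_of_poly [:0, 1:] * gen_of_poly q \<in> M" using parameter_M gen_of_poly_V by blast
  show ?thesis
  proof (cases "poly p 0 = 0")
    case True
    then show ?thesis using eq M by simp
  next
    case False
    then show ?thesis using unit_add[OF const_unit[OF False] M] eq by simp
  qed
qed

text \<open>In the type \<open>3\<close> the index 3 is 0, so the indices 0, 1, 2 here are 3, 1, 2
  for the vectors above.\<close>

definition multidegree :: "(3 \<Rightarrow>\<^sub>0 nat) \<Rightarrow> nat multiset" where
  "multidegree m = {#lookup m 0, lookup m 1, lookup m 2#}"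

lemma var_power: "var i ^ n = single (single i n) 1"
  by (induction n) (simp_all add: var_def mult_single single_add[symmetric])

lemma has_limiting_multidegree_iff_monomial:
  "has_limiting_multidegree V C D \<longleftrightarrow> (\<exists>m. D = multidegree m \<and> has_limit V C (plane_curve (single m 1)))"
proof -
  have distinct: "(0::3) \<noteq> 1" "(1::3) \<noteq> 2" "(0::3) \<noteq> 2" by simp_all
  have prod: "var 0 ^ a * var 1 ^ b * var 2 ^ c = (single (expo 0 1 2 a b c) 1 :: 'k ternary)" for a b c
    by (simp add: var_power mult_single expo_def)
  have md: "multidegree (expo 0 1 2 a b c) = {#a, b, c#}" for a b c
    using lookup_expo[OF distinct] by (simp add: multidegree_def)
  show ?thesis
    unfolding has_limiting_multidegree_def prod
    using md expo_cases[OF distinct] by metis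
qed

lemma limits_to_lookup:
  assumes "homogeneous 2 Q" "limits_to (teval Q) (\<lambda>v. v $ j * v $ k)"
  obtains u where "u \<noteq> 0"
    "\<And>m. u * lookup Q m - (if m = single j 1 + single k 1 then 1 else 0) \<in> M"
proof -
  obtain u R where u: "u \<noteq> 0" "form_in M 2 R" "\<And>v. u * teval Q v = v $ j * v $ k + R v"
    using assms(2) unfolding limits_to_def by blast
  obtain S where S: "homogeneous 2 S" "\<And>m. lookup S m \<in> M" "\<And>v. teval S v = R v"
    using u(2) unfolding form_in_def by blast
  have "homogeneous (1 + 1) (var j * var k :: 'k gen ternary)"
    by (intro homogeneous_mult homogeneous_var)
  then have "homogeneous 2 (var j * var k + S)"
    using S(1) by (intro homogeneous_add) (simp_all add: numeral_2_eq_2)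
  moreover have "homogeneous 2 (const u * Q)"
    using homogeneous_mult[OF homogeneous_const assms(1), of u] by (simp only: add_0)
  ultimately have "const u * Q = var j * var k + S"
    by (intro quadratic_eqI) (simp_all add: teval_mult teval_add S(3) u(3))
  then have eq: "u * lookup Q m = lookup (var j * var k + S) m" for m
    by (metis lookup_const_mult)
  show ?thesis
  proof (rule that[OF u(1)])
    fix m
    have "u * lookup Q m - (if m = single j 1 + single k 1 then 1 else 0)
        = lookup S m"
      unfolding eq by (auto simp: lookup_add var_def mult_single lookup_single when_def)
    then show "u * lookup Q m - (if m = single j 1 + single k 1 then 1 else 0) \<in> M"
      using S(2) by simp
  qed
qed

text \<open>Uniqueness of the flat limit: two representatives with nonzero reduction differ by a
  unit, so their reductions have the same monomial.\<close>

lemma has_limit_monomial_iff: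
  assumes Q: "homogeneous 2 Q" "limits_to (teval Q) (\<lambda>v. v $ j * v $ k)"
  shows "has_limit V (plane_curve Q) (plane_curve (single n 1)) \<longleftrightarrow>
    n = single j 1 + single k 1"
proof -
  define n0 where "n0 = single j 1 + single k (1::nat)"
  obtain u where u: "u \<noteq> 0" "\<And>m. u * lookup Q m - (if m = n0 then 1 else 0) \<in> M"
    by (rule limits_to_lookup[OF Q, folded n0_def]) (rule that)
  show ?thesis
    unfolding n0_def[symmetric]
  proof
    assume n: "n = n0"
    have "gen_of_poly [:lookup (single n (1::'k)) m:] = (if m = n0 then 1 else 0)" for m
      by (auto simp: n lookup_single when_def one_pCons[symmetric])
    moreover have "u * lookup Q m \<in> V" for m
    proof -
      have "(u * lookup Q m - (if m = n0 then 1 else 0)) + (if m = n0 then 1 else 0) \<in> V"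
        using M_V[OF u(2)] by (rule V_add) simp
      then show ?thesis by simp
    qed
    ultimately have "\<forall>m. lookup (const u * Q) m \<in> V \<and> lookup (const u * Q) m
        - gen_of_poly [:lookup (single n (1::'k)) m:] \<in> M"
      using u(2) by (simp add: lookup_const_mult)
    moreover have "plane_curve Q = plane_curve (const u * Q)"
      using plane_curve_const_mult[OF u(1)] by blast
    moreover have "single n (1::'k) \<noteq> 0"
      by (metis lookup_single_eq lookup_zero zero_neq_one)
    ultimately show "has_limit V (plane_curve Q) (plane_curve (single n 1))"
      unfolding has_limit_def by blast
  next
    assume "has_limit V (plane_curve Q) (plane_curve (single n 1))"
    then obtain Q' R where QR: "plane_curve Q = plane_curve Q'" "plane_curve (single n 1) = plane_curve R"
      "\<And>m. lookup Q' m \<in> V"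
      "\<And>m. lookup Q' m - gen_of_poly [:lookup R m:] \<in> M"
      unfolding has_limit_def by blast
    obtain c where c: "c \<noteq> 0" "Q' = const c * Q" using plane_curve_eqD[OF QR(1)] by blast
    obtain d where d: "d \<noteq> 0" "R = const d * single n 1" using plane_curve_eqD[OF QR(2)] by blast
    have R: "lookup R m = (if m = n then d else 0)" for m
      unfolding d(2) lookup_const_mult by (simp add: lookup_single when_def)
    show "n = n0"
    proof (rule ccontr)
      assume "n \<noteq> n0"
      \<comment> \<open>If the monomials differ, the coefficient of Q' at n0 is w times a unit and
        lies in M. So w is in M, and then so is the coefficient at n, which should reduce to
        d.\<close>
      define w where "w = c / u"
      have Q'w: "lookup Q' m = w * (u * lookup Q m)" for m
        using u(1) by (simp add: c(2) lookup_const_mult w_def)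
      have 1: "lookup Q' n0 \<in> M"
        using QR(4)[of n0] \<open>n \<noteq> n0\<close> by (simp add: R)
      define z where "z = u * lookup Q n0"
      have "1 + (z - 1) \<notin> M" using unit_add[OF M_1, of "z - 1"] u(2)[of n0] by (simp add: z_def)
      moreover have "1 + (z - 1) \<in> V" using M_V[OF u(2)[of n0]] V_1 unfolding z_def by (intro V_add) simp_all
      ultimately have z: "z \<in> V" "z \<notin> M" by simp_all
      then have "z \<noteq> 0" by auto
      have "w * z \<in> M" using 1 by (simp add: Q'w z_def)
      then have "w * z / z \<in> M" using M_divide_unit z by blast
      then have "w \<in> M" using \<open>z \<noteq> 0\<close> by simp
      moreover have "u * lookup Q n \<in> M" using u(2)[of n] \<open>n \<noteq> n0\<close> by simp
      ultimately have n: "lookup Q' n \<in> M" unfolding Q'w using M_V by blast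
      have "lookup Q' n - (lookup Q' n - gen_of_poly [:lookup R n:]) \<in> M"
        by (rule M_diff[OF n QR(4)])
      then have "gen_of_poly [:d:] \<in> M" by (simp add: R)
      then show False using d(1) by (simp add: gen_of_poly_M_iff)
    qed
  qed
qed

text \<open>Stated as an equivalence, since the count also needs that a conic of one type is not of
  the other.\<close>

lemma has_limiting_multidegree_iff:
  assumes "homogeneous 2 Q" "limits_to (teval Q) (\<lambda>v. v $ j * v $ k)"
  shows "has_limiting_multidegree V (plane_curve Q) D \<longleftrightarrow> D = (if j = k then {#2, 0, 0#} else {#1, 1, 0#})"
proof -
  have "multidegree (single j 1 + single k 1) = (if j = k then {#2, 0, 0#} else {#1, 1, 0#})"
  proof -
    have cases: "l = 0 \<or> l = 1 \<or> l = 2" for l :: 3 using exhaust_3[of l] by auto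
    show ?thesis
      using cases[of j] cases[of k]
      by (elim disjE) (simp_all add: multidegree_def lookup_add lookup_single when_def add_mset_commute)
  qed
  then show ?thesis
    unfolding has_limiting_multidegree_iff_monomial has_limit_monomial_iff[OF assms] by auto
qed

end

text \<open>If m were 0, the cubic would be c l^3 and singular along l = 0.\<close>

lemma flex_line_if_on_flex:
  fixes F :: "'a::alg_closed_field ^ 3 \<Rightarrow> 'a"
  assumes "smooth F" "on_flex F Q m"
  shows "flex_line F m"
proof -
  obtain l c where F: "\<And>v. F v = lin m v * Q v + c * (lin l v)^3"
    using assms(2) unfolding on_flex_def by blast
  have "m \<noteq> 0"
  proof
    assume "m = 0"
    then have F': "F v = c * (lin l v)^3" for v by (simp add: F lin_3)
    obtain v where v: "v \<noteq> 0" "lin l v = 0"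
    proof (cases "l $ 1 = 0")
      case True
      then show ?thesis by (intro that[of "vec3 1 0 0"]) (simp_all add: lin_3 vec3_eq_iff)
    next
      case False
      then show ?thesis by (intro that[of "vec3 (- l $ 2) (l $ 1) 0"]) (simp_all add: lin_3 vec3_eq_iff mult.commute)
    qed
    have "F (v + t *s w) = t^2 * 0 + t^3 * (c * (lin l w)^3)" for t w
      by (simp add: F' lin_add lin_smult v(2) power_mult_distrib)
    then have "singular_at F v" unfolding singular_at_def by blast
    then show False using assms(1) v(1) unfolding smooth_def by blast
  qed
  moreover obtain r where "r^3 = c" using cube_root_exists by blast
  then have "F v = (lin (r *s l) v)^3" if "lin m v = 0" for v
    using that by (simp add: F lin_smult_left power_mult_distrib)
  ultimately show ?thesis unfolding flex_line_def by blast
qed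

lemma tangent_conic_fun_scale:
  assumes "tangent_conic_fun F Q" "c \<noteq> 0"
  shows "tangent_conic_fun F (\<lambda>v. c * Q v)"
proof -
  have "\<nexists>a b. \<forall>v. c * Q v = lin a v * lin b v"
  proof
    assume "\<exists>a b. \<forall>v. c * Q v = lin a v * lin b v"
    then obtain a b where ab: "\<And>v. c * Q v = lin a v * lin b v" by blast
    have "Q v = lin (inverse c *s a) v * lin b v" for v
      using ab[of v] assms(2) by (simp add: lin_smult_left field_simps)
    then show False using assms(1) unfolding tangent_conic_fun_def by blast
  qed
  moreover have "form 2 (\<lambda>v. c * Q v)"
    using assms(1) unfolding tangent_conic_fun_def by (intro form_scale) blast
  moreover have "c * Q v = 0 \<longleftrightarrow> Q v = 0" for v using assms(2) by simp
  ultimately show ?thesis using assms(1) unfolding tangent_conic_fun_def by presburger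
qed

lemma on_flex_scale:
  assumes "c \<noteq> 0"
  shows "on_flex F (\<lambda>v. c * Q v) m \<longleftrightarrow> on_flex F Q (c *s m)"
  unfolding on_flex_def by (simp add: lin_smult_left mult_ac)

section \<open>The generic fibre\<close>

lemma lookup_map: "f 0 = 0 \<Longrightarrow> lookup (Poly_Mapping.map f p) m = f (lookup p m)"
  by (simp add: Poly_Mapping.map.rep_eq when_def)

lemma homogeneous_map: "f 0 = 0 \<Longrightarrow> homogeneous d P \<Longrightarrow> homogeneous d (Poly_Mapping.map f P)"
  unfolding homogeneous_def by (auto simp: in_keys_iff lookup_map)

lemma teval_axis:
  assumes "homogeneous 3 P"
  shows "teval P (axis i 1) = lookup P (single i 3)"
proof -
  obtain j k where ijk: "i \<noteq> j" "j \<noteq> k" "i \<noteq> k" by (rule other_indices) (rule that)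
  have "expo i j k 3 0 0 = single i 3" by (simp add: expo_def)
  then show ?thesis
    unfolding cubic_teval[OF ijk assms] using ijk by (simp add: axis_def)
qed

definition triangle_monomial :: "3 \<Rightarrow>\<^sub>0 nat" where
  "triangle_monomial = single 0 1 + single 1 1 + single 2 1"

lemma lookup_triangle_monomial [simp]: "lookup triangle_monomial l = 1"
proof -
  have "l = 0 \<or> l = 1 \<or> l = 2" using exhaust_3[of l] by auto
  then show ?thesis
    by (elim disjE) (simp_all add: triangle_monomial_def lookup_add lookup_single when_def)
qed

lemma triangle_form: "var 0 * var 1 * var 2 = single triangle_monomial 1"
  by (simp add: var_def mult_single triangle_monomial_def)

text \<open>Turns the equality of plane curves at t = 0 into coefficients: all but that of x y z
  vanish at the origin.\<close>

lemma cubic_degeneration_lookup_0: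
  assumes "cubic_degeneration U F"
  obtains c where "c \<noteq> 0"
    "\<And>m. poly (lookup F m) 0 = (if m = triangle_monomial then c else 0)"
proof -
  have "plane_curve (fibre F 0) = plane_curve (single triangle_monomial 1)"
    using assms by (simp add: cubic_degeneration_def triangle_form)
  then obtain c where c: "c \<noteq> 0" "single triangle_monomial 1 = const c * fibre F 0"
    by (rule plane_curve_eqD)
  have "(if m = triangle_monomial then 1 else 0) = c * poly (lookup F m) 0" for m
    using arg_cong[OF c(2), of "\<lambda>P. lookup P m"]
    by (auto simp: lookup_const_mult fibre_def lookup_map lookup_single when_def)
  then have "poly (lookup F m) 0 = (if m = triangle_monomial then inverse c else 0)" for m
    using c(1) by (metis inverse_unique mult_eq_0_iff)
  then show ?thesis using c(1) by (intro that[of "inverse c"]) auto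
qed

text \<open>At the vertices of the triangle all partial derivatives of \<open>xyz\<close> vanish, so smoothness of the
  total space is a condition on the derivative in the direction of the base.\<close>

lemma cubic_degeneration_vertex:
  assumes "cubic_degeneration U F"
  shows "poly (pderiv (lookup F (single i 3))) 0 \<noteq> 0"
proof -
  obtain c where c: "c \<noteq> 0" "\<And>m. poly (lookup F m) 0 = (if m = triangle_monomial then c else 0)"
    by (rule cubic_degeneration_lookup_0[OF assms]) (rule that)
  have hom: "homogeneous 3 F" using assms by (simp add: cubic_degeneration_def)
  have F0: "fibre F 0 = single triangle_monomial c"
    by (rule poly_mapping_eqI) (simp add: fibre_def lookup_map c(2) lookup_single when_def)
  let ?v = "axis i 1 :: 'a ^ 3"
  \<comment> \<open>The case n = 0 is x y z at the vertex, n = 1 concerns its partial derivatives.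
    Some l other than i and j keeps the exponent 1, and the vertex has coordinate 0 there.\<close>
  have vanish: "monom_fun (triangle_monomial - single j n) ?v = 0" for j n
  proof -
    obtain l where l: "l \<noteq> i" "l \<noteq> j"
      using other_indices[of i] by metis
    have "lookup (triangle_monomial - single j n) l = 1"
      using l(2) by (simp add: lookup_minus lookup_single when_def)
    then have zero: "?v $ l ^ lookup (triangle_monomial - single j n) l = 0"
      using l(1) by (simp add: axis_def)
    show ?thesis
      unfolding monom_fun_def by (rule prod_zero, simp, rule bexI[of _ l], rule zero, simp)
  qed
  have "teval (fibre F 0) ?v = 0"
    using vanish[of i 0] by (simp add: F0 teval_single)
  moreover have "teval (partial j (fibre F 0)) ?v = 0" for j
    by (simp add: partial_def F0 teval_sum teval_single vanish)
  moreover have "?v \<noteq> 0" by (metis axis_eq_0_iff zero_neq_one)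
  ultimately have "teval (fibre (Poly_Mapping.map pderiv F) 0) ?v \<noteq> 0"
    using assms unfolding cubic_degeneration_def smooth_total_space_def by blast
  moreover have "homogeneous 3 (fibre (Poly_Mapping.map pderiv F) 0)"
    unfolding fibre_def by (intro homogeneous_map hom) simp_all
  ultimately show ?thesis
    by (simp add: teval_axis fibre_def lookup_map)
qed

context
  fixes V :: "'k::{alg_closed_field, field_char_0} gen set"
  assumes V: "valuation_ring_over_0 V"
begin

interpretation alg_closed_residue_char_not_2 V
  using valuation_ring_residue_char[OF V] by (simp add: alg_closed_residue_char_not_2_def)

text \<open>The coefficient of x y z becomes e as a whole; every other one is t times its quotient
  by t. At a vertex this quotient p / t has the value p'(0) at the origin, which is nonzero.\<close>

lemma generic_fibre_degenerating:
  assumes "cubic_degeneration U F"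
  shows "degenerating_cubic (gen_of_poly [:0, 1:]) (teval (generic_fibre F))"
proof -
  let ?\<tau> = "gen_of_poly [:0, 1 :: 'k:]"
  obtain c where c: "c \<noteq> 0" "\<And>m. poly (lookup F m) 0 = (if m = triangle_monomial then c else 0)"
    by (rule cubic_degeneration_lookup_0[OF assms]) (rule that)
  have hom: "homogeneous 3 F" using assms by (simp add: cubic_degeneration_def)
  \<comment> \<open>The else-branch serves the monomial x y z, whose coefficient does not vanish at
    the origin.\<close>
  define h :: "'k poly \<Rightarrow> 'k gen" where "h p = (if poly p 0 = 0 then gen_of_poly (p div [:0, 1:]) else 0)" for p
  have h0: "h 0 = 0" by (simp add: h_def)
  have hp: "?\<tau> * h p = gen_of_poly p" if "poly p 0 = 0" for p
  proof -
    have "[:0, 1:] dvd p" using that poly_eq_0_iff_dvd[of p 0] by simp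
    then have "[:0, 1:] * (p div [:0, 1:]) = p" by (rule dvd_mult_div_cancel)
    then show ?thesis using that by (simp add: h_def gen_of_poly_simps(5)[symmetric] del: gen_of_poly_simps(5))
  qed
  define S where "S = Poly_Mapping.map h F"
  define e where "e = gen_of_poly (lookup F triangle_monomial)"
  have S: "lookup S m = h (lookup F m)" for m
    by (simp add: S_def lookup_map h0)
  have homS: "homogeneous 3 S"
    unfolding S_def by (rule homogeneous_map[where f = h, OF h0 hom])
  have "generic_fibre F = single triangle_monomial e + const ?\<tau> * S"
  proof (rule poly_mapping_eqI)
    fix m
    have P: "lookup (generic_fibre F) m = gen_of_poly (lookup F m)"
      by (simp add: generic_fibre_def lookup_map)
    show "lookup (generic_fibre F) m
        = lookup (single triangle_monomial e + const ?\<tau> * S) m"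
    proof (cases "m = triangle_monomial")
      case True
      then show ?thesis unfolding P using c by (simp add: lookup_add lookup_const_mult S h_def e_def)
    next
      case False
      then show ?thesis using hp c by (simp add: P lookup_add lookup_const_mult S lookup_single when_def)
    qed
  qed
  then have "teval (generic_fibre F) v = e * (\<Prod>i\<in>UNIV. v $ i) + ?\<tau> * teval S v" for v
    by (simp add: teval_add teval_mult teval_single monom_fun_def)
  moreover have "form_in V 3 (teval S)"
    unfolding form_in_def using homS S gen_of_poly_V[OF V]
    by (intro exI[of _ S]) (auto simp: h_def)
  moreover have "teval S (axis i 1) \<notin> M" for i
  proof -
    define p where "p = lookup F (single i 3)"
    have "lookup (single i 3) i \<noteq> lookup triangle_monomial i" by simp
    then have "single i 3 \<noteq> triangle_monomial" by metis
    then have p0: "poly p 0 = 0" by (simp add: p_def c)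
    then have "[:0, 1:] dvd p" using poly_eq_0_iff_dvd[of p 0] by simp
    then obtain q where q: "p = [:0, 1:] * q" by (elim dvdE)
    have "poly (pderiv p) 0 = poly q 0" unfolding q pderiv_mult by (simp add: pderiv_pCons)
    moreover have "poly (pderiv p) 0 \<noteq> 0" unfolding p_def by (rule cubic_degeneration_vertex[OF assms])
    moreover have "p div [:0, 1:] = q" unfolding q by (rule nonzero_mult_div_cancel_left) simp
    moreover have "teval S (axis i 1) = h p"
      using teval_axis[OF homS, of i] S by (simp add: p_def)
    ultimately show ?thesis using p0 by (simp add: h_def gen_of_poly_M_iff[OF V])
  qed
  moreover have "e \<in> V" "e \<notin> M"
    using c by (simp_all add: e_def gen_of_poly_V[OF V] gen_of_poly_M_iff[OF V])
  moreover have "?\<tau> \<in> M" "?\<tau> \<noteq> 0"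
    using parameter_M[OF V] by simp_all
  ultimately show ?thesis unfolding degenerating_cubic_def by blast
qed

text \<open>Scaling by a coordinate that divides the others yields the integral representative on
  which \<open>degenerating_cubic_at_flex\<close> relies.\<close>

lemma normalised_flex_line:
  assumes "flex_line F m"
  obtains m' i where "proj_point m' = proj_point m" "flex_line F m'" "m' $ i = 1" "\<And>l. m' $ l \<in> V"
proof -
  have "m \<noteq> 0" using assms by (simp add: flex_line_def)
  then obtain i where i: "m $ i \<noteq> 0" "\<And>l. m $ l / m $ i \<in> V" by (rule maximal_coordinate) (rule that)
  let ?m = "inverse (m $ i) *s m"
  have "flex_line F ?m" using assms i(1) by (intro flex_line_smult) simp_all
  moreover have "proj_point m = proj_point ?m"
    unfolding proj_point_eq_iff using i(1) by (intro exI[of _ "inverse (m $ i)"]) simp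
  moreover have "?m $ l \<in> V" for l using i(2)[of l] by (simp add: divide_inverse mult.commute)
  ultimately show ?thesis using i(1) that[of ?m i] by simp
qed

lemma conics_of_flex_line:
  assumes P: "homogeneous 3 P" "degenerating_cubic \<tau> (teval P)"
    and m: "flex_line (teval P) m" "m $ i = 1" "\<And>l. m $ l \<in> V"
  obtains C1 C2 C3 where
    "{plane_curve Q | Q. homogeneous 2 Q \<and> teval Q \<in> flexes_conics (teval P) m} = {C1, C2, C3}"
    "C1 \<noteq> C2" "C2 \<noteq> C3" "C1 \<noteq> C3"
    "\<And>D. has_limiting_multidegree V C1 D \<longleftrightarrow> D = {#1, 1, 0#}"
    "\<And>D. has_limiting_multidegree V C2 D \<longleftrightarrow> D = {#1, 1, 0#}"
    "\<And>D. has_limiting_multidegree V C3 D \<longleftrightarrow> D = {#2, 0, 0#}"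
proof -
  obtain j k Q1 Q2 Q3 where ijk: "i \<noteq> j" "j \<noteq> k" "i \<noteq> k" and Qs: "flexes_conics (teval P) m = {Q1, Q2, Q3}"
    and np: "\<And>c. Q1 \<noteq> (\<lambda>v. c * Q2 v)" "\<And>c. Q2 \<noteq> (\<lambda>v. c * Q3 v)" "\<And>c. Q1 \<noteq> (\<lambda>v. c * Q3 v)"
    and lim: "limits_to Q1 (\<lambda>v. v $ j * v $ k)" "limits_to Q2 (\<lambda>v. v $ j * v $ k)" "limits_to Q3 (\<lambda>v. v $ i * v $ i)"
    by (rule limits_of_flex_conics[OF P(2) m]) (rule that)
  have "\<exists>S. homogeneous 2 S \<and> teval S = Q" if "Q \<in> {Q1, Q2, Q3}" for Q
    using that unfolding Qs[symmetric] flexes_conics_def tangent_conic_fun_def form_iff by (simp add: fun_eq_iff)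
  then obtain S1 S2 S3 where S: "homogeneous 2 S1" "teval S1 = Q1" "homogeneous 2 S2" "teval S2 = Q2"
    "homogeneous 2 S3" "teval S3 = Q3" by (metis insertCI)
  have "{plane_curve Q | Q. homogeneous 2 Q \<and> teval Q \<in> {Q1, Q2, Q3}} = {plane_curve S1, plane_curve S2, plane_curve S3}"
  proof -
    have "Q = S1 \<or> Q = S2 \<or> Q = S3" if "homogeneous 2 Q" "teval Q \<in> {Q1, Q2, Q3}" for Q
      using that S quadratic_eqI[of Q] by (metis empty_iff insert_iff)
    then show ?thesis using S by blast
  qed
  moreover have distinct: "plane_curve A \<noteq> plane_curve B" if "\<And>c. teval A \<noteq> (\<lambda>v. c * teval B v)" for A B :: "'k gen ternary"
  proof
    assume "plane_curve A = plane_curve B"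
    then have "plane_curve B = plane_curve A" ..
    then obtain c where "A = const c * B" by (rule plane_curve_eqD)
    then have "teval A = (\<lambda>v. c * teval B v)" by (simp add: teval_mult fun_eq_iff)
    with that show False by blast
  qed
  have "plane_curve S1 \<noteq> plane_curve S2" "plane_curve S2 \<noteq> plane_curve S3" "plane_curve S1 \<noteq> plane_curve S3"
    using np by (intro distinct; simp add: S)+
  moreover have "has_limiting_multidegree V (plane_curve S1) D \<longleftrightarrow> D = {#1, 1, 0#}"
    "has_limiting_multidegree V (plane_curve S2) D \<longleftrightarrow> D = {#1, 1, 0#}"
    "has_limiting_multidegree V (plane_curve S3) D \<longleftrightarrow> D = {#2, 0, 0#}" for D
    using has_limiting_multidegree_iff[OF V S(1), of j k] has_limiting_multidegree_iff[OF V S(3), of j k]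
      has_limiting_multidegree_iff[OF V S(5), of i i] lim ijk by (simp_all add: S)
  ultimately show ?thesis by (rule that[unfolded Qs])
qed

text \<open>The tangent conics are partitioned by their flex line: existence of the line gives the
  covering, its uniqueness the disjointness.\<close>

lemma count_conics:
  fixes P :: "'k gen ternary"
  assumes P: "homogeneous 3 P" "degenerating_cubic \<tau> (teval P)"
  shows "card (tangent_conics P) = 27 \<and>
         card {C \<in> tangent_conics P. has_limiting_multidegree V C {#1, 1, 0#}} = 18 \<and>
         card {C \<in> tangent_conics P. has_limiting_multidegree V C {#2, 0, 0#}} = 9"
proof -
  let ?F = "teval P"
  have smooth: "smooth ?F" by (rule degenerating_cubic_smooth[OF P(2)])
  have form: "form 3 ?F" by (rule form_teval[OF P(1)])
  \<comment> \<open>At a vertex the product of the coordinates vanishes and \<tau> R remains, with R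
    outside M.\<close>
  have "?F (vec3 0 0 1) \<noteq> 0"
  proof -
    obtain e R where R: "\<And>i. R (axis i 1) \<notin> M" "\<And>v. ?F v = e * (\<Prod>i\<in>UNIV. v $ i) + \<tau> * R v" "\<tau> \<noteq> 0"
      using P(2) unfolding degenerating_cubic_def by blast
    have "vec3 0 0 1 = (axis 3 1 :: 'k gen ^ 3)" by (simp add: vec3_eq_iff axis_def)
    then have "R (vec3 0 0 1) \<notin> M" using R(1)[of 3] by simp
    then have R0: "R (vec3 0 0 1) \<noteq> 0" by auto
    have prod0: "(\<Prod>i\<in>UNIV. vec3 0 0 (1 :: 'k gen) $ i) = 0"
      by (rule prod_zero) (auto intro!: exI[of _ 1])
    show ?thesis unfolding R(2) prod0 using R(3) R0 by simp
  qed
  define L where "L = {proj_point m | m. flex_line ?F m}"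
  have L: "card L = 9" unfolding L_def by (rule card_flex_lines[OF smooth form]) fact
  then have "finite L" by (metis card.infinite zero_neq_numeral)
  \<comment> \<open>One integral covector is fixed per line, since \<open>flexes_conics\<close>
    depends on the scale.\<close>
  have "\<forall>\<mu>\<in>L. \<exists>m. proj_point m = \<mu> \<and> flex_line ?F m \<and> (\<exists>i. m $ i = 1) \<and> (\<forall>l. m $ l \<in> V)"
  proof
    fix \<mu> assume "\<mu> \<in> L"
    then obtain m where m: "\<mu> = proj_point m" "flex_line ?F m" unfolding L_def by blast
    obtain m' i where "proj_point m' = proj_point m" "flex_line ?F m'" "m' $ i = 1" "\<And>l. m' $ l \<in> V"
      by (rule normalised_flex_line[OF m(2)]) (rule that)
    then show "\<exists>m. proj_point m = \<mu> \<and> flex_line ?F m \<and> (\<exists>i. m $ i = 1) \<and> (\<forall>l. m $ l \<in> V)"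
      unfolding m(1) by (intro exI[of _ m']) auto
  qed
  then obtain rep where rep: "\<And>\<mu>. \<mu> \<in> L \<Longrightarrow> proj_point (rep \<mu>) = \<mu>" "\<And>\<mu>. \<mu> \<in> L \<Longrightarrow> flex_line ?F (rep \<mu>)"
    "\<And>\<mu>. \<mu> \<in> L \<Longrightarrow> \<exists>i. rep \<mu> $ i = 1" "\<And>\<mu> l. \<mu> \<in> L \<Longrightarrow> rep \<mu> $ l \<in> V"
    by metis
  define T where "T \<mu> = {plane_curve Q | Q. homogeneous 2 Q \<and> teval Q \<in> flexes_conics ?F (rep \<mu>)}" for \<mu>
  have union: "tangent_conics P = (\<Union>\<mu>\<in>L. T \<mu>)"
  proof (intro subset_antisym subsetI)
    fix C assume "C \<in> tangent_conics P"
    then obtain Q where Q: "C = plane_curve Q" "homogeneous 2 Q" "tangent_conic_fun ?F (teval Q)"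
      unfolding tangent_conics_eq[OF P(1)] by blast
    obtain m where m: "on_flex ?F (teval Q) m" using flex_of_tangent_conic[OF form Q(3)] by blast
    define \<mu> where "\<mu> = proj_point m"
    have "\<mu> \<in> L" unfolding L_def \<mu>_def using flex_line_if_on_flex[OF smooth m] by blast
    then have "proj_point (rep \<mu>) = proj_point m" using rep(1) by (simp add: \<mu>_def)
    then obtain c where c: "c \<noteq> 0" "m = c *s rep \<mu>" using proj_point_eq_iff by blast
    have tQ: "teval (const c * Q) = (\<lambda>v. c * teval Q v)" by (simp add: teval_mult fun_eq_iff)
    have "teval (const c * Q) \<in> flexes_conics ?F (rep \<mu>)"
      unfolding flexes_conics_def tQ using tangent_conic_fun_scale[OF Q(3) c(1)] on_flex_scale[OF c(1)] m c(2) by simp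
    moreover have "homogeneous 2 (const c * Q)"
      using homogeneous_mult[OF homogeneous_const Q(2), of c] by (simp only: add_0)
    moreover have "C = plane_curve (const c * Q)" using plane_curve_const_mult[OF c(1)] Q(1) by simp
    ultimately have "C \<in> T \<mu>" unfolding T_def by blast
    with \<open>\<mu> \<in> L\<close> show "C \<in> (\<Union>\<mu>\<in>L. T \<mu>)" by blast
  next
    fix C assume "C \<in> (\<Union>\<mu>\<in>L. T \<mu>)"
    then show "C \<in> tangent_conics P"
      unfolding tangent_conics_eq[OF P(1)] T_def flexes_conics_def by blast
  qed
  have disjoint: "T \<mu> \<inter> T \<nu> = {}" if "\<mu> \<in> L" "\<nu> \<in> L" "\<mu> \<noteq> \<nu>" for \<mu> \<nu>
  proof (rule ccontr)
    assume "T \<mu> \<inter> T \<nu> \<noteq> {}"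
    then obtain Q S where QS: "plane_curve Q = plane_curve S" "teval Q \<in> flexes_conics ?F (rep \<mu>)"
      "teval S \<in> flexes_conics ?F (rep \<nu>)"
      unfolding T_def by blast
    obtain c where c: "c \<noteq> 0" "S = const c * Q" by (rule plane_curve_eqD[OF QS(1)])
    have "teval S = (\<lambda>v. c * teval Q v)" by (simp add: c(2) teval_mult fun_eq_iff)
    then have "on_flex ?F (teval Q) (c *s rep \<nu>)"
      using QS(3) on_flex_scale[OF c(1)] by (simp add: flexes_conics_def)
    moreover have "on_flex ?F (teval Q) (rep \<mu>)" "tangent_conic_fun ?F (teval Q)"
      using QS(2) by (simp_all add: flexes_conics_def)
    ultimately have "rep \<mu> = c *s rep \<nu>" using flex_of_tangent_conic[OF form] by blast
    then have "proj_point (rep \<nu>) = proj_point (rep \<mu>)" using c(1) proj_point_eq_iff by blast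
    then show False using rep(1) that by simp
  qed
  have fibre: "finite (T \<mu>) \<and> card (T \<mu>) = 3 \<and> card {C \<in> T \<mu>. has_limiting_multidegree V C {#1, 1, 0#}} = 2
      \<and> card {C \<in> T \<mu>. has_limiting_multidegree V C {#2, 0, 0#}} = 1" if \<mu>: "\<mu> \<in> L" for \<mu>
  proof -
    obtain i where "rep \<mu> $ i = 1" using rep(3)[OF \<mu>] by blast
    then obtain C1 C2 C3 where C: "T \<mu> = {C1, C2, C3}" "C1 \<noteq> C2" "C2 \<noteq> C3" "C1 \<noteq> C3"
      "\<And>D. has_limiting_multidegree V C1 D \<longleftrightarrow> D = {#1, 1, 0#}"
      "\<And>D. has_limiting_multidegree V C2 D \<longleftrightarrow> D = {#1, 1, 0#}"
      "\<And>D. has_limiting_multidegree V C3 D \<longleftrightarrow> D = {#2, 0, 0#}"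
      by (rule conics_of_flex_line[OF P rep(2)[OF \<mu>] _ rep(4)[OF \<mu>], folded T_def]) (rule that)
    have "{#1, 1, 0#} \<noteq> {#2, 0, 0 :: nat#}"
      by (metis count_add_mset count_empty n_not_Suc_n one_neq_zero zero_neq_numeral num.distinct(1) numeral_eq_one_iff)
    then have "{C \<in> T \<mu>. has_limiting_multidegree V C {#1, 1, 0#}} = {C1, C2}"
      "{C \<in> T \<mu>. has_limiting_multidegree V C {#2, 0, 0#}} = {C3}"
      unfolding C(1) using C(5-7) by auto
    then show ?thesis using C(1-4) by simp
  qed
  have count: "card {C \<in> tangent_conics P. p C} = 9 * n"
    if "\<And>\<mu>. \<mu> \<in> L \<Longrightarrow> card {C \<in> T \<mu>. p C} = n" for p n
  proof -
    have "{C \<in> tangent_conics P. p C} = (\<Union>\<mu>\<in>L. {C \<in> T \<mu>. p C})" unfolding union by blast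
    also have "card \<dots> = (\<Sum>\<mu>\<in>L. card {C \<in> T \<mu>. p C})"
    proof (rule card_UN_disjoint[OF \<open>finite L\<close>])
      show "\<forall>\<mu>\<in>L. finite {C \<in> T \<mu>. p C}" using fibre by simp
      show "\<forall>\<mu>\<in>L. \<forall>\<nu>\<in>L. \<mu> \<noteq> \<nu> \<longrightarrow> {C \<in> T \<mu>. p C} \<inter> {C \<in> T \<nu>. p C} = {}"
        using disjoint by blast
    qed
    finally show ?thesis using that L by simp
  qed
  show ?thesis
    using count[of "\<lambda>_. True" 3] count[of _ 2] count[of _ 1] fibre by simp
qed

end

theorem mainTheorem5:
  fixes F :: "'k::{alg_closed_field, field_char_0} poly ternary"
    and U :: "'k set"
    and V :: "'k gen set"
  assumes "cubic_degeneration U F"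
    and "valuation_ring_over_0 V"
  shows "card (tangent_conics (generic_fibre F)) = 27 \<and>
         card {C \<in> tangent_conics (generic_fibre F).
                has_limiting_multidegree V C {#1, 1, 0#}} = 18 \<and>
         card {C \<in> tangent_conics (generic_fibre F).
                has_limiting_multidegree V C {#2, 0, 0#}} = 9"
proof -
  have "homogeneous 3 (generic_fibre F)"
    unfolding generic_fibre_def using assms(1)
    by (intro homogeneous_map) (simp_all add: cubic_degeneration_def)
  then show ?thesis
    by (rule count_conics[OF assms(2) _ generic_fibre_degenerating[OF assms(2,1)]])
qed

end
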